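(* (1) Let $k$ be a field. For every integer $m>4$, there exist infinitely many pairwise non-isomorphic connected finite dimensional $k$-algebras $A$ for which $\mathrm{tors}\,A$ is a left modular (equivalently, extremal) lattice of length $m$. (2) For every infinite cardinal $\aleph$, there exists a left modular and extremal lattice with $2^{\aleph}$ many maximal chains of size $\aleph$ consisting of left modular elements. (3) For every infinite cardinal $\aleph$, there exists an extremal lattice $L$ for which the set $\mathrm{LM}(L)$ of left modular elements is of size $2^{\aleph}$.
   Context: A torsion class is a full subcategory of the category of finite dimensional $A$-modules closed under isomorphisms, quotients and extensions; $\mathrm{tors}\,A$ is the complete lattice of torsion classes ordered by inclusion. Lattices are complete and possibly infinite. The length of a finite chain $x_0<\cdots<x_r$ is $r$, and the length of a lattice is the maximum of the lengths of its finite chains, if it exists. An element $x\in L$ is left modular if $(y\vee x)\wedge z=y\vee(x\wedge z)$ for all $y\leq z$; $\mathrm{LM}(L)$ is the set of left modular elements; $L$ is left modular if it has an inclusion-maximal chain of left modular elements. $\mathrm{JI}^c(L)$ is the set of completely join-irreducible elements ($x\neq\bigvee\emptyset$ with $x\neq\bigvee S$ for all $S\subseteq\{y\mid y<x\}$), with $x_*:=\bigvee\{y\mid y<x\}$; $\mathrm{MI}^c(L)$ is the dual notion. $L$ is extremal if there are a bijection $\lambda:\mathrm{JI}^c(L)\to\mathrm{MI}^c(L)$ and an inclusion-maximal chain $\mathcal X$ in $L$ such that: for all $x\in\mathcal X$ and $j\in\mathrm{JI}^c(L)$ with $j\not\leq x$ we have $x\leq\lambda(j)$; and whenever $x\lessdot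 y$ is a cover relation with $x,y\in\mathcal X$, there is a unique $j\in\mathrm{JI}^c(L)$ with $j\leq y$, $j\not\leq x$, a unique $m\in\mathrm{MI}^c(L)$ with $x\leq m$, $y\not\leq m$, and $\lambda(j)=m$. When $L$ is a $\kappa$-lattice (every element is a join of elements of $\mathrm{JI}^c(L)$ and a meet of elements of $\mathrm{MI}^c(L)$, and $\kappa(j)=\max\{x\mid x\wedge j=j_*\}$ defines a bijection $\mathrm{JI}^c(L)\to\mathrm{MI}^c(L)$ with inverse $m\mapsto\min\{y\mid y\vee m=m^*\}$, $m^*$ the unique upper cover of $m$), one takes $\lambda=\kappa$; $\mathrm{tors}\,A$ is known to be a $\kappa$-lattice. *)

theory Defs
  imports
    "HOL-Algebra.Complete_Lattice"
    "HOL-Algebra.Module"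
    "HOL-Algebra.Ideal"
    "HOL-Algebra.QuotRing"
begin

unbundle cardinal_syntax

section \<open>Complete lattices\<close>

definition chain_of :: "('a, 'b) gorder_scheme \<Rightarrow> 'a set \<Rightarrow> bool" where
  "chain_of L C \<longleftrightarrow> pred_on.chain (carrier L) (\<lambda>x y. x \<sqsubset>\<^bsub>L\<^esub> y) C"

definition maximal_chain_of :: "('a, 'b) gorder_scheme \<Rightarrow> 'a set \<Rightarrow> bool" where
  "maximal_chain_of L C \<longleftrightarrow> pred_on.maxchain (carrier L) (\<lambda>x y. x \<sqsubset>\<^bsub>L\<^esub> y) C"

text \<open>A chain \<open>x\<^sub>0 < \<dots> < x\<^sub>r\<close> has length \<open>r\<close>, hence \<open>r + 1\<close> elements.\<close>

definition has_length :: "('a, 'b) gorder_scheme \<Rightarrow> nat \<Rightarrow> bool" where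
  "has_length L r \<longleftrightarrow>
     (\<exists>C. chain_of L C \<and> finite C \<and> card C = Suc r) \<and>
     (\<forall>C. chain_of L C \<and> finite C \<longrightarrow> card C \<le> Suc r)"

definition covers :: "('a, 'b) gorder_scheme \<Rightarrow> 'a \<Rightarrow> 'a \<Rightarrow> bool" where
  "covers L x y \<longleftrightarrow> x \<in> carrier L \<and> y \<in> carrier L \<and> x \<sqsubset>\<^bsub>L\<^esub> y \<and>
     \<not> (\<exists>z\<in>carrier L. x \<sqsubset>\<^bsub>L\<^esub> z \<and> z \<sqsubset>\<^bsub>L\<^esub> y)"

definition LM :: "('a, 'b) gorder_scheme \<Rightarrow> 'a set" where
  "LM L = {x \<in> carrier L. \<forall>y\<in>carrier L. \<forall>z\<in>carrier L. y \<sqsubseteq>\<^bsub>L\<^esub> z \<longrightarrow>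
     (y \<squnion>\<^bsub>L\<^esub> x) \<sqinter>\<^bsub>L\<^esub> z = y \<squnion>\<^bsub>L\<^esub> (x \<sqinter>\<^bsub>L\<^esub> z)}"

text \<open>The chain below is maximal among all chains of \<open>L\<close>, not merely among the chains of
  left modular elements.\<close>

definition left_modular_lattice :: "('a, 'b) gorder_scheme \<Rightarrow> bool" where
  "left_modular_lattice L \<longleftrightarrow> complete_lattice L \<and> (\<exists>C. maximal_chain_of L C \<and> C \<subseteq> LM L)"

definition JIc :: "('a, 'b) gorder_scheme \<Rightarrow> 'a set" where
  "JIc L = {x \<in> carrier L. x \<noteq> \<Squnion>\<^bsub>L\<^esub>{} \<and>
     (\<forall>S. S \<subseteq> {y \<in> carrier L. y \<sqsubset>\<^bsub>L\<^esub> x} \<longrightarrow> x \<noteq> \<Squnion>\<^bsub>L\<^esub>S)}"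

definition MIc :: "('a, 'b) gorder_scheme \<Rightarrow> 'a set" where
  "MIc L = {x \<in> carrier L. x \<noteq> \<Sqinter>\<^bsub>L\<^esub>{} \<and>
     (\<forall>S. S \<subseteq> {y \<in> carrier L. x \<sqsubset>\<^bsub>L\<^esub> y} \<longrightarrow> x \<noteq> \<Sqinter>\<^bsub>L\<^esub>S)}"

definition lower_star :: "('a, 'b) gorder_scheme \<Rightarrow> 'a \<Rightarrow> 'a" where
  "lower_star L x = \<Squnion>\<^bsub>L\<^esub>{y \<in> carrier L. y \<sqsubset>\<^bsub>L\<^esub> x}"

definition upper_star :: "('a, 'b) gorder_scheme \<Rightarrow> 'a \<Rightarrow> 'a" where
  "upper_star L m = (THE u. covers L m u)"

definition is_kappa :: "('a, 'b) gorder_scheme \<Rightarrow> 'a \<Rightarrow> 'a \<Rightarrow> bool" where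
  "is_kappa L j m \<longleftrightarrow> greatest L m {x \<in> carrier L. x \<sqinter>\<^bsub>L\<^esub> j = lower_star L j}"

definition is_kappa_dual :: "('a, 'b) gorder_scheme \<Rightarrow> 'a \<Rightarrow> 'a \<Rightarrow> bool" where
  "is_kappa_dual L m j \<longleftrightarrow> least L j {y \<in> carrier L. y \<squnion>\<^bsub>L\<^esub> m = upper_star L m}"

definition kappa_lattice :: "('a, 'b) gorder_scheme \<Rightarrow> bool" where
  "kappa_lattice L \<longleftrightarrow> complete_lattice L \<and>
     (\<forall>x\<in>carrier L. \<exists>S\<subseteq>JIc L. x = \<Squnion>\<^bsub>L\<^esub>S) \<and>
     (\<forall>x\<in>carrier L. \<exists>S\<subseteq>MIc L. x = \<Sqinter>\<^bsub>L\<^esub>S) \<and>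
     (\<exists>\<kappa> \<kappa>'. (\<forall>j\<in>JIc L. is_kappa L j (\<kappa> j)) \<and> (\<forall>m\<in>MIc L. is_kappa_dual L m (\<kappa>' m)) \<and>
        bij_betw \<kappa> (JIc L) (MIc L) \<and>
        (\<forall>j\<in>JIc L. \<kappa>' (\<kappa> j) = j) \<and> (\<forall>m\<in>MIc L. \<kappa> (\<kappa>' m) = m))"

text \<open>On a \<open>\<kappa>\<close>-lattice the bijection \<open>\<lambda>\<close> is required to be \<open>\<kappa>\<close>; on any other complete lattice
  it is an arbitrary bijection.\<close>

definition extremal_lattice :: "('a, 'b) gorder_scheme \<Rightarrow> bool" where
  "extremal_lattice L \<longleftrightarrow> complete_lattice L \<and>
     (\<exists>lam X. bij_betw lam (JIc L) (MIc L) \<and>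
        (kappa_lattice L \<longrightarrow> (\<forall>j\<in>JIc L. is_kappa L j (lam j))) \<and>
        maximal_chain_of L X \<and>
        (\<forall>x\<in>X. \<forall>j\<in>JIc L. \<not> j \<sqsubseteq>\<^bsub>L\<^esub> x \<longrightarrow> x \<sqsubseteq>\<^bsub>L\<^esub> lam j) \<and>
        (\<forall>x\<in>X. \<forall>y\<in>X. covers L x y \<longrightarrow>
           (\<exists>j m. {j' \<in> JIc L. j' \<sqsubseteq>\<^bsub>L\<^esub> y \<and> \<not> j' \<sqsubseteq>\<^bsub>L\<^esub> x} = {j} \<and>
                  {m' \<in> MIc L. x \<sqsubseteq>\<^bsub>L\<^esub> m' \<and> \<not> y \<sqsubseteq>\<^bsub>L\<^esub> m'} = {m} \<and>
                  lam j = m)))"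


section \<open>Finite dimensional algebras\<close>

definition finite_dimensional ::
    "('k, 'c) ring_scheme \<Rightarrow> ('k, 'v, 'd) module_scheme \<Rightarrow> bool" where
  "finite_dimensional K V \<longleftrightarrow> (\<exists>B. finite B \<and> B \<subseteq> carrier V \<and>
     (\<forall>v\<in>carrier V. \<exists>c. c \<in> B \<rightarrow> carrier K \<and> v = (\<Oplus>\<^bsub>V\<^esub>b\<in>B. c b \<odot>\<^bsub>V\<^esub> b)))"

text \<open>Associative and unital, not necessarily commutative, unlike \<^locale>\<open>algebra\<close>.\<close>

locale fd_algebra = K?: field K + module K A + A?: ring A
  for K (structure) and A (structure) +
  assumes smult_mult_left:
    "\<lbrakk>c \<in> carrier K; a \<in> carrier A; b \<in> carrier A\<rbrakk> \<Longrightarrow>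
       (c \<odot>\<^bsub>A\<^esub> a) \<otimes>\<^bsub>A\<^esub> b = c \<odot>\<^bsub>A\<^esub> (a \<otimes>\<^bsub>A\<^esub> b)"
    and smult_mult_right:
    "\<lbrakk>c \<in> carrier K; a \<in> carrier A; b \<in> carrier A\<rbrakk> \<Longrightarrow>
       a \<otimes>\<^bsub>A\<^esub> (c \<odot>\<^bsub>A\<^esub> b) = c \<odot>\<^bsub>A\<^esub> (a \<otimes>\<^bsub>A\<^esub> b)"
    and finite_dim: "finite_dimensional K A"

text \<open>Connected: nonzero and not a direct product of two nonzero algebras. A decomposition
  \<open>A = A\<^sub>1 \<times> A\<^sub>2\<close> is the same as a decomposition of \<open>A\<close> as an internal direct sum of two
  two-sided ideals; these are automatically \<open>K\<close>-subspaces because \<open>A\<close> is unital.\<close>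

definition connected_algebra :: "('k, 'a, 'd) module_scheme \<Rightarrow> bool" where
  "connected_algebra A \<longleftrightarrow> carrier A \<noteq> {\<zero>\<^bsub>A\<^esub>} \<and>
     (\<forall>I J. ideal I A \<and> ideal J A \<and> I <+>\<^bsub>A\<^esub> J = carrier A \<and> I \<inter> J = {\<zero>\<^bsub>A\<^esub>} \<longrightarrow>
        I = {\<zero>\<^bsub>A\<^esub>} \<or> J = {\<zero>\<^bsub>A\<^esub>})"

definition algebra_isomorphic ::
    "('k, 'c) ring_scheme \<Rightarrow> ('k, 'a, 'd) module_scheme \<Rightarrow> ('k, 'b, 'e) module_scheme \<Rightarrow> bool" where
  "algebra_isomorphic K A B \<longleftrightarrow> (\<exists>f \<in> ring_iso A B.
     \<forall>c\<in>carrier K. \<forall>a\<in>carrier A. f (c \<odot>\<^bsub>A\<^esub> a) = c \<odot>\<^bsub>B\<^esub> f a)"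


section \<open>Finite dimensional modules and torsion classes\<close>

text \<open>Left modules over a possibly noncommutative ring; \<^locale>\<open>module\<close> needs a commutative one.
  The multiplicative fields of the record \<open>M\<close> are irrelevant.\<close>

locale left_module = R?: ring R + M?: abelian_group M
  for R (structure) and M (structure) +
  assumes smult_closed:
    "\<lbrakk>a \<in> carrier R; x \<in> carrier M\<rbrakk> \<Longrightarrow> a \<odot>\<^bsub>M\<^esub> x \<in> carrier M"
    and smult_l_distr:
    "\<lbrakk>a \<in> carrier R; b \<in> carrier R; x \<in> carrier M\<rbrakk> \<Longrightarrow>
       (a \<oplus>\<^bsub>R\<^esub> b) \<odot>\<^bsub>M\<^esub> x = a \<odot>\<^bsub>M\<^esub> x \<oplus>\<^bsub>M\<^esub> b \<odot>\<^bsub>M\<^esub> x"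
    and smult_r_distr:
    "\<lbrakk>a \<in> carrier R; x \<in> carrier M; y \<in> carrier M\<rbrakk> \<Longrightarrow>
       a \<odot>\<^bsub>M\<^esub> (x \<oplus>\<^bsub>M\<^esub> y) = a \<odot>\<^bsub>M\<^esub> x \<oplus>\<^bsub>M\<^esub> a \<odot>\<^bsub>M\<^esub> y"
    and smult_assoc:
    "\<lbrakk>a \<in> carrier R; b \<in> carrier R; x \<in> carrier M\<rbrakk> \<Longrightarrow>
       (a \<otimes>\<^bsub>R\<^esub> b) \<odot>\<^bsub>M\<^esub> x = a \<odot>\<^bsub>M\<^esub> (b \<odot>\<^bsub>M\<^esub> x)"
    and smult_one: "x \<in> carrier M \<Longrightarrow> \<one>\<^bsub>R\<^esub> \<odot>\<^bsub>M\<^esub> x = x"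

text \<open>The \<open>K\<close>-vector space underlying an \<open>A\<close>-module, with \<open>c\<close> acting as \<open>c \<cdot> 1\<^sub>A\<close>.\<close>

definition underlying_space ::
    "('k, 'a, 'd) module_scheme \<Rightarrow> ('a, 'm, 'e) module_scheme \<Rightarrow> ('k, 'm) module" where
  "underlying_space A M =
     \<lparr>carrier = carrier M, mult = mult M, one = one M, zero = zero M, add = add M,
      smult = (\<lambda>c x. (c \<odot>\<^bsub>A\<^esub> \<one>\<^bsub>A\<^esub>) \<odot>\<^bsub>M\<^esub> x)\<rparr>"

definition fd_module ::
    "('k, 'c) ring_scheme \<Rightarrow> ('k, 'a, 'd) module_scheme \<Rightarrow> ('a, 'm, 'e) module_scheme \<Rightarrow> bool" where
  "fd_module K A M \<longleftrightarrow> left_module A M \<and> finite_dimensional K (underlying_space A M)"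

definition left_module_hom ::
    "('k, 'a, 'd) module_scheme \<Rightarrow> ('a, 'm, 'e) module_scheme \<Rightarrow> ('a, 'n, 'f) module_scheme
       \<Rightarrow> ('m \<Rightarrow> 'n) set" where
  "left_module_hom A M N = {f \<in> carrier M \<rightarrow> carrier N.
     (\<forall>x\<in>carrier M. \<forall>y\<in>carrier M. f (x \<oplus>\<^bsub>M\<^esub> y) = f x \<oplus>\<^bsub>N\<^esub> f y) \<and>
     (\<forall>a\<in>carrier A. \<forall>x\<in>carrier M. f (a \<odot>\<^bsub>M\<^esub> x) = a \<odot>\<^bsub>N\<^esub> f x)}"

definition left_module_isomorphic ::
    "('k, 'a, 'd) module_scheme \<Rightarrow> ('a, 'm, 'e) module_scheme \<Rightarrow> ('a, 'n, 'f) module_scheme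
       \<Rightarrow> bool" where
  "left_module_isomorphic A M N \<longleftrightarrow> (\<exists>f\<in>left_module_hom A M N. bij_betw f (carrier M) (carrier N))"

definition is_quotient ::
    "('k, 'a, 'd) module_scheme \<Rightarrow> ('a, 'm, 'e) module_scheme \<Rightarrow> ('a, 'n, 'f) module_scheme
       \<Rightarrow> bool" where
  "is_quotient A M N \<longleftrightarrow> (\<exists>f\<in>left_module_hom A M N. f ` carrier M = carrier N)"

text \<open>There is a short exact sequence \<open>0 \<rightarrow> L \<rightarrow> M \<rightarrow> N \<rightarrow> 0\<close>.\<close>

definition is_extension ::
    "('k, 'a, 'd) module_scheme \<Rightarrow> ('a, 'l, 'e) module_scheme \<Rightarrow> ('a, 'm, 'f) module_scheme
       \<Rightarrow> ('a, 'n, 'g) module_scheme \<Rightarrow> bool" where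
  "is_extension A L M N \<longleftrightarrow> (\<exists>f\<in>left_module_hom A L M. \<exists>g\<in>left_module_hom A M N.
     inj_on f (carrier L) \<and> f ` carrier L = {x \<in> carrier M. g x = \<zero>\<^bsub>N\<^esub>} \<and>
     g ` carrier M = carrier N)"

text \<open>A full subcategory is given by its class of objects. The category of finite dimensional
  \<open>A\<close>-modules is represented by the modules whose elements are lists of scalars; by
  \<open>fd_module_representable\<close> below this contains every finite dimensional module up to
  isomorphism, so that the isomorphism-closed subcategories are not affected. Torsion classes
  contain the zero module; since they are closed under quotients, this amounts to nonemptiness.\<close>

definition torsion_class ::
    "('k, 'c) ring_scheme \<Rightarrow> ('k, 'a, 'd) module_scheme \<Rightarrow> ('a, 'k list) module set \<Rightarrow> bool" where
  "torsion_class K A T \<longleftrightarrow>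
     T \<subseteq> {M. fd_module K A M} \<and> T \<noteq> {} \<and>
     (\<forall>M N. M \<in> T \<and> fd_module K A N \<and> left_module_isomorphic A M N \<longrightarrow> N \<in> T) \<and>
     (\<forall>M N. M \<in> T \<and> fd_module K A N \<and> is_quotient A M N \<longrightarrow> N \<in> T) \<and>
     (\<forall>L M N. L \<in> T \<and> N \<in> T \<and> fd_module K A M \<and> is_extension A L M N \<longrightarrow> M \<in> T)"

definition tors ::
    "('k, 'c) ring_scheme \<Rightarrow> ('k, 'a, 'd) module_scheme \<Rightarrow> ('a, 'k list) module set gorder" where
  "tors K A = \<lparr>carrier = {T. torsion_class K A T}, eq = (=), le = (\<subseteq>)\<rparr>"

lemma finsum_additive:
  assumes "abelian_group V" "abelian_group N" "finite F"
    and h: "h \<in> carrier V \<rightarrow> carrier N" "h \<zero>\<^bsub>V\<^esub> = \<zero>\<^bsub>N\<^esub>"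
      "\<And>x y. \<lbrakk>x \<in> carrier V; y \<in> carrier V\<rbrakk> \<Longrightarrow> h (x \<oplus>\<^bsub>V\<^esub> y) = h x \<oplus>\<^bsub>N\<^esub> h y"
    and "f \<in> F \<rightarrow> carrier V"
  shows "h (finsum V f F) = finsum N (\<lambda>b. h (f b)) F"
proof -
  interpret V: abelian_group V by fact
  interpret N: abelian_group N by fact
  show ?thesis using \<open>finite F\<close> \<open>f \<in> F \<rightarrow> carrier V\<close>
  proof (induction F)
    case empty
    show ?case by (simp add: h(2))
  next
    case (insert b F)
    have "(\<lambda>b. h (f b)) \<in> F \<rightarrow> carrier N" "h (f b) \<in> carrier N"
      using insert.prems h(1) by auto
    moreover have "f \<in> F \<rightarrow> carrier V" "f b \<in> carrier V" using insert.prems by auto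
    ultimately show ?case using insert by (simp add: h(3) V.finsum_closed)
  qed
qed

lemma fd_module_representable:
  fixes K :: "('k, 'c) ring_scheme" and A :: "('k, 'a, 'd) module_scheme"
    and M :: "('a, 'm, 'e) module_scheme"
  assumes A: "fd_algebra K A" and M: "fd_module K A M"
  shows "\<exists>N :: ('a, 'k list) module. fd_module K A N \<and> left_module_isomorphic A M N"
proof -
  interpret A: fd_algebra K A by fact
  interpret M: left_module A M using M by (simp add: fd_module_def)
  let ?V = "underlying_space A M"
  have V_simps: "carrier ?V = carrier M" "add ?V = add M" "zero ?V = zero M"
    "\<And>c x. c \<odot>\<^bsub>?V\<^esub> x = (c \<odot>\<^bsub>A\<^esub> \<one>\<^bsub>A\<^esub>) \<odot>\<^bsub>M\<^esub> x"
    by (simp_all add: underlying_space_def)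
  have V: "abelian_group ?V"
    by (rule abelian_groupI)
      (auto simp: V_simps M.add.m_assoc intro: M.add.m_comm M.add.l_inv_ex)
  interpret V: abelian_group ?V by (fact V)
  have one: "c \<odot>\<^bsub>A\<^esub> \<one>\<^bsub>A\<^esub> \<in> carrier A" if "c \<in> carrier K" for c
    using that by (simp add: A.smult_closed)
  obtain B where B: "finite B" "B \<subseteq> carrier M"
    and span: "\<And>v. v \<in> carrier M \<Longrightarrow>
      \<exists>c. c \<in> B \<rightarrow> carrier K \<and> v = (\<Oplus>\<^bsub>?V\<^esub>b\<in>B. c b \<odot>\<^bsub>?V\<^esub> b)"
    using M unfolding fd_module_def finite_dimensional_def V_simps(1) by blast
  obtain bs where bs: "set bs = B" using finite_list[OF B(1)] by blast
  obtain co where co: "\<And>v. v \<in> carrier M \<Longrightarrow> co v \<in> B \<rightarrow> carrier K"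
      "\<And>v. v \<in> carrier M \<Longrightarrow> v = (\<Oplus>\<^bsub>?V\<^esub>b\<in>B. co v b \<odot>\<^bsub>?V\<^esub> b)"
    using span by metis
  have cl: "(\<lambda>b. c b \<odot>\<^bsub>?V\<^esub> b) \<in> B \<rightarrow> carrier ?V" if "c \<in> B \<rightarrow> carrier K" for c
    using that B(2) by (auto simp: V_simps intro!: M.smult_closed one)
  define e where "e v = map (co v) bs" for v
  have inj: "inj_on e (carrier M)"
  proof (rule inj_onI)
    fix v w assume v: "v \<in> carrier M" and w: "w \<in> carrier M" and "e v = e w"
    hence eq: "\<And>b. b \<in> B \<Longrightarrow> co v b = co w b" using bs by (auto simp: e_def)
    have "(\<Oplus>\<^bsub>?V\<^esub>b\<in>B. co v b \<odot>\<^bsub>?V\<^esub> b) = (\<Oplus>\<^bsub>?V\<^esub>b\<in>B. co w b \<odot>\<^bsub>?V\<^esub> b)"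
      by (rule V.finsum_cong') (use cl[OF co(1)[OF w]] eq in auto)
    with co(2)[OF v] co(2)[OF w] show "v = w" by simp
  qed
  define h where "h = inv_into (carrier M) e"
  have he [simp]: "h (e x) = x" if "x \<in> carrier M" for x
    using that inj by (simp add: h_def)
  define N :: "('a, 'k list) module" where "N = \<lparr>carrier = e ` carrier M,
    mult = undefined, one = undefined, zero = e \<zero>\<^bsub>M\<^esub>, add = (\<lambda>x y. e (h x \<oplus>\<^bsub>M\<^esub> h y)),
    smult = (\<lambda>a x. e (a \<odot>\<^bsub>M\<^esub> h x))\<rparr>"
  have N_simps: "carrier N = e ` carrier M" "zero N = e \<zero>\<^bsub>M\<^esub>"
    "\<And>x y. x \<oplus>\<^bsub>N\<^esub> y = e (h x \<oplus>\<^bsub>M\<^esub> h y)" "\<And>a x. a \<odot>\<^bsub>N\<^esub> x = e (a \<odot>\<^bsub>M\<^esub> h x)"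
    by (simp_all add: N_def)
  have N: "abelian_group N"
  proof (rule abelian_groupI)
    fix x assume "x \<in> carrier N"
    then obtain u where u: "u \<in> carrier M" "x = e u" by (auto simp: N_simps)
    show "\<exists>y\<in>carrier N. y \<oplus>\<^bsub>N\<^esub> x = \<zero>\<^bsub>N\<^esub>"
      by (rule bexI[of _ "e (\<ominus>\<^bsub>M\<^esub> u)"]) (use u in \<open>auto simp: N_simps M.l_neg\<close>)
  qed (auto simp: N_simps M.a_ac)
  have lm: "left_module A N"
  proof (intro left_module.intro left_module_axioms.intro N)
    show "ring A" by (rule A.A.ring_axioms)
  qed (auto simp: N_simps M.smult_closed M.smult_l_distr M.smult_r_distr M.smult_assoc M.smult_one)
  have W: "abelian_group (underlying_space A N)"
    by (rule abelian_groupI) (insert abelian_groupE[OF N], auto simp: underlying_space_def)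
  interpret W: abelian_group "underlying_space A N" by (fact W)
  have W_simps: "carrier (underlying_space A N) = e ` carrier M"
    "zero (underlying_space A N) = e \<zero>\<^bsub>M\<^esub>"
    "\<And>x y. x \<oplus>\<^bsub>underlying_space A N\<^esub> y = e (h x \<oplus>\<^bsub>M\<^esub> h y)"
    "\<And>c x. c \<odot>\<^bsub>underlying_space A N\<^esub> x = e ((c \<odot>\<^bsub>A\<^esub> \<one>\<^bsub>A\<^esub>) \<odot>\<^bsub>M\<^esub> h x)"
    by (simp_all add: underlying_space_def N_simps)
  have fd: "finite_dimensional K (underlying_space A N)"
    unfolding finite_dimensional_def
  proof (intro exI[of _ "e ` B"] conjI ballI)
    show "finite (e ` B)" using B(1) by simp
    show "e ` B \<subseteq> carrier (underlying_space A N)" using B(2) by (auto simp: W_simps)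
    fix w assume "w \<in> carrier (underlying_space A N)"
    then obtain v where v: "v \<in> carrier M" "w = e v" by (auto simp: W_simps)
    have injB: "inj_on e B" using inj B(2) by (rule inj_on_subset)
    have c: "(\<lambda>y. co v (h y)) \<in> e ` B \<rightarrow> carrier K" using co(1)[OF v(1)] B(2) by force
    have "w = e (\<Oplus>\<^bsub>?V\<^esub>b\<in>B. co v b \<odot>\<^bsub>?V\<^esub> b)" using co(2)[OF v(1)] v(2) by simp
    also have "\<dots> = (\<Oplus>\<^bsub>underlying_space A N\<^esub>b\<in>B. e (co v b \<odot>\<^bsub>?V\<^esub> b))"
      by (rule finsum_additive[OF V W B(1) _ _ _ cl[OF co(1)[OF v(1)]]])
        (auto simp: V_simps W_simps)
    also have "\<dots> = (\<Oplus>\<^bsub>underlying_space A N\<^esub>b\<in>B. co v (h (e b)) \<odot>\<^bsub>underlying_space A N\<^esub> e b)"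
    proof (rule W.finsum_cong')
      show "(\<lambda>b. co v (h (e b)) \<odot>\<^bsub>underlying_space A N\<^esub> e b) \<in> B \<rightarrow> carrier (underlying_space A N)"
        using co(1)[OF v(1)] B(2) by (auto simp: W_simps subset_iff Pi_iff intro!: imageI M.smult_closed one)
    qed (use B(2) in \<open>auto simp: V_simps W_simps subset_iff\<close>)
    also have "\<dots> = (\<Oplus>\<^bsub>underlying_space A N\<^esub>y\<in>e ` B. co v (h y) \<odot>\<^bsub>underlying_space A N\<^esub> y)"
      by (rule W.finsum_reindex[symmetric])
        (use injB co(1)[OF v(1)] B(2) in \<open>auto simp: W_simps subset_iff Pi_iff intro!: imageI M.smult_closed one\<close>)
    finally show "\<exists>c. c \<in> e ` B \<rightarrow> carrier K \<and>
        w = (\<Oplus>\<^bsub>underlying_space A N\<^esub>b\<in>e ` B. c b \<odot>\<^bsub>underlying_space A N\<^esub> b)"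
      using c by blast
  qed
  have "left_module_isomorphic A M N" unfolding left_module_isomorphic_def
  proof (rule bexI[of _ e])
    show "bij_betw e (carrier M) (carrier N)" using inj by (simp add: bij_betw_def N_simps)
    show "e \<in> left_module_hom A M N" by (auto simp: left_module_hom_def N_simps)
  qed
  with lm fd show ?thesis unfolding fd_module_def by blast
qed

end

theory Submission
  imports Defs
begin

text \<open>
  For the statements about infinite cardinals, the lattice of all subsets of a set \<open>F\<close> of the given
  cardinality serves both purposes. It is distributive, so all its elements are left modular, and any
  maximal chain shows that it is extremal, a singleton being matched with its complement. The initial
  segments of a well-order of \<open>F\<close> form a maximal chain of the size of \<open>F\<close>, and this chain determines
  the well-order. Exchanging points within disjoint pairs gives as many well-orders as \<open>F\<close> has
  subsets; conversely there are no more families of subsets of that size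
  (\<open>many_ofilter_chains\<close>, \<open>card_families_le\<close>).

  For the statement about algebras, let \<open>B\<close> be given by the quiver \<open>0 \<rightarrow> 1 \<rightarrow> \<dots> \<rightarrow> n - 1\<close> together with
  loops \<open>x, z\<^sub>1, \<dots>, z\<^sub>N\<close> at \<open>0\<close>, where all products of two arrows or loops vanish, except possibly the
  path \<open>a x\<close> that goes first around \<open>x\<close> and then along the arrow \<open>a\<close> from \<open>0\<close> to \<open>1\<close>. The loops
  \<open>z\<^sub>1, \<dots>, z\<^sub>N\<close> do not change the lattice of torsion classes, but they make the dimension arbitrarily
  large; this is where infinitely many algebras come from. The length of the lattice is \<open>2 n - 1\<close> if
  \<open>a x = 0\<close> and \<open>2 n\<close> otherwise.

  The torsion classes are found as follows. If \<open>e\<close> is an idempotent and \<open>e f = f\<close>, then the modules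
  \<open>M\<close> with \<open>e M = f M\<close> form a torsion class (\<open>torsion_class_factor_class\<close>). For the idempotent \<open>e\<close> of
  a vertex \<open>i\<close> this is applied to \<open>f = 0\<close>, to \<open>f = a x\<close> if \<open>i = 1\<close>, to the arrow \<open>f\<close> that ends in \<open>i\<close>, if
  \<open>i > 0\<close>, and to \<open>f = e\<close>. These conditions become weaker and weaker; call
  their positions the levels of \<open>i\<close>. Every torsion class \<open>T\<close> is an intersection of such classes, one for each vertex (\<open>torsion_of_level\<close>): if \<open>M\<close>
  lies in the intersection, then some module in \<open>T\<close> has a nonzero homomorphism to \<open>M\<close>, whose image is
  in \<open>T\<close>, and the quotient by the image is smaller (\<open>subset_torsion_class_by_homs\<close>). A family of
  levels occurs if and only if a level below the top at \<open>i\<close> only permits the bottom and the top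
  level at \<open>i + 1\<close> (\<open>admissible_level\<close>, \<open>level_torsion_of\<close>).

  Thus the lattice consists of the admissible families of levels, and joins are pointwise maxima.
  Starting from the bottom, raise the level of vertex \<open>0\<close> step by step to the top, then that of vertex
  \<open>1\<close>, and so on. The resulting chain is maximal, its elements are left modular (\<open>rung_LM\<close>), and for each
  step, from \<open>u\<close> to \<open>v\<close>, there is a least element that is below \<open>v\<close> but not below \<open>u\<close>, and a greatest
  element that is above \<open>u\<close> but not above \<open>v\<close> (\<open>ladder\<close>). In the locale
  \<open>left_modular_ladder\<close> these data are shown to imply that the lattice is left modular and extremal,
  and that its length is that of the chain.
\<close>


section \<open>Left modular chains in complete lattices\<close>

context complete_lattice
begin

lemma lless_iff: "x \<sqsubset> y \<longleftrightarrow> x \<sqsubseteq> y \<and> x \<noteq> y"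
  by (simp add: lless_def eq_is_equal)

lemma chain_of_iff:
  "chain_of L C \<longleftrightarrow> C \<subseteq> carrier L \<and> (\<forall>a\<in>C. \<forall>b\<in>C. a \<sqsubseteq> b \<or> b \<sqsubseteq> a)"
proof
  assume "chain_of L C"
  then have "C \<subseteq> carrier L" and "\<forall>a\<in>C. \<forall>b\<in>C. a = b \<or> a \<sqsubset> b \<or> b \<sqsubset> a"
    by (auto simp: chain_of_def pred_on.chain_def)
  then show "C \<subseteq> carrier L \<and> (\<forall>a\<in>C. \<forall>b\<in>C. a \<sqsubseteq> b \<or> b \<sqsubseteq> a)"
    by (metis le_refl lless_iff subsetD)
next
  assume "C \<subseteq> carrier L \<and> (\<forall>a\<in>C. \<forall>b\<in>C. a \<sqsubseteq> b \<or> b \<sqsubseteq> a)"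
  then show "chain_of L C"
    by (auto simp: chain_of_def pred_on.chain_def lless_iff)
qed

lemma maximal_chain_of_iff:
  "maximal_chain_of L C \<longleftrightarrow> chain_of L C \<and>
     (\<forall>z\<in>carrier L. (\<forall>a\<in>C. a \<sqsubseteq> z \<or> z \<sqsubseteq> a) \<longrightarrow> z \<in> C)"
proof
  assume *: "maximal_chain_of L C"
  then have C: "chain_of L C" and max: "\<And>S. chain_of L S \<Longrightarrow> C \<subseteq> S \<Longrightarrow> S = C"
    by (auto simp: maximal_chain_of_def pred_on.maxchain_def chain_of_def)
  have "z \<in> C" if z: "z \<in> carrier L" "\<forall>a\<in>C. a \<sqsubseteq> z \<or> z \<sqsubseteq> a" for z
  proof -
    have "chain_of L (insert z C)"
      using C z by (auto simp: chain_of_iff)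
    from max[OF this] show ?thesis by blast
  qed
  with C show "chain_of L C \<and> (\<forall>z\<in>carrier L. (\<forall>a\<in>C. a \<sqsubseteq> z \<or> z \<sqsubseteq> a) \<longrightarrow> z \<in> C)" by blast
next
  assume *: "chain_of L C \<and> (\<forall>z\<in>carrier L. (\<forall>a\<in>C. a \<sqsubseteq> z \<or> z \<sqsubseteq> a) \<longrightarrow> z \<in> C)"
  have "S = C" if S: "chain_of L S" "C \<subseteq> S" for S
  proof
    show "S \<subseteq> C"
    proof
      fix z assume "z \<in> S"
      with S have "z \<in> carrier L" "\<forall>a\<in>C. a \<sqsubseteq> z \<or> z \<sqsubseteq> a" by (auto simp: chain_of_iff)
      with * show "z \<in> C" by simp
    qed
  qed (fact S(2))
  with * show "maximal_chain_of L C"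
    by (auto simp: maximal_chain_of_def pred_on.maxchain_def chain_of_def)
qed

lemma lower_star_upper:
  assumes "y \<in> carrier L" "y \<sqsubset> x"
  shows "y \<sqsubseteq> lower_star L x"
  unfolding lower_star_def by (rule sup_upper) (use assms in auto)

lemma lower_star_least:
  assumes "b \<in> carrier L" "\<And>y. y \<in> carrier L \<Longrightarrow> y \<sqsubset> x \<Longrightarrow> y \<sqsubseteq> b"
  shows "lower_star L x \<sqsubseteq> b"
  unfolding lower_star_def by (rule sup_least) (use assms in auto)

text \<open>The element \<open>z\<close> of the modular law disappears from this criterion: for \<open>w = (y \<squnion> x) \<sqinter> z\<close> the element
\<open>v\<close> lies below \<open>x \<sqinter> z\<close>, so that \<open>w \<sqsubseteq> y \<squnion> (x \<sqinter> z)\<close>; the reverse inequality holds in every lattice.\<close>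

lemma LM_if_small_approximation:
  assumes x: "x \<in> carrier L"
    and ap: "\<And>y w. \<lbrakk>y \<in> carrier L; w \<in> carrier L; w \<sqsubseteq> y \<squnion> x\<rbrakk> \<Longrightarrow>
       \<exists>v\<in>carrier L. v \<sqsubseteq> x \<and> v \<sqsubseteq> w \<and> w \<sqsubseteq> y \<squnion> v"
  shows "x \<in> LM L"
  unfolding LM_def
proof (intro CollectI conjI ballI impI x)
  fix y z assume y: "y \<in> carrier L" and z: "z \<in> carrier L" and "y \<sqsubseteq> z"
  let ?w = "(y \<squnion> x) \<sqinter> z"
  have w: "?w \<in> carrier L" "?w \<sqsubseteq> y \<squnion> x" "?w \<sqsubseteq> z"
    using x y z by (auto intro: meet_left meet_right)
  obtain v where v: "v \<in> carrier L" "v \<sqsubseteq> x" "v \<sqsubseteq> ?w" "?w \<sqsubseteq> y \<squnion> v"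
    using ap[OF y w(1,2)] by blast
  have "v \<sqsubseteq> z" using v w z le_trans by blast
  then have vxz: "v \<sqsubseteq> x \<sqinter> z" using v x z by (simp add: meet_le)
  have "y \<squnion> v \<sqsubseteq> y \<squnion> (x \<sqinter> z)"
  proof (rule join_le)
    show "v \<sqsubseteq> y \<squnion> (x \<sqinter> z)"
      using le_trans[OF vxz join_right[of y "x \<sqinter> z"]] v x y z by simp
  qed (use x y z v in \<open>auto intro: join_left\<close>)
  then have 1: "?w \<sqsubseteq> y \<squnion> (x \<sqinter> z)"
    using le_trans[OF v(4)] w v x y z by simp
  have 2: "y \<squnion> (x \<sqinter> z) \<sqsubseteq> ?w"
  proof (rule meet_le)
    show "y \<squnion> (x \<sqinter> z) \<sqsubseteq> y \<squnion> x"
      using x y z le_trans[OF meet_left[OF x z] join_right[OF y x]]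
      by (intro join_le) (auto intro: join_left)
    show "y \<squnion> (x \<sqinter> z) \<sqsubseteq> z"
      using x y z \<open>y \<sqsubseteq> z\<close> by (intro join_le) (auto intro: meet_right)
  qed (use x y z in auto)
  show "?w = y \<squnion> (x \<sqinter> z)"
    using 1 2 x y z by (intro le_antisym) auto
qed

end

text \<open>A rank function that is bounded by \<open>len\<close>, and a chain of left modular elements \<open>x 0, \<dots>, x len\<close> that
realises every rank. The elements \<open>j i\<close> and \<open>mu i\<close> will turn out to be the completely join-irreducible
and the completely meet-irreducible element that label the step from \<open>x i\<close> to \<open>x (Suc i)\<close>.\<close>

locale left_modular_ladder = complete_lattice +
  fixes rk :: "'a \<Rightarrow> nat" and len :: nat and x :: "nat \<Rightarrow> 'a" and j mu :: "nat \<Rightarrow> 'a"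
  assumes rk_strict: "\<lbrakk>a \<in> carrier L; b \<in> carrier L; a \<sqsubset> b\<rbrakk> \<Longrightarrow> rk a < rk b"
    and rk_le: "a \<in> carrier L \<Longrightarrow> rk a \<le> len"
    and x_LM: "i \<le> len \<Longrightarrow> x i \<in> LM L"
    and rk_x: "i \<le> len \<Longrightarrow> rk (x i) = i"
    and x_step: "i < len \<Longrightarrow> x i \<sqsubseteq> x (Suc i)"
    and j_least: "i < len \<Longrightarrow> least L (j i) {z \<in> carrier L. z \<sqsubseteq> x (Suc i) \<and> \<not> z \<sqsubseteq> x i}"
    and mu_greatest: "i < len \<Longrightarrow> greatest L (mu i) {z \<in> carrier L. x i \<sqsubseteq> z \<and> \<not> x (Suc i) \<sqsubseteq> z}"
begin

lemma x_closed [simp, intro]: "i \<le> len \<Longrightarrow> x i \<in> carrier L"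
  using x_LM by (simp add: LM_def)

lemma left_modular:
  assumes "i \<le> len" "y \<in> carrier L" "z \<in> carrier L" "y \<sqsubseteq> z"
  shows "(y \<squnion> x i) \<sqinter> z = y \<squnion> (x i \<sqinter> z)"
  using x_LM[OF assms(1)] assms(2-) by (simp add: LM_def)

lemma eq_if_rk_le:
  assumes "a \<in> carrier L" "b \<in> carrier L" "a \<sqsubseteq> b" "rk b \<le> rk a"
  shows "a = b"
  using rk_strict[OF assms(1,2)] assms(3,4) by (auto simp: lless_iff)

lemma x_mono: "i \<le> k \<Longrightarrow> k \<le> len \<Longrightarrow> x i \<sqsubseteq> x k"
proof (induction k rule: dec_induct)
  case (step k)
  then show ?case using le_trans[of "x i" "x k" "x (Suc k)"] x_step[of k] by auto
qed auto

lemma x_0_le: "a \<in> carrier L \<Longrightarrow> x 0 \<sqsubseteq> a"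
proof -
  assume a: "a \<in> carrier L"
  have "\<bottom> = x 0"
    by (rule eq_if_rk_le) (use rk_x[of 0] in auto)
  with a show ?thesis by (metis bottom_lower)
qed

lemma le_x_len: "a \<in> carrier L \<Longrightarrow> a \<sqsubseteq> x len"
proof -
  assume a: "a \<in> carrier L"
  have "x len = \<top>"
    by (rule eq_if_rk_le) (use rk_x[of len] rk_le in auto)
  with a show ?thesis by (metis top_higher)
qed

lemma j_props:
  assumes "i < len"
  shows "j i \<in> carrier L" "j i \<sqsubseteq> x (Suc i)" "\<not> j i \<sqsubseteq> x i"
    and "\<And>z. \<lbrakk>z \<in> carrier L; z \<sqsubseteq> x (Suc i); \<not> z \<sqsubseteq> x i\<rbrakk> \<Longrightarrow> j i \<sqsubseteq> z"
  using j_least[OF assms] by (auto simp: least_def)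

lemma mu_props:
  assumes "i < len"
  shows "mu i \<in> carrier L" "x i \<sqsubseteq> mu i" "\<not> x (Suc i) \<sqsubseteq> mu i"
    and "\<And>z. \<lbrakk>z \<in> carrier L; x i \<sqsubseteq> z; \<not> x (Suc i) \<sqsubseteq> z\<rbrakk> \<Longrightarrow> z \<sqsubseteq> mu i"
  using mu_greatest[OF assms] by (auto simp: greatest_def)

text \<open>Between consecutive rungs there is no room, because the rank only rises by one.\<close>

lemma between_rungs:
  assumes "i < len" "a \<in> carrier L" "x i \<sqsubseteq> a" "a \<sqsubseteq> x (Suc i)"
  shows "a = x i \<or> a = x (Suc i)"
proof (rule disjCI)
  assume "a \<noteq> x (Suc i)"
  then have "rk a < Suc i"
    using rk_strict[of a "x (Suc i)"] assms by (auto simp: lless_iff rk_x)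
  then show "a = x i"
    using eq_if_rk_le[of "x i" a] assms by (auto simp: rk_x)
qed

lemma x_join_j: "i < len \<Longrightarrow> j i \<squnion> x i = x (Suc i)"
proof -
  assume i: "i < len"
  note p = j_props[OF i]
  have "j i \<squnion> x i \<sqsubseteq> x (Suc i)"
    using p i x_step by (intro join_le) auto
  moreover have "x i \<sqsubseteq> j i \<squnion> x i" "j i \<sqsubseteq> j i \<squnion> x i"
    using p i by (auto intro: join_left join_right)
  ultimately show ?thesis
    using between_rungs[OF i, of "j i \<squnion> x i"] p i by auto
qed

lemma x_meet_mu: "i < len \<Longrightarrow> x (Suc i) \<sqinter> mu i = x i"
proof -
  assume i: "i < len"
  note p = mu_props[OF i]
  have "x i \<sqsubseteq> x (Suc i) \<sqinter> mu i"
    using p i x_step by (intro meet_le) auto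
  moreover have "x (Suc i) \<sqinter> mu i \<sqsubseteq> x (Suc i)" "x (Suc i) \<sqinter> mu i \<sqsubseteq> mu i"
    using p i by (auto intro: meet_left meet_right)
  ultimately show ?thesis
    using between_rungs[OF i, of "x (Suc i) \<sqinter> mu i"] p i by auto
qed

lemma below_j:
  assumes "i < len" "y \<in> carrier L" "y \<sqsubset> j i"
  shows "y \<sqsubseteq> x i"
proof (rule ccontr)
  note p = j_props[OF assms(1)]
  assume "\<not> y \<sqsubseteq> x i"
  moreover have "y \<sqsubseteq> x (Suc i)"
    using le_trans[of y "j i" "x (Suc i)"] assms p by (auto simp: lless_iff)
  ultimately have "j i \<sqsubseteq> y" using p(4) assms(2) by blast
  with assms(2,3) p(1) show False by (auto simp: lless_iff)
qed

lemma above_mu: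
  assumes "i < len" "y \<in> carrier L" "mu i \<sqsubset> y"
  shows "x (Suc i) \<sqsubseteq> y"
proof (rule ccontr)
  note p = mu_props[OF assms(1)]
  assume "\<not> x (Suc i) \<sqsubseteq> y"
  moreover have "x i \<sqsubseteq> y"
    using le_trans[of "x i" "mu i" y] assms p by (auto simp: lless_iff)
  ultimately have "y \<sqsubseteq> mu i" using p(4) assms(2) by blast
  with assms(2,3) p(1) show False by (auto simp: lless_iff)
qed

lemma j_in_JIc: "i < len \<Longrightarrow> j i \<in> JIc L"
proof -
  assume i: "i < len"
  note p = j_props[OF i]
  have "j i \<noteq> \<Squnion>S" if "S \<subseteq> {y \<in> carrier L. y \<sqsubset> j i}" for S
  proof -
    have "\<Squnion>S \<sqsubseteq> x i"
      by (rule sup_least) (use that below_j[OF i] i in auto)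
    with p(3) show ?thesis by metis
  qed
  from this this[of "{}"] p(1) show ?thesis by (auto simp: JIc_def)
qed

lemma mu_in_MIc: "i < len \<Longrightarrow> mu i \<in> MIc L"
proof -
  assume i: "i < len"
  note p = mu_props[OF i]
  have "mu i \<noteq> \<Sqinter>S" if "S \<subseteq> {y \<in> carrier L. mu i \<sqsubset> y}" for S
  proof -
    have "x (Suc i) \<sqsubseteq> \<Sqinter>S"
      by (rule inf_greatest) (use that above_mu[OF i] i in auto)
    with p(3) show ?thesis by metis
  qed
  from this this[of "{}"] p(1) show ?thesis by (auto simp: MIc_def)
qed

text \<open>Left modularity of \<open>x i\<close> splits every element \<open>a\<close> of the step from \<open>x i\<close> to \<open>x (Suc i)\<close>
  as \<open>a = j i \<squnion> (x i \<sqinter> a)\<close>. The second part lies strictly below \<open>a\<close>, so if \<open>a\<close> is completely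
  join-irreducible, then the first part is \<open>a\<close> itself.\<close>

lemma JIc_in_step:
  assumes i: "i < len" and a: "a \<in> JIc L" "a \<sqsubseteq> x (Suc i)" "\<not> a \<sqsubseteq> x i"
  shows "a = j i"
proof (rule ccontr)
  assume ne: "a \<noteq> j i"
  note p = j_props[OF i]
  have ac: "a \<in> carrier L" using a by (simp add: JIc_def)
  have le: "j i \<sqsubseteq> a" using p(4)[OF ac] a by blast
  have "a = x (Suc i) \<sqinter> a"
    using a(2) ac i by (intro le_antisym) (auto intro: meet_le meet_right)
  also have "\<dots> = j i \<squnion> (x i \<sqinter> a)"
    using left_modular[of i "j i" a] x_join_j[OF i] p(1) ac le i by simp
  also have "\<dots> = \<Squnion>{j i, x i \<sqinter> a}" by (simp add: join_def)
  finally have "a = \<Squnion>{j i, x i \<sqinter> a}" .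
  moreover have "x i \<sqinter> a \<sqsubseteq> a" "x i \<sqinter> a \<noteq> a"
    using ac i meet_right[of "x i" a] meet_left[of "x i" a] a(3) by auto
  then have "{j i, x i \<sqinter> a} \<subseteq> {y \<in> carrier L. y \<sqsubset> a}"
    using ne le ac p(1) i by (auto simp: lless_iff)
  ultimately show False using a(1) unfolding JIc_def by blast
qed

text \<open>Dually, \<open>a = (a \<squnion> x (Suc i)) \<sqinter> mu i\<close>, by left modularity of \<open>x (Suc i)\<close>.\<close>

lemma MIc_in_step:
  assumes i: "i < len" and a: "a \<in> MIc L" "x i \<sqsubseteq> a" "\<not> x (Suc i) \<sqsubseteq> a"
  shows "a = mu i"
proof (rule ccontr)
  assume ne: "a \<noteq> mu i"
  note p = mu_props[OF i]
  have ac: "a \<in> carrier L" using a by (simp add: MIc_def)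
  have le: "a \<sqsubseteq> mu i" using p(4)[OF ac] a by blast
  have "a = a \<squnion> x i"
    using a(2) ac i by (intro le_antisym) (auto intro: join_le join_left)
  also have "\<dots> = (a \<squnion> x (Suc i)) \<sqinter> mu i"
    using left_modular[of "Suc i" a "mu i"] x_meet_mu[OF i] p(1) ac le i by simp
  also have "\<dots> = \<Sqinter>{a \<squnion> x (Suc i), mu i}" by (simp add: meet_def)
  finally have "a = \<Sqinter>{a \<squnion> x (Suc i), mu i}" .
  moreover have "a \<sqsubseteq> a \<squnion> x (Suc i)" "a \<squnion> x (Suc i) \<noteq> a"
    using ac i join_right[of a "x (Suc i)"] join_left[of a "x (Suc i)"] a(3) by auto
  then have "{a \<squnion> x (Suc i), mu i} \<subseteq> {y \<in> carrier L. a \<sqsubset> y}"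
    using ne le ac p(1) i by (auto simp: lless_iff)
  ultimately show False using a(1) unfolding MIc_def by blast
qed

text \<open>An element that is not the bottom enters the chain at exactly one step.\<close>

lemma JIc_eq: "JIc L = j ` {..<len}"
proof
  show "JIc L \<subseteq> j ` {..<len}"
  proof
    fix a assume a: "a \<in> JIc L"
    then have ac: "a \<in> carrier L" by (simp add: JIc_def)
    have a0: "\<not> a \<sqsubseteq> x 0"
    proof
      assume "a \<sqsubseteq> x 0"
      then have "a \<sqsubseteq> \<Squnion>{}" using le_trans[OF _ x_0_le[of "\<Squnion>{}"]] ac by simp
      moreover have "\<Squnion>{} \<sqsubseteq> a" by (rule sup_least) (use ac in auto)
      ultimately have "a = \<Squnion>{}" using ac by (intro le_antisym) auto
      with a show False by (simp add: JIc_def)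
    qed
    define k where "k = (LEAST k. a \<sqsubseteq> x k)"
    have k: "a \<sqsubseteq> x k" unfolding k_def using le_x_len[OF ac] by (rule LeastI)
    have kl: "k \<le> len" unfolding k_def using le_x_len[OF ac] by (rule Least_le)
    obtain i where i: "k = Suc i" using k a0 by (cases k) auto
    have "\<not> a \<sqsubseteq> x i" using not_less_Least[of i "\<lambda>k. a \<sqsubseteq> x k"] i k_def by simp
    with JIc_in_step[of i a] a k i kl show "a \<in> j ` {..<len}" by auto
  qed
  show "j ` {..<len} \<subseteq> JIc L" using j_in_JIc by auto
qed

lemma MIc_eq: "MIc L = mu ` {..<len}"
proof
  show "MIc L \<subseteq> mu ` {..<len}"
  proof
    fix a assume a: "a \<in> MIc L"
    then have ac: "a \<in> carrier L" by (simp add: MIc_def)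
    have al: "\<not> x len \<sqsubseteq> a"
    proof
      assume "x len \<sqsubseteq> a"
      then have "\<Sqinter>{} \<sqsubseteq> a" using le_trans[OF le_x_len[of "\<Sqinter>{}"]] ac by simp
      moreover have "a \<sqsubseteq> \<Sqinter>{}" by (rule inf_greatest) (use ac in auto)
      ultimately have "a = \<Sqinter>{}" using ac by (intro le_antisym) auto
      with a show False by (simp add: MIc_def)
    qed
    define k where "k = (LEAST k. \<not> x k \<sqsubseteq> a)"
    have k: "\<not> x k \<sqsubseteq> a" unfolding k_def using al by (rule LeastI)
    have kl: "k \<le> len" unfolding k_def using al by (rule Least_le)
    obtain i where i: "k = Suc i" using k x_0_le[OF ac] by (cases k) auto
    have "x i \<sqsubseteq> a" using not_less_Least[of i "\<lambda>k. \<not> x k \<sqsubseteq> a"] i k_def by simp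
    with MIc_in_step[of i a] a k i kl show "a \<in> mu ` {..<len}" by auto
  qed
  show "mu ` {..<len} \<subseteq> MIc L" using mu_in_MIc by auto
qed

lemma j_le_x_iff: "i < len \<Longrightarrow> k \<le> len \<Longrightarrow> j i \<sqsubseteq> x k \<longleftrightarrow> i < k"
proof -
  assume i: "i < len" and k: "k \<le> len"
  note p = j_props[OF i]
  show ?thesis
  proof (cases "i < k")
    case True
    then show ?thesis using le_trans[OF p(2) x_mono[of "Suc i" k]] p(1) i k by auto
  next
    case False
    then have "x k \<sqsubseteq> x i" using x_mono[of k i] i by auto
    then show ?thesis using p(1,3) le_trans[of "j i" "x k" "x i"] i k False by auto
  qed
qed

lemma x_le_mu_iff: "i < len \<Longrightarrow> k \<le> len \<Longrightarrow> x k \<sqsubseteq> mu i \<longleftrightarrow> k \<le> i"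
proof -
  assume i: "i < len" and k: "k \<le> len"
  note p = mu_props[OF i]
  show ?thesis
  proof (cases "k \<le> i")
    case True
    then show ?thesis using le_trans[OF x_mono[of k i] p(2)] p(1) i k by auto
  next
    case False
    then have "x (Suc i) \<sqsubseteq> x k" using x_mono[of "Suc i" k] k by auto
    then show ?thesis using p(1,3) le_trans[of "x (Suc i)" "x k" "mu i"] i k False by auto
  qed
qed

lemma inj_j: "inj_on j {..<len}"
proof (rule linorder_inj_onI')
  fix i k assume "i \<in> {..<len}" "k \<in> {..<len}" "i < k"
  then have "j i \<sqsubseteq> x k" "\<not> j k \<sqsubseteq> x k" by (simp_all add: j_le_x_iff)
  then show "j i \<noteq> j k" by metis
qed

lemma inj_mu: "inj_on mu {..<len}"
proof (rule linorder_inj_onI')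
  fix i k assume "i \<in> {..<len}" "k \<in> {..<len}" "i < k"
  then have "\<not> x k \<sqsubseteq> mu i" "x k \<sqsubseteq> mu k" by (simp_all add: x_le_mu_iff)
  then show "mu i \<noteq> mu k" by metis
qed

lemma chain_of_rungs: "chain_of L (x ` {..len})"
  unfolding chain_of_iff
proof (intro conjI ballI)
  fix a b assume "a \<in> x ` {..len}" "b \<in> x ` {..len}"
  then show "a \<sqsubseteq> b \<or> b \<sqsubseteq> a" using x_mono by (auto) (meson linear)
qed auto

lemma maximal_chain_of_rungs: "maximal_chain_of L (x ` {..len})"
  unfolding maximal_chain_of_iff
proof (intro conjI ballI impI chain_of_rungs)
  fix z assume z: "z \<in> carrier L" and cmp: "\<forall>a\<in>x ` {..len}. a \<sqsubseteq> z \<or> z \<sqsubseteq> a"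
  have r: "rk z \<le> len" using rk_le[OF z] .
  have "x (rk z) \<sqsubseteq> z \<or> z \<sqsubseteq> x (rk z)" using cmp r by auto
  then have "z = x (rk z)"
    using eq_if_rk_le[of z "x (rk z)"] eq_if_rk_le[of "x (rk z)" z] z r rk_x by auto
  with r show "z \<in> x ` {..len}" by auto
qed

theorem left_modular_lattice: "left_modular_lattice L"
  unfolding left_modular_lattice_def
  using maximal_chain_of_rungs x_LM complete_lattice_axioms by blast

theorem has_length: "has_length L len"
  unfolding has_length_def
proof (intro conjI allI impI exI[of _ "x ` {..len}"])
  have "inj_on x {..len}" by (rule inj_on_inverseI[of _ rk]) (simp add: rk_x)
  then show "card (x ` {..len}) = Suc len" by (simp add: card_image)
  fix C assume C: "chain_of L C \<and> finite C"
  have "inj_on rk C"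
  proof (rule inj_onI)
    fix a b assume "a \<in> C" "b \<in> C" "rk a = rk b"
    with C show "a = b" unfolding chain_of_iff by (metis eq_if_rk_le order_refl subsetD)
  qed
  moreover have "rk ` C \<subseteq> {..len}" using C rk_le by (auto simp: chain_of_iff)
  ultimately have "card C \<le> card {..len}" using card_inj_on_le by blast
  then show "card C \<le> Suc len" by simp
qed (use chain_of_rungs in auto)

text \<open>As every element strictly below \<open>j i\<close> is below \<open>x i\<close>, one has \<open>x i \<sqinter> j i = lower_star L (j i)\<close>. Hence
\<open>\<kappa> (j i)\<close> is above \<open>x i\<close> and not above \<open>x (Suc i)\<close>, which identifies it as \<open>mu i\<close>.\<close>

lemma kappa_of_step:
  assumes k: "kappa_lattice L" and i: "i < len"
  shows "is_kappa L (j i) (mu i)"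
proof -
  obtain \<kappa> where kap: "\<And>a. a \<in> JIc L \<Longrightarrow> is_kappa L a (\<kappa> a)" and bij: "bij_betw \<kappa> (JIc L) (MIc L)"
    using k unfolding kappa_lattice_def by blast
  note p = j_props[OF i]
  have ji: "j i \<in> JIc L" by (rule j_in_JIc[OF i])
  have g: "greatest L (\<kappa> (j i)) {y \<in> carrier L. y \<sqinter> j i = lower_star L (j i)}"
    using kap[OF ji] by (simp add: is_kappa_def)
  have ls: "lower_star L (j i) \<in> carrier L" by (auto simp: lower_star_def)
  have lsx: "lower_star L (j i) \<sqsubseteq> x i"
    by (rule lower_star_least) (use below_j[OF i] i in auto)
  have m: "x i \<sqinter> j i = lower_star L (j i)"
  proof (rule le_antisym)
    show "x i \<sqinter> j i \<sqsubseteq> lower_star L (j i)"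
      using p i meet_left[of "x i" "j i"] meet_right[of "x i" "j i"]
      by (intro lower_star_upper) (auto simp: lless_iff)
    have "lower_star L (j i) \<sqsubseteq> j i"
      by (rule lower_star_least) (use p in \<open>auto simp: lless_iff\<close>)
    then show "lower_star L (j i) \<sqsubseteq> x i \<sqinter> j i" using lsx p i ls by (intro meet_le) auto
  qed (use p i ls in auto)
  have kc: "\<kappa> (j i) \<in> carrier L" and ke: "\<kappa> (j i) \<sqinter> j i = lower_star L (j i)"
    using g by (auto simp: greatest_def)
  have "x i \<sqsubseteq> \<kappa> (j i)" using greatest_le[OF g] m i by auto
  moreover have "\<not> x (Suc i) \<sqsubseteq> \<kappa> (j i)"
  proof
    assume "x (Suc i) \<sqsubseteq> \<kappa> (j i)"
    then have "j i \<sqsubseteq> \<kappa> (j i)" using le_trans[OF p(2)] p(1) kc i by auto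
    then have "j i \<sqsubseteq> \<kappa> (j i) \<sqinter> j i" using p(1) kc by (intro meet_le) auto
    then show False using p(1,3) ke ls lsx i le_trans[of "j i" "lower_star L (j i)" "x i"] by auto
  qed
  moreover have "\<kappa> (j i) \<in> MIc L" using bij ji by (auto simp: bij_betw_def)
  ultimately have "\<kappa> (j i) = mu i" using MIc_in_step[OF i] by blast
  with kap[OF ji] show ?thesis by simp
qed

theorem extremal_lattice: "extremal_lattice L"
proof -
  define lam where "lam = mu \<circ> the_inv_into {..<len} j"
  have lam: "lam (j i) = mu i" if "i < len" for i
    using that inj_j by (simp add: lam_def the_inv_into_f_f)
  have "bij_betw j {..<len} (JIc L)" "bij_betw mu {..<len} (MIc L)"
    by (simp_all add: bij_betw_def inj_j inj_mu JIc_eq MIc_eq)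
  then have bij: "bij_betw lam (JIc L) (MIc L)"
    unfolding lam_def using bij_betw_the_inv_into bij_betw_trans by blast
  have step: "\<exists>j' m'. {a \<in> JIc L. a \<sqsubseteq> b \<and> \<not> a \<sqsubseteq> a'} = {j'} \<and>
      {m \<in> MIc L. a' \<sqsubseteq> m \<and> \<not> b \<sqsubseteq> m} = {m'} \<and> lam j' = m'"
    if "a' \<in> x ` {..len}" "b \<in> x ` {..len}" "covers L a' b" for a' b
  proof -
    obtain i k where ik: "i \<le> len" "a' = x i" "k \<le> len" "b = x k" using \<open>a' \<in> _\<close> \<open>b \<in> _\<close> by auto
    have lt: "x i \<sqsubset> x k" and no: "\<not> (\<exists>z\<in>carrier L. x i \<sqsubset> z \<and> z \<sqsubset> x k)"
      using \<open>covers L a' b\<close> ik by (auto simp: covers_def)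
    have "i < k" using rk_strict[OF _ _ lt] ik rk_x by auto
    have "k = Suc i"
    proof (rule ccontr)
      assume "k \<noteq> Suc i"
      with \<open>i < k\<close> have "Suc i < k" by simp
      then have "x i \<sqsubset> x (Suc i)" "x (Suc i) \<sqsubset> x k"
        using x_mono[of i "Suc i"] x_mono[of "Suc i" k] ik rk_x[of i] rk_x[of "Suc i"] rk_x[of k]
        by (auto simp: lless_iff)
      with no ik \<open>Suc i < k\<close> show False by auto
    qed
    with ik have i: "i < len" by simp
    have "{a \<in> JIc L. a \<sqsubseteq> b \<and> \<not> a \<sqsubseteq> a'} = {j i}"
      unfolding ik \<open>k = Suc i\<close>
      using JIc_in_step[OF i] j_props(2,3)[OF i] j_in_JIc[OF i] by blast
    moreover have "{m \<in> MIc L. a' \<sqsubseteq> m \<and> \<not> b \<sqsubseteq> m} = {mu i}"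
      unfolding ik \<open>k = Suc i\<close>
      using MIc_in_step[OF i] mu_props(2,3)[OF i] mu_in_MIc[OF i] by blast
    ultimately show ?thesis using lam[OF i] by blast
  qed
  show ?thesis
    unfolding extremal_lattice_def
  proof (intro conjI exI[of _ lam] exI[of _ "x ` {..len}"] ballI impI complete_lattice_axioms bij
      maximal_chain_of_rungs)
    fix a assume "kappa_lattice L" "a \<in> JIc L"
    then show "is_kappa L a (lam a)" using kappa_of_step lam by (auto simp: JIc_eq)
  next
    fix y a assume "y \<in> x ` {..len}" "a \<in> JIc L" "\<not> a \<sqsubseteq> y"
    then show "y \<sqsubseteq> lam a" using lam j_le_x_iff x_le_mu_iff by (auto simp: JIc_eq not_less)
  next
    fix a b assume "a \<in> x ` {..len}" "b \<in> x ` {..len}" "covers L a b"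
    then show "\<exists>j' m'. {c \<in> JIc L. c \<sqsubseteq> b \<and> \<not> c \<sqsubseteq> a} = {j'} \<and>
        {m \<in> MIc L. a \<sqsubseteq> m \<and> \<not> b \<sqsubseteq> m} = {m'} \<and> lam j' = m'"
      by (rule step)
  qed
qed

end

section \<open>Linear algebra over a field\<close>

text \<open>Generation is phrased with submodules instead of linear combinations, because images and preimages
under linear maps are then immediate; \<open>generates_iff\<close> translates.\<close>

definition generates where
  "generates K V B \<longleftrightarrow> (\<forall>U. submodule U K V \<longrightarrow> B \<subseteq> U \<longrightarrow> carrier V \<subseteq> U)"

text \<open>For a finite dimensional vector space this is the dimension. It serves as an induction measure and
as an invariant of algebras, because it drops when passing to a proper quotient.\<close>

definition min_generators where
  "min_generators K V =
     (LEAST d. \<exists>B. finite B \<and> card B = d \<and> B \<subseteq> carrier V \<and> generates K V B)"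

context module
begin

lemma minus_zero [simp]: "\<ominus>\<^bsub>M\<^esub> \<zero>\<^bsub>M\<^esub> = \<zero>\<^bsub>M\<^esub>"
  using M.r_neg[of "\<zero>\<^bsub>M\<^esub>"] by simp

lemma submodule_addD:
  assumes "submodule U R M"
  shows "U \<subseteq> carrier M" "\<zero>\<^bsub>M\<^esub> \<in> U"
    "\<And>a b. a \<in> U \<Longrightarrow> b \<in> U \<Longrightarrow> a \<oplus>\<^bsub>M\<^esub> b \<in> U"
    "\<And>a b. a \<in> carrier R \<Longrightarrow> b \<in> U \<Longrightarrow> a \<odot>\<^bsub>M\<^esub> b \<in> U"
    "\<And>a. a \<in> U \<Longrightarrow> \<ominus>\<^bsub>M\<^esub> a \<in> U"
proof -
  note e = submoduleE[OF assms]
  show "U \<subseteq> carrier M" "\<And>a b. a \<in> U \<Longrightarrow> b \<in> U \<Longrightarrow> a \<oplus>\<^bsub>M\<^esub> b \<in> U"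
    "\<And>a b. a \<in> carrier R \<Longrightarrow> b \<in> U \<Longrightarrow> a \<odot>\<^bsub>M\<^esub> b \<in> U"
    "\<And>a. a \<in> U \<Longrightarrow> \<ominus>\<^bsub>M\<^esub> a \<in> U"
    using e by blast+
  obtain u where u: "u \<in> U" using e(2) by blast
  then have "\<zero> \<odot>\<^bsub>M\<^esub> u \<in> U" using e(4) by simp
  with u e(1) show "\<zero>\<^bsub>M\<^esub> \<in> U" by (simp add: subset_iff)
qed

lemma submoduleI':
  assumes "U \<subseteq> carrier M" "\<zero>\<^bsub>M\<^esub> \<in> U"
    "\<And>a b. a \<in> U \<Longrightarrow> b \<in> U \<Longrightarrow> a \<oplus>\<^bsub>M\<^esub> b \<in> U"
    "\<And>a b. a \<in> carrier R \<Longrightarrow> b \<in> U \<Longrightarrow> a \<odot>\<^bsub>M\<^esub> b \<in> U"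
  shows "submodule U R M"
proof (rule submoduleI)
  fix a assume a: "a \<in> U"
  then have "(\<ominus> \<one>) \<odot>\<^bsub>M\<^esub> a \<in> U" using assms(4) by simp
  with a assms(1) show "\<ominus>\<^bsub>M\<^esub> a \<in> U" by (simp add: smult_l_minus subset_iff)
qed (use assms in auto)

lemma finsum_in_submodule:
  assumes U: "submodule U R M" and "finite B" "B \<subseteq> U" "c \<in> B \<rightarrow> carrier R"
  shows "(\<Oplus>\<^bsub>M\<^esub>b\<in>B. c b \<odot>\<^bsub>M\<^esub> b) \<in> U"
  using assms(2-)
proof (induction B)
  case (insert b B)
  have "b \<in> carrier M" "B \<subseteq> carrier M" using insert submodule_addD(1)[OF U] by auto
  then have "(\<Oplus>\<^bsub>M\<^esub>b\<in>insert b B. c b \<odot>\<^bsub>M\<^esub> b) = c b \<odot>\<^bsub>M\<^esub> b \<oplus>\<^bsub>M\<^esub> (\<Oplus>\<^bsub>M\<^esub>b\<in>B. c b \<odot>\<^bsub>M\<^esub> b)"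
    using insert by (intro M.finsum_insert) auto
  then show ?case using insert submodule_addD[OF U] by auto
qed (use submodule_addD(2)[OF U] in simp)

lemma combinations_submodule:
  assumes B: "finite B" "B \<subseteq> carrier M"
  shows "submodule {v. \<exists>c. c \<in> B \<rightarrow> carrier R \<and> v = (\<Oplus>\<^bsub>M\<^esub>b\<in>B. c b \<odot>\<^bsub>M\<^esub> b)} R M" (is "submodule ?U R M")
proof (rule submoduleI')
  have cl: "(\<lambda>b. c b \<odot>\<^bsub>M\<^esub> b) \<in> B \<rightarrow> carrier M" if "c \<in> B \<rightarrow> carrier R" for c
    using that B by auto
  show "?U \<subseteq> carrier M" using cl by (auto intro!: M.finsum_closed)
  have "\<zero>\<^bsub>M\<^esub> = (\<Oplus>\<^bsub>M\<^esub>b\<in>B. \<zero> \<odot>\<^bsub>M\<^esub> b)"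
  proof -
    have "(\<Oplus>\<^bsub>M\<^esub>b\<in>B. \<zero> \<odot>\<^bsub>M\<^esub> b) = (\<Oplus>\<^bsub>M\<^esub>b\<in>B. \<zero>\<^bsub>M\<^esub>)"
      using B by (intro M.finsum_cong') auto
    then show ?thesis by simp
  qed
  then show "\<zero>\<^bsub>M\<^esub> \<in> ?U" by (intro CollectI exI[of _ "\<lambda>_. \<zero>"]) auto
  fix v w assume "v \<in> ?U" "w \<in> ?U"
  then obtain c d where cd: "c \<in> B \<rightarrow> carrier R" "d \<in> B \<rightarrow> carrier R"
    and e: "v = (\<Oplus>\<^bsub>M\<^esub>b\<in>B. c b \<odot>\<^bsub>M\<^esub> b)" "w = (\<Oplus>\<^bsub>M\<^esub>b\<in>B. d b \<odot>\<^bsub>M\<^esub> b)" by blast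
  have "v \<oplus>\<^bsub>M\<^esub> w = (\<Oplus>\<^bsub>M\<^esub>b\<in>B. c b \<odot>\<^bsub>M\<^esub> b \<oplus>\<^bsub>M\<^esub> d b \<odot>\<^bsub>M\<^esub> b)"
    unfolding e using cl[OF cd(1)] cl[OF cd(2)] by (rule M.finsum_addf[symmetric])
  also have "\<dots> = (\<Oplus>\<^bsub>M\<^esub>b\<in>B. (c b \<oplus> d b) \<odot>\<^bsub>M\<^esub> b)"
    using cd B by (intro M.finsum_cong') (auto simp: smult_l_distr Pi_iff subset_iff)
  finally show "v \<oplus>\<^bsub>M\<^esub> w \<in> ?U"
    using cd by (intro CollectI exI[of _ "\<lambda>b. c b \<oplus> d b"]) auto
next
  fix a w assume a: "a \<in> carrier R" and "w \<in> ?U"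
  then obtain c where c: "c \<in> B \<rightarrow> carrier R" and e: "w = (\<Oplus>\<^bsub>M\<^esub>b\<in>B. c b \<odot>\<^bsub>M\<^esub> b)" by blast
  have "a \<odot>\<^bsub>M\<^esub> w = (\<Oplus>\<^bsub>M\<^esub>b\<in>B. a \<odot>\<^bsub>M\<^esub> (c b \<odot>\<^bsub>M\<^esub> b))"
    unfolding e using a c B by (intro finsum_smult_ldistr) auto
  also have "\<dots> = (\<Oplus>\<^bsub>M\<^esub>b\<in>B. (a \<otimes> c b) \<odot>\<^bsub>M\<^esub> b)"
    using a c B by (intro M.finsum_cong') (auto simp: smult_assoc1 Pi_iff subset_iff)
  finally show "a \<odot>\<^bsub>M\<^esub> w \<in> ?U"
    using a c by (intro CollectI exI[of _ "\<lambda>b. a \<otimes> c b"]) auto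
qed

lemma generates_iff:
  assumes B: "finite B" "B \<subseteq> carrier M"
  shows "generates R M B \<longleftrightarrow>
    (\<forall>v\<in>carrier M. \<exists>c. c \<in> B \<rightarrow> carrier R \<and> v = (\<Oplus>\<^bsub>M\<^esub>b\<in>B. c b \<odot>\<^bsub>M\<^esub> b))"
proof
  let ?U = "{v. \<exists>c. c \<in> B \<rightarrow> carrier R \<and> v = (\<Oplus>\<^bsub>M\<^esub>b\<in>B. c b \<odot>\<^bsub>M\<^esub> b)}"
  assume g: "generates R M B"
  have "B \<subseteq> ?U"
  proof
    fix b assume b: "b \<in> B"
    have "(\<Oplus>\<^bsub>M\<^esub>b'\<in>B. (if b = b' then \<one> else \<zero>) \<odot>\<^bsub>M\<^esub> b') = (\<Oplus>\<^bsub>M\<^esub>b'\<in>B. if b = b' then b' else \<zero>\<^bsub>M\<^esub>)"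
      using B by (intro M.finsum_cong') auto
    also have "\<dots> = b" using B b by (intro M.finsum_singleton[where f = "\<lambda>b. b"]) auto
    finally show "b \<in> ?U"
      by (intro CollectI exI[of _ "\<lambda>b'. if b = b' then \<one> else \<zero>"]) auto
  qed
  with g combinations_submodule[OF B] show "\<forall>v\<in>carrier M. \<exists>c. c \<in> B \<rightarrow> carrier R \<and> v = (\<Oplus>\<^bsub>M\<^esub>b\<in>B. c b \<odot>\<^bsub>M\<^esub> b)"
    unfolding generates_def by blast
next
  assume *: "\<forall>v\<in>carrier M. \<exists>c. c \<in> B \<rightarrow> carrier R \<and> v = (\<Oplus>\<^bsub>M\<^esub>b\<in>B. c b \<odot>\<^bsub>M\<^esub> b)"
  show "generates R M B"
    unfolding generates_def
  proof (intro allI impI subsetI)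
    fix U v assume U: "submodule U R M" "B \<subseteq> U" and v: "v \<in> carrier M"
    obtain c where "c \<in> B \<rightarrow> carrier R" "v = (\<Oplus>\<^bsub>M\<^esub>b\<in>B. c b \<odot>\<^bsub>M\<^esub> b)" using * v by blast
    with finsum_in_submodule[OF U(1) B(1) U(2)] show "v \<in> U" by simp
  qed
qed

lemma finite_dimensional_iff:
  "finite_dimensional R M \<longleftrightarrow> (\<exists>B. finite B \<and> B \<subseteq> carrier M \<and> generates R M B)"
  unfolding finite_dimensional_def using generates_iff by blast

lemma min_generators_attained:
  assumes "finite_dimensional R M"
  obtains B where "finite B" "card B = min_generators R M" "B \<subseteq> carrier M" "generates R M B"
proof -
  have "\<exists>d B. finite B \<and> card B = d \<and> B \<subseteq> carrier M \<and> generates R M B"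
    using assms by (auto simp: finite_dimensional_iff)
  from LeastI_ex[OF this] show ?thesis
    using that by (auto simp: min_generators_def)
qed

end

locale linear_map =
  V?: module K V + W?: module K W for K (structure) and V (structure) and W (structure) +
  fixes h
  assumes h_closed [simp, intro]: "v \<in> carrier V \<Longrightarrow> h v \<in> carrier W"
    and h_add: "\<lbrakk>v \<in> carrier V; w \<in> carrier V\<rbrakk> \<Longrightarrow> h (v \<oplus>\<^bsub>V\<^esub> w) = h v \<oplus>\<^bsub>W\<^esub> h w"
    and h_smult: "\<lbrakk>c \<in> carrier K; v \<in> carrier V\<rbrakk> \<Longrightarrow> h (c \<odot>\<^bsub>V\<^esub> v) = c \<odot>\<^bsub>W\<^esub> h v"
begin

lemma h_zero: "h \<zero>\<^bsub>V\<^esub> = \<zero>\<^bsub>W\<^esub>"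
  using h_smult[of \<zero> "\<zero>\<^bsub>V\<^esub>"] by simp

lemma preimage_submodule:
  assumes U: "submodule U K W"
  shows "submodule {v \<in> carrier V. h v \<in> U} K V"
  by (rule V.submoduleI') (auto simp: h_zero h_add h_smult W.submodule_addD[OF U])

lemma generates_image:
  assumes B: "B \<subseteq> carrier V" "generates K V B" and surj: "h ` carrier V = carrier W"
  shows "generates K W (h ` B)"
  unfolding generates_def
proof (intro allI impI)
  fix U assume U: "submodule U K W" "h ` B \<subseteq> U"
  have "B \<subseteq> {v \<in> carrier V. h v \<in> U}" using U(2) B(1) by auto
  with B(2) preimage_submodule[OF U(1)] have "carrier V \<subseteq> {v \<in> carrier V. h v \<in> U}"
    unfolding generates_def by blast
  then have "h ` carrier V \<subseteq> U" by auto
  then show "carrier W \<subseteq> U" using surj by simp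
qed

lemma finite_dimensional_image:
  assumes "finite_dimensional K V" "h ` carrier V = carrier W"
  shows "finite_dimensional K W"
proof -
  obtain B where B: "finite B" "B \<subseteq> carrier V" "generates K V B"
    using assms(1) V.finite_dimensional_iff by blast
  then have "finite (h ` B)" "h ` B \<subseteq> carrier W" "generates K W (h ` B)"
    using generates_image[OF B(2,3) assms(2)] by auto
  then show ?thesis using W.finite_dimensional_iff by blast
qed

lemma min_generators_image_le:
  assumes "finite_dimensional K V" "h ` carrier V = carrier W"
  shows "min_generators K W \<le> min_generators K V"
proof -
  obtain B where B: "finite B" "card B = min_generators K V" "B \<subseteq> carrier V" "generates K V B"
    using V.min_generators_attained[OF assms(1)] .
  have "min_generators K W \<le> card (h ` B)"
    unfolding min_generators_def
    using B generates_image[OF B(3,4) assms(2)] by (intro Least_le) auto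
  then show ?thesis using card_image_le[OF B(1), of h] B(2) by simp
qed

text \<open>A nonzero \<open>v\<close> in the kernel is a combination of a minimal generating set \<open>B\<close>, in which some \<open>b\<close> has a
nonzero coefficient. In the image, \<open>b\<close> is redundant.\<close>

lemma min_generators_image_less:
  assumes K: "field K" and fd: "finite_dimensional K V" and surj: "h ` carrier V = carrier W"
    and v: "v \<in> carrier V" "v \<noteq> \<zero>\<^bsub>V\<^esub>" "h v = \<zero>\<^bsub>W\<^esub>"
  shows "min_generators K W < min_generators K V"
proof -
  interpret K: field K by (fact K)
  obtain B where B: "finite B" "card B = min_generators K V" "B \<subseteq> carrier V" "generates K V B"
    using V.min_generators_attained[OF fd] .
  obtain c where c: "c \<in> B \<rightarrow> carrier K" "v = (\<Oplus>\<^bsub>V\<^esub>b\<in>B. c b \<odot>\<^bsub>V\<^esub> b)"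
    using V.generates_iff[OF B(1,3)] B(4) v(1) by blast
  have "\<exists>b\<in>B. c b \<noteq> \<zero>"
  proof (rule ccontr)
    assume "\<not> (\<exists>b\<in>B. c b \<noteq> \<zero>)"
    then have "v = (\<Oplus>\<^bsub>V\<^esub>b\<in>B. \<zero>\<^bsub>V\<^esub>)"
      unfolding c(2) using B(3) by (intro V.M.finsum_cong') auto
    with v(2) show False by simp
  qed
  then obtain b where b: "b \<in> B" "c b \<noteq> \<zero>" by blast
  have bV: "b \<in> carrier V" and cb: "c b \<in> carrier K" using b B(3) c by auto
  let ?B = "B - {b}"
  have B': "finite ?B" "?B \<subseteq> carrier V" "c \<in> ?B \<rightarrow> carrier K" using B c by auto
  have sum: "v = c b \<odot>\<^bsub>V\<^esub> b \<oplus>\<^bsub>V\<^esub> (\<Oplus>\<^bsub>V\<^esub>b\<in>?B. c b \<odot>\<^bsub>V\<^esub> b)"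
  proof -
    have "(\<Oplus>\<^bsub>V\<^esub>b\<in>insert b ?B. c b \<odot>\<^bsub>V\<^esub> b) = c b \<odot>\<^bsub>V\<^esub> b \<oplus>\<^bsub>V\<^esub> (\<Oplus>\<^bsub>V\<^esub>b\<in>?B. c b \<odot>\<^bsub>V\<^esub> b)"
      using B' bV cb by (intro V.M.finsum_insert) auto
    then show ?thesis using b c by (simp add: insert_absorb)
  qed
  have "generates K W (h ` ?B)"
    unfolding generates_def
  proof (intro allI impI)
    fix U assume U: "submodule U K W" "h ` ?B \<subseteq> U"
    let ?P = "{v \<in> carrier V. h v \<in> U}"
    have P: "submodule ?P K V" by (rule preimage_submodule[OF U(1)])
    note PD = V.submodule_addD[OF P]
    have BP: "?B \<subseteq> ?P" using U(2) B' by auto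
    then have s: "(\<Oplus>\<^bsub>V\<^esub>b\<in>?B. c b \<odot>\<^bsub>V\<^esub> b) \<in> ?P" (is "?s \<in> _")
      using V.finsum_in_submodule[OF P B'(1)] B'(3) by blast
    have "v \<in> ?P" using v W.submodule_addD(2)[OF U(1)] by simp
    have "c b \<odot>\<^bsub>V\<^esub> b = v \<oplus>\<^bsub>V\<^esub> (\<ominus>\<^bsub>V\<^esub> ?s)"
      unfolding sum[symmetric] using sum bV cb s PD(1)
      by (metis (no_types, lifting) V.M.add.inv_solve_right V.smult_closed subsetD v(1))
    then have "c b \<odot>\<^bsub>V\<^esub> b \<in> ?P" using PD(3)[OF \<open>v \<in> ?P\<close> PD(5)[OF s]] by simp
    then have "inv c b \<odot>\<^bsub>V\<^esub> (c b \<odot>\<^bsub>V\<^esub> b) \<in> ?P"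
      using PD(4)[of "inv c b"] b cb K.field_Units by simp
    moreover have "inv c b \<odot>\<^bsub>V\<^esub> (c b \<odot>\<^bsub>V\<^esub> b) = b"
      using b cb bV K.field_Units by (simp add: V.smult_assoc1[symmetric] V.R.Units_l_inv)
    ultimately have "B \<subseteq> ?P" using BP by auto
    with B(4) P have "carrier V \<subseteq> ?P" unfolding generates_def by blast
    then have "h ` carrier V \<subseteq> U" by auto
    then show "carrier W \<subseteq> U" using surj by simp
  qed
  then have "min_generators K W \<le> card (h ` ?B)"
    unfolding min_generators_def using B' by (intro Least_le exI[of _ "h ` ?B"]) auto
  also have "\<dots> \<le> card ?B" using B'(1) by (rule card_image_le)
  also have "\<dots> < card B" using B(1) b by (intro psubset_card_mono) auto
  finally show ?thesis using B(2) by simp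
qed

end

lemma (in linear_map) linear_map_inverse:
  assumes bij: "bij_betw h (carrier V) (carrier W)"
  shows "linear_map K W V (inv_into (carrier V) h)"
proof (intro linear_map.intro linear_map_axioms.intro V.module_axioms W.module_axioms)
  let ?g = "inv_into (carrier V) h"
  have g: "?g w \<in> carrier V" "h (?g w) = w" if "w \<in> carrier W" for w
    using that bij by (auto simp: bij_betw_def inv_into_into f_inv_into_f)
  have gh: "?g (h v) = v" if "v \<in> carrier V" for v
    using that bij by (simp add: bij_betw_def)
  show "?g w \<in> carrier V" if "w \<in> carrier W" for w using g that by simp
  show "?g (v \<oplus>\<^bsub>W\<^esub> w) = ?g v \<oplus>\<^bsub>V\<^esub> ?g w" if "v \<in> carrier W" "w \<in> carrier W" for v w
    using gh[of "?g v \<oplus>\<^bsub>V\<^esub> ?g w"] g[OF that(1)] g[OF that(2)] by (simp add: h_add)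
  show "?g (c \<odot>\<^bsub>W\<^esub> v) = c \<odot>\<^bsub>V\<^esub> ?g v" if "c \<in> carrier K" "v \<in> carrier W" for c v
    using gh[of "c \<odot>\<^bsub>V\<^esub> ?g v"] g[OF that(2)] that(1) by (simp add: h_smult)
qed

text \<open>By Zorn's lemma there is a subspace \<open>H\<close> that contains \<open>U\<close> and is maximal among those that avoid \<open>v\<close>.
It is a hyperplane, and \<open>f w\<close> is the coefficient \<open>c\<close> with \<open>w - c v \<in> H\<close>.\<close>

lemma linear_functional_exists:
  fixes K (structure) and V (structure)
  assumes "field K" "module K V" "submodule U K V" "v \<in> carrier V" "v \<notin> U"
  shows "\<exists>f. f \<in> carrier V \<rightarrow> carrier K \<and> f v = \<one>\<^bsub>K\<^esub> \<and> (\<forall>u\<in>U. f u = \<zero>\<^bsub>K\<^esub>) \<and>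
    (\<forall>x\<in>carrier V. \<forall>y\<in>carrier V. f (x \<oplus>\<^bsub>V\<^esub> y) = f x \<oplus>\<^bsub>K\<^esub> f y) \<and>
    (\<forall>c\<in>carrier K. \<forall>x\<in>carrier V. f (c \<odot>\<^bsub>V\<^esub> x) = c \<otimes>\<^bsub>K\<^esub> f x)"
proof -
  interpret K: field K by fact
  interpret V: module K V by fact
  define S where "S = {H. submodule H K V \<and> U \<subseteq> H \<and> v \<notin> H}"
  have "\<exists>H\<in>S. \<forall>X\<in>S. H \<subseteq> X \<longrightarrow> X = H"
  proof (rule subset_Zorn_nonempty)
    show "S \<noteq> {}" using assms by (auto simp: S_def)
    fix C assume C: "C \<noteq> {}" "subset.chain S C"
    then have CS: "C \<subseteq> S" and lin: "\<And>X Y. X \<in> C \<Longrightarrow> Y \<in> C \<Longrightarrow> X \<subseteq> Y \<or> Y \<subseteq> X"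
      by (auto simp: subset.chain_def)
    have "submodule (\<Union>C) K V"
    proof (rule V.submoduleI')
      note D = V.submodule_addD
      show "\<Union>C \<subseteq> carrier V" using CS D(1) by (fastforce simp: S_def)
      show "\<zero>\<^bsub>V\<^esub> \<in> \<Union>C" using C(1) CS D(2) by (fastforce simp: S_def)
      show "a \<odot>\<^bsub>V\<^esub> b \<in> \<Union>C" if "a \<in> carrier K" "b \<in> \<Union>C" for a b
        using that CS D(4) by (fastforce simp: S_def)
      fix a b assume "a \<in> \<Union>C" "b \<in> \<Union>C"
      then obtain X where X: "X \<in> C" "a \<in> X" "b \<in> X" using lin by (metis UnionE subsetD)
      then have "submodule X K V" using CS by (auto simp: S_def)
      from D(3)[OF this X(2,3)] X(1) show "a \<oplus>\<^bsub>V\<^esub> b \<in> \<Union>C" by blast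
    qed
    then show "\<Union>C \<in> S" using C(1) CS by (auto simp: S_def)
  qed
  then obtain H where "H \<in> S" and max: "\<And>X. X \<in> S \<Longrightarrow> H \<subseteq> X \<Longrightarrow> X = H"
    by blast
  then have H: "submodule H K V" "U \<subseteq> H" "v \<notin> H" by (simp_all add: S_def)
  note D = V.submodule_addD[OF H(1)]
  have v: "v \<in> carrier V" by fact
  have span: "\<exists>c\<in>carrier K. w \<ominus>\<^bsub>V\<^esub> c \<odot>\<^bsub>V\<^esub> v \<in> H" if w: "w \<in> carrier V" for w
  proof (cases "w \<in> H")
    case True
    then show ?thesis using w v by (intro bexI[of _ \<zero>]) (simp_all add: V.M.minus_eq)
  next
    case False
    define X where "X = {x \<in> carrier V. \<exists>c\<in>carrier K. x \<ominus>\<^bsub>V\<^esub> c \<odot>\<^bsub>V\<^esub> w \<in> H}"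
    have "submodule X K V"
    proof (rule V.submoduleI')
      show "X \<subseteq> carrier V" by (auto simp: X_def)
      show "\<zero>\<^bsub>V\<^esub> \<in> X" using w D(2) by (auto simp: X_def V.M.minus_eq intro!: bexI[of _ \<zero>])
    next
      fix a b assume "a \<in> X" "b \<in> X"
      then obtain c d where c: "a \<in> carrier V" "c \<in> carrier K" "a \<ominus>\<^bsub>V\<^esub> c \<odot>\<^bsub>V\<^esub> w \<in> H"
        and d: "b \<in> carrier V" "d \<in> carrier K" "b \<ominus>\<^bsub>V\<^esub> d \<odot>\<^bsub>V\<^esub> w \<in> H"
        by (auto simp: X_def)
      have "(a \<oplus>\<^bsub>V\<^esub> b) \<ominus>\<^bsub>V\<^esub> (c \<oplus> d) \<odot>\<^bsub>V\<^esub> w = (a \<ominus>\<^bsub>V\<^esub> c \<odot>\<^bsub>V\<^esub> w) \<oplus>\<^bsub>V\<^esub> (b \<ominus>\<^bsub>V\<^esub> d \<odot>\<^bsub>V\<^esub> w)"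
        using c d w by (simp add: V.M.minus_eq V.smult_l_distr V.minus_add V.a_ac)
      with D(3)[OF c(3) d(3)] c d show "a \<oplus>\<^bsub>V\<^esub> b \<in> X"
        by (auto simp: X_def intro!: bexI[of _ "c \<oplus> d"])
    next
      fix k b assume k: "k \<in> carrier K" and "b \<in> X"
      then obtain d where d: "b \<in> carrier V" "d \<in> carrier K" "b \<ominus>\<^bsub>V\<^esub> d \<odot>\<^bsub>V\<^esub> w \<in> H"
        by (auto simp: X_def)
      have "k \<odot>\<^bsub>V\<^esub> b \<ominus>\<^bsub>V\<^esub> (k \<otimes> d) \<odot>\<^bsub>V\<^esub> w = k \<odot>\<^bsub>V\<^esub> (b \<ominus>\<^bsub>V\<^esub> d \<odot>\<^bsub>V\<^esub> w)"
        using k d w by (simp add: V.M.minus_eq V.smult_r_distr V.smult_r_minus V.smult_assoc1)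
      with D(4)[OF k d(3)] k d show "k \<odot>\<^bsub>V\<^esub> b \<in> X"
        by (auto simp: X_def intro!: bexI[of _ "k \<otimes> d"])
    qed
    moreover have HX: "H \<subseteq> X"
    proof
      fix x assume "x \<in> H"
      then show "x \<in> X" using D(1) w by (auto simp: X_def V.M.minus_eq subset_iff intro!: bexI[of _ \<zero>])
    qed
    moreover have "w \<in> X"
      using w D(2) by (auto simp: X_def V.M.minus_eq V.r_neg intro!: bexI[of _ \<one>])
    ultimately have "v \<in> X" using max[of X] H(2) False by (auto simp: S_def)
    then obtain c where c: "c \<in> carrier K" "v \<ominus>\<^bsub>V\<^esub> c \<odot>\<^bsub>V\<^esub> w \<in> H" by (auto simp: X_def)
    have c0: "c \<noteq> \<zero>" using c(2) H(3) v w by (auto simp: V.M.minus_eq)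
    then have ci: "inv c \<in> carrier K" "inv c \<otimes> c = \<one>" using c K.field_Units by auto
    have "(\<ominus> (inv c)) \<odot>\<^bsub>V\<^esub> (v \<ominus>\<^bsub>V\<^esub> c \<odot>\<^bsub>V\<^esub> w) \<in> H" using D(4)[OF _ c(2)] ci by simp
    also have "(\<ominus> (inv c)) \<odot>\<^bsub>V\<^esub> (v \<ominus>\<^bsub>V\<^esub> c \<odot>\<^bsub>V\<^esub> w) = w \<ominus>\<^bsub>V\<^esub> inv c \<odot>\<^bsub>V\<^esub> v"
      using v w c(1) ci
      by (simp add: V.M.minus_eq V.smult_l_minus V.smult_r_distr V.smult_r_minus
          V.smult_assoc1[symmetric] K.l_minus V.minus_add V.a_comm)
    finally show ?thesis using ci(1) by blast
  qed
  have uniq: "c = d" if "c \<in> carrier K" "d \<in> carrier K" "w \<in> carrier V"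
    "w \<ominus>\<^bsub>V\<^esub> c \<odot>\<^bsub>V\<^esub> v \<in> H" "w \<ominus>\<^bsub>V\<^esub> d \<odot>\<^bsub>V\<^esub> v \<in> H" for c d w
  proof (rule ccontr)
    assume "c \<noteq> d"
    let ?e = "d \<ominus> c"
    have e: "?e \<in> carrier K" using that by simp
    have e0: "?e \<noteq> \<zero>"
    proof
      assume "?e = \<zero>"
      then have "d = \<ominus> (\<ominus> c)" using that K.minus_equality[of "\<ominus> c" d] K.sum_zero_eq_neg[of d "\<ominus> c"]
        by (simp add: K.minus_eq)
      with that \<open>c \<noteq> d\<close> show False by simp
    qed
    have "(w \<ominus>\<^bsub>V\<^esub> c \<odot>\<^bsub>V\<^esub> v) \<oplus>\<^bsub>V\<^esub> (\<ominus>\<^bsub>V\<^esub> (w \<ominus>\<^bsub>V\<^esub> d \<odot>\<^bsub>V\<^esub> v)) \<in> H"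
      using D(3)[OF that(4) D(5)[OF that(5)]] .
    also have "(w \<ominus>\<^bsub>V\<^esub> c \<odot>\<^bsub>V\<^esub> v) \<oplus>\<^bsub>V\<^esub> (\<ominus>\<^bsub>V\<^esub> (w \<ominus>\<^bsub>V\<^esub> d \<odot>\<^bsub>V\<^esub> v)) = ?e \<odot>\<^bsub>V\<^esub> v"
    proof -
      have "(w \<ominus>\<^bsub>V\<^esub> c \<odot>\<^bsub>V\<^esub> v) \<oplus>\<^bsub>V\<^esub> (\<ominus>\<^bsub>V\<^esub> (w \<ominus>\<^bsub>V\<^esub> d \<odot>\<^bsub>V\<^esub> v)) =
          (w \<oplus>\<^bsub>V\<^esub> \<ominus>\<^bsub>V\<^esub> w) \<oplus>\<^bsub>V\<^esub> (d \<odot>\<^bsub>V\<^esub> v \<oplus>\<^bsub>V\<^esub> \<ominus>\<^bsub>V\<^esub> (c \<odot>\<^bsub>V\<^esub> v))"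
        using that v by (simp add: V.M.minus_eq V.minus_add V.a_ac)
      then show ?thesis
        using that v by (simp add: V.r_neg K.minus_eq V.smult_l_distr V.smult_l_minus)
    qed
    finally have "inv ?e \<odot>\<^bsub>V\<^esub> (?e \<odot>\<^bsub>V\<^esub> v) \<in> H" using D(4) e e0 K.field_Units by simp
    then show False
      using e e0 K.field_Units v H(3) by (simp add: V.smult_assoc1[symmetric] K.Units_l_inv)
  qed
  define f where "f w = (THE c. c \<in> carrier K \<and> w \<ominus>\<^bsub>V\<^esub> c \<odot>\<^bsub>V\<^esub> v \<in> H)" for w
  have f: "f w = c" if "w \<in> carrier V" "c \<in> carrier K" "w \<ominus>\<^bsub>V\<^esub> c \<odot>\<^bsub>V\<^esub> v \<in> H" for w c
    unfolding f_def using that uniq by (intro the_equality) auto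
  have fc: "f w \<in> carrier K" "w \<ominus>\<^bsub>V\<^esub> f w \<odot>\<^bsub>V\<^esub> v \<in> H" if "w \<in> carrier V" for w
    using span[OF that] f[OF that] by auto
  show ?thesis
  proof (intro exI[of _ f] conjI ballI)
    show "f \<in> carrier V \<rightarrow> carrier K" using fc by auto
    show "f v = \<one>" using v D(2) by (intro f) (auto simp: V.M.minus_eq V.r_neg)
    show "f u = \<zero>" if "u \<in> U" for u
    proof -
      have "u \<in> H" "u \<in> carrier V" using that H(2) D(1) by auto
      then show ?thesis using v by (intro f) (simp_all add: V.M.minus_eq)
    qed
  next
    fix x y assume x: "x \<in> carrier V" and y: "y \<in> carrier V"
    have "(x \<oplus>\<^bsub>V\<^esub> y) \<ominus>\<^bsub>V\<^esub> (f x \<oplus> f y) \<odot>\<^bsub>V\<^esub> v = (x \<ominus>\<^bsub>V\<^esub> f x \<odot>\<^bsub>V\<^esub> v) \<oplus>\<^bsub>V\<^esub> (y \<ominus>\<^bsub>V\<^esub> f y \<odot>\<^bsub>V\<^esub> v)"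
      using fc(1)[OF x] fc(1)[OF y] x y v by (simp add: V.M.minus_eq V.smult_l_distr V.minus_add V.a_ac)
    with D(3)[OF fc(2)[OF x] fc(2)[OF y]] show "f (x \<oplus>\<^bsub>V\<^esub> y) = f x \<oplus> f y"
      using fc(1)[OF x] fc(1)[OF y] x y by (intro f) auto
  next
    fix k x assume k: "k \<in> carrier K" and x: "x \<in> carrier V"
    have "k \<odot>\<^bsub>V\<^esub> x \<ominus>\<^bsub>V\<^esub> (k \<otimes> f x) \<odot>\<^bsub>V\<^esub> v = k \<odot>\<^bsub>V\<^esub> (x \<ominus>\<^bsub>V\<^esub> f x \<odot>\<^bsub>V\<^esub> v)"
      using k fc(1)[OF x] x v by (simp add: V.M.minus_eq V.smult_r_distr V.smult_r_minus V.smult_assoc1)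
    with D(4)[OF k fc(2)[OF x]] show "f (k \<odot>\<^bsub>V\<^esub> x) = k \<otimes> f x"
      using k fc(1)[OF x] x by (intro f) auto
  qed
qed

section \<open>Modules, quotients and torsion classes\<close>

lemma underlying_space_simps [simp]:
  "carrier (underlying_space A M) = carrier M"
  "zero (underlying_space A M) = zero M"
  "add (underlying_space A M) = add M"
  "smult (underlying_space A M) = (\<lambda>c x. (c \<odot>\<^bsub>A\<^esub> \<one>\<^bsub>A\<^esub>) \<odot>\<^bsub>M\<^esub> x)"
  by (simp_all add: underlying_space_def)

context left_module
begin

lemma uminus_zero [simp]: "\<ominus>\<^bsub>M\<^esub> \<zero>\<^bsub>M\<^esub> = \<zero>\<^bsub>M\<^esub>"
  using M.r_neg[of "\<zero>\<^bsub>M\<^esub>"] by simp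

lemma zero_smult [simp]: "x \<in> carrier M \<Longrightarrow> \<zero> \<odot>\<^bsub>M\<^esub> x = \<zero>\<^bsub>M\<^esub>"
proof -
  assume x: "x \<in> carrier M"
  have "\<zero> \<odot>\<^bsub>M\<^esub> x \<oplus>\<^bsub>M\<^esub> \<zero> \<odot>\<^bsub>M\<^esub> x = \<zero> \<odot>\<^bsub>M\<^esub> x"
    using smult_l_distr[of \<zero> \<zero> x] x by simp
  with x show ?thesis by (simp add: smult_closed)
qed

lemma smult_zero [simp]: "a \<in> carrier R \<Longrightarrow> a \<odot>\<^bsub>M\<^esub> \<zero>\<^bsub>M\<^esub> = \<zero>\<^bsub>M\<^esub>"
proof -
  assume a: "a \<in> carrier R"
  have "a \<odot>\<^bsub>M\<^esub> \<zero>\<^bsub>M\<^esub> \<oplus>\<^bsub>M\<^esub> a \<odot>\<^bsub>M\<^esub> \<zero>\<^bsub>M\<^esub> = a \<odot>\<^bsub>M\<^esub> \<zero>\<^bsub>M\<^esub>"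
    using smult_r_distr[of a "\<zero>\<^bsub>M\<^esub>" "\<zero>\<^bsub>M\<^esub>"] a by simp
  with a show ?thesis by (simp add: smult_closed)
qed

lemma minus_one_smult: "x \<in> carrier M \<Longrightarrow> (\<ominus> \<one>) \<odot>\<^bsub>M\<^esub> x = \<ominus>\<^bsub>M\<^esub> x"
proof -
  assume x: "x \<in> carrier M"
  have "(\<ominus> \<one>) \<odot>\<^bsub>M\<^esub> x \<oplus>\<^bsub>M\<^esub> x = (\<ominus> \<one> \<oplus> \<one>) \<odot>\<^bsub>M\<^esub> x"
    using x by (simp add: smult_l_distr smult_one del: R.l_neg)
  also have "\<dots> = \<zero>\<^bsub>M\<^esub>" using x by (simp add: R.l_neg)
  finally show ?thesis using x by (simp add: M.minus_equality smult_closed)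
qed

lemma smult_minus:
  "a \<in> carrier R \<Longrightarrow> x \<in> carrier M \<Longrightarrow> a \<odot>\<^bsub>M\<^esub> (\<ominus>\<^bsub>M\<^esub> x) = \<ominus>\<^bsub>M\<^esub> (a \<odot>\<^bsub>M\<^esub> x)"
proof -
  assume a: "a \<in> carrier R" and x: "x \<in> carrier M"
  have "a \<odot>\<^bsub>M\<^esub> (\<ominus>\<^bsub>M\<^esub> x) \<oplus>\<^bsub>M\<^esub> a \<odot>\<^bsub>M\<^esub> x = \<zero>\<^bsub>M\<^esub>"
    using a x by (simp add: smult_r_distr[symmetric] M.l_neg)
  with a x show ?thesis by (simp add: M.minus_equality smult_closed)
qed

end

definition left_submodule where
  "left_submodule A M H \<longleftrightarrow> H \<subseteq> carrier M \<and> \<zero>\<^bsub>M\<^esub> \<in> H \<and>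
     (\<forall>x\<in>H. \<forall>y\<in>H. x \<oplus>\<^bsub>M\<^esub> y \<in> H) \<and> (\<forall>a\<in>carrier A. \<forall>x\<in>H. a \<odot>\<^bsub>M\<^esub> x \<in> H)"

context left_module
begin

lemma left_submoduleD:
  assumes "left_submodule R M H"
  shows "x \<in> H \<Longrightarrow> x \<in> carrier M" "\<zero>\<^bsub>M\<^esub> \<in> H"
    "x \<in> H \<Longrightarrow> y \<in> H \<Longrightarrow> x \<oplus>\<^bsub>M\<^esub> y \<in> H"
    "a \<in> carrier R \<Longrightarrow> x \<in> H \<Longrightarrow> a \<odot>\<^bsub>M\<^esub> x \<in> H"
    "x \<in> H \<Longrightarrow> \<ominus>\<^bsub>M\<^esub> x \<in> H"
proof -
  have *: "H \<subseteq> carrier M" "\<And>a x. a \<in> carrier R \<Longrightarrow> x \<in> H \<Longrightarrow> a \<odot>\<^bsub>M\<^esub> x \<in> H"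
    using assms by (auto simp: left_submodule_def)
  then show "x \<in> H \<Longrightarrow> \<ominus>\<^bsub>M\<^esub> x \<in> H" using minus_one_smult[of x] by (metis R.a_inv_closed R.one_closed subsetD)
qed (use assms in \<open>auto simp: left_submodule_def\<close>)

lemma left_module_submodule:
  assumes H: "left_submodule R M H"
  shows "left_module R (M\<lparr>carrier := H\<rparr>)"
proof (intro left_module.intro left_module_axioms.intro)
  note D = left_submoduleD[OF H]
  show "abelian_group (M\<lparr>carrier := H\<rparr>)"
  proof (rule abelian_groupI)
    fix x assume "x \<in> carrier (M\<lparr>carrier := H\<rparr>)"
    then show "\<exists>y\<in>carrier (M\<lparr>carrier := H\<rparr>). y \<oplus>\<^bsub>M\<lparr>carrier := H\<rparr>\<^esub> x = \<zero>\<^bsub>M\<lparr>carrier := H\<rparr>\<^esub>"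
      using D by (auto simp: M.l_neg intro!: bexI[of _ "\<ominus>\<^bsub>M\<^esub> x"])
  qed (use D in \<open>auto simp: M.a_ac\<close>)
  show "ring R" by (rule R.ring_axioms)
qed (use left_submoduleD[OF H] in \<open>auto simp: smult_l_distr smult_r_distr smult_assoc smult_one\<close>)

end

text \<open>The quotient is built on a set of representatives of the cosets, so that its elements
  have the same type as those of \<open>M\<close>.\<close>

lemma quotient_exists:
  fixes A :: "('k, 'a, 'd) module_scheme" and M :: "('a, 'm, 'e) module_scheme"
  assumes M: "left_module A M" and H: "left_submodule A M H"
  obtains Q :: "('a, 'm) module" and p where "left_module A Q" "p \<in> left_module_hom A M Q"
    "p ` carrier M = carrier Q" "{x \<in> carrier M. p x = \<zero>\<^bsub>Q\<^esub>} = H"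
proof -
  interpret M: left_module A M by (fact M)
  note D = M.left_submoduleD[OF H]
  define p where "p x = (SOME y. y \<in> carrier M \<and> x \<oplus>\<^bsub>M\<^esub> \<ominus>\<^bsub>M\<^esub> y \<in> H)" for x
  have p: "p x \<in> carrier M" "x \<oplus>\<^bsub>M\<^esub> \<ominus>\<^bsub>M\<^esub> p x \<in> H" if "x \<in> carrier M" for x
  proof -
    have "x \<in> carrier M \<and> x \<oplus>\<^bsub>M\<^esub> \<ominus>\<^bsub>M\<^esub> x \<in> H" using that D(2) by (simp add: M.r_neg)
    from someI[of "\<lambda>y. y \<in> carrier M \<and> x \<oplus>\<^bsub>M\<^esub> \<ominus>\<^bsub>M\<^esub> y \<in> H", OF this]
    show "p x \<in> carrier M" "x \<oplus>\<^bsub>M\<^esub> \<ominus>\<^bsub>M\<^esub> p x \<in> H" by (simp_all add: p_def)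
  qed
  have tr: "x \<oplus>\<^bsub>M\<^esub> \<ominus>\<^bsub>M\<^esub> z \<in> H" if "x \<in> carrier M" "y \<in> carrier M" "z \<in> carrier M"
    "x \<oplus>\<^bsub>M\<^esub> \<ominus>\<^bsub>M\<^esub> y \<in> H" "y \<oplus>\<^bsub>M\<^esub> \<ominus>\<^bsub>M\<^esub> z \<in> H" for x y z
  proof -
    have "(x \<oplus>\<^bsub>M\<^esub> \<ominus>\<^bsub>M\<^esub> y) \<oplus>\<^bsub>M\<^esub> (y \<oplus>\<^bsub>M\<^esub> \<ominus>\<^bsub>M\<^esub> z) = x \<oplus>\<^bsub>M\<^esub> \<ominus>\<^bsub>M\<^esub> z"
      using that(1-3) by (simp add: M.a_assoc M.r_neg1)
    with D(3)[OF that(4,5)] show ?thesis by simp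
  qed
  have sy: "y \<oplus>\<^bsub>M\<^esub> \<ominus>\<^bsub>M\<^esub> x \<in> H" if "x \<in> carrier M" "y \<in> carrier M" "x \<oplus>\<^bsub>M\<^esub> \<ominus>\<^bsub>M\<^esub> y \<in> H" for x y
  proof -
    have "\<ominus>\<^bsub>M\<^esub> (x \<oplus>\<^bsub>M\<^esub> \<ominus>\<^bsub>M\<^esub> y) = y \<oplus>\<^bsub>M\<^esub> \<ominus>\<^bsub>M\<^esub> x"
      using that(1,2) by (simp add: M.minus_add M.a_comm)
    with D(5)[OF that(3)] show ?thesis by simp
  qed
  have peq: "p x = p y \<longleftrightarrow> x \<oplus>\<^bsub>M\<^esub> \<ominus>\<^bsub>M\<^esub> y \<in> H" if "x \<in> carrier M" "y \<in> carrier M" for x y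
  proof
    assume "p x = p y"
    then show "x \<oplus>\<^bsub>M\<^esub> \<ominus>\<^bsub>M\<^esub> y \<in> H" using p[OF that(1)] p[OF that(2)] sy tr that by metis
  next
    assume "x \<oplus>\<^bsub>M\<^esub> \<ominus>\<^bsub>M\<^esub> y \<in> H"
    then have "(z \<in> carrier M \<and> x \<oplus>\<^bsub>M\<^esub> \<ominus>\<^bsub>M\<^esub> z \<in> H) = (z \<in> carrier M \<and> y \<oplus>\<^bsub>M\<^esub> \<ominus>\<^bsub>M\<^esub> z \<in> H)" for z
      using sy tr that by blast
    then show "p x = p y" by (simp add: p_def)
  qed
  have pp [simp]: "p (p x) = p x" if "x \<in> carrier M" for x
    using that p[OF that] peq[of "p x" x] sy by blast
  have padd: "p (p x \<oplus>\<^bsub>M\<^esub> p y) = p (x \<oplus>\<^bsub>M\<^esub> y)" if "x \<in> carrier M" "y \<in> carrier M" for x y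
  proof -
    have "(x \<oplus>\<^bsub>M\<^esub> \<ominus>\<^bsub>M\<^esub> p x) \<oplus>\<^bsub>M\<^esub> (y \<oplus>\<^bsub>M\<^esub> \<ominus>\<^bsub>M\<^esub> p y) = (x \<oplus>\<^bsub>M\<^esub> y) \<oplus>\<^bsub>M\<^esub> \<ominus>\<^bsub>M\<^esub> (p x \<oplus>\<^bsub>M\<^esub> p y)"
      using that p by (simp add: M.minus_add M.a_ac)
    then have "(x \<oplus>\<^bsub>M\<^esub> y) \<oplus>\<^bsub>M\<^esub> \<ominus>\<^bsub>M\<^esub> (p x \<oplus>\<^bsub>M\<^esub> p y) \<in> H"
      using D(3)[OF p(2)[OF that(1)] p(2)[OF that(2)]] by simp
    then show ?thesis using peq[of "x \<oplus>\<^bsub>M\<^esub> y" "p x \<oplus>\<^bsub>M\<^esub> p y"] that p by simp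
  qed
  have padd1: "p (p x \<oplus>\<^bsub>M\<^esub> y) = p (x \<oplus>\<^bsub>M\<^esub> y)" and padd2: "p (x \<oplus>\<^bsub>M\<^esub> p y) = p (x \<oplus>\<^bsub>M\<^esub> y)"
    if "x \<in> carrier M" "y \<in> carrier M" for x y
    using padd[of "p x" y] padd[of x "p y"] padd[of x y] that p by simp_all
  have psm: "p (a \<odot>\<^bsub>M\<^esub> p x) = p (a \<odot>\<^bsub>M\<^esub> x)" if "a \<in> carrier A" "x \<in> carrier M" for a x
  proof -
    have "a \<odot>\<^bsub>M\<^esub> (x \<oplus>\<^bsub>M\<^esub> \<ominus>\<^bsub>M\<^esub> p x) = a \<odot>\<^bsub>M\<^esub> x \<oplus>\<^bsub>M\<^esub> \<ominus>\<^bsub>M\<^esub> (a \<odot>\<^bsub>M\<^esub> p x)"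
      using that p by (simp add: M.smult_r_distr M.smult_minus)
    with D(4)[OF that(1) p(2)[OF that(2)]]
    have "a \<odot>\<^bsub>M\<^esub> x \<oplus>\<^bsub>M\<^esub> \<ominus>\<^bsub>M\<^esub> (a \<odot>\<^bsub>M\<^esub> p x) \<in> H" by simp
    then show ?thesis using peq[of "a \<odot>\<^bsub>M\<^esub> x" "a \<odot>\<^bsub>M\<^esub> p x"] that p M.smult_closed by simp
  qed
  define Q :: "('a, 'm) module" where "Q = \<lparr>carrier = p ` carrier M, mult = undefined, one = undefined,
    zero = p \<zero>\<^bsub>M\<^esub>, add = (\<lambda>x y. p (x \<oplus>\<^bsub>M\<^esub> y)), smult = (\<lambda>a x. p (a \<odot>\<^bsub>M\<^esub> x))\<rparr>"
  have Q: "carrier Q = p ` carrier M" "\<zero>\<^bsub>Q\<^esub> = p \<zero>\<^bsub>M\<^esub>" "\<And>x y. x \<oplus>\<^bsub>Q\<^esub> y = p (x \<oplus>\<^bsub>M\<^esub> y)"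
    "\<And>a x. a \<odot>\<^bsub>Q\<^esub> x = p (a \<odot>\<^bsub>M\<^esub> x)" by (simp_all add: Q_def)
  note simps = Q p padd padd1 padd2 psm M.smult_closed
  have "abelian_group Q"
  proof (rule abelian_groupI)
    fix x assume "x \<in> carrier Q"
    then obtain u where u: "u \<in> carrier M" "x = p u" by (auto simp: Q)
    then have "p (\<ominus>\<^bsub>M\<^esub> u) \<oplus>\<^bsub>Q\<^esub> x = \<zero>\<^bsub>Q\<^esub>" by (simp add: simps M.l_neg)
    with u show "\<exists>y\<in>carrier Q. y \<oplus>\<^bsub>Q\<^esub> x = \<zero>\<^bsub>Q\<^esub>" by (auto simp: Q)
  next
    fix x y z assume "x \<in> carrier Q" "y \<in> carrier Q" "z \<in> carrier Q"
    then obtain u v w where "u \<in> carrier M" "x = p u" "v \<in> carrier M" "y = p v" "w \<in> carrier M" "z = p w"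
      by (auto simp: Q)
    then show "x \<oplus>\<^bsub>Q\<^esub> y \<oplus>\<^bsub>Q\<^esub> z = x \<oplus>\<^bsub>Q\<^esub> (y \<oplus>\<^bsub>Q\<^esub> z)" by (simp add: simps M.a_assoc)
  next
    fix x y assume "x \<in> carrier Q" "y \<in> carrier Q"
    then show "x \<oplus>\<^bsub>Q\<^esub> y = y \<oplus>\<^bsub>Q\<^esub> x" by (auto simp: simps M.a_comm)
  qed (auto simp: simps)
  then have "left_module A Q"
    by (intro left_module.intro left_module_axioms.intro M.R.ring_axioms)
      (auto simp: simps, simp_all add: M.smult_l_distr M.smult_r_distr M.smult_assoc M.smult_one)
  moreover have "p \<in> left_module_hom A M Q"
    by (auto simp: left_module_hom_def simps)
  moreover have "{x \<in> carrier M. p x = \<zero>\<^bsub>Q\<^esub>} = H"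
    using peq[of _ "\<zero>\<^bsub>M\<^esub>"] D(1) by (auto simp: Q)
  ultimately show ?thesis using that[of Q p] Q(1) by blast
qed

lemma left_module_homD:
  assumes "h \<in> left_module_hom A M N"
  shows "x \<in> carrier M \<Longrightarrow> h x \<in> carrier N"
    "x \<in> carrier M \<Longrightarrow> y \<in> carrier M \<Longrightarrow> h (x \<oplus>\<^bsub>M\<^esub> y) = h x \<oplus>\<^bsub>N\<^esub> h y"
    "a \<in> carrier A \<Longrightarrow> x \<in> carrier M \<Longrightarrow> h (a \<odot>\<^bsub>M\<^esub> x) = a \<odot>\<^bsub>N\<^esub> h x"
  using assms by (auto simp: left_module_hom_def)

lemma left_module_hom_zero:
  assumes "left_module A M" "left_module A N" "h \<in> left_module_hom A M N"
  shows "h \<zero>\<^bsub>M\<^esub> = \<zero>\<^bsub>N\<^esub>"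
proof -
  interpret M: left_module A M by fact
  interpret N: left_module A N by fact
  show ?thesis using left_module_homD(3)[OF assms(3), of "\<zero>\<^bsub>A\<^esub>" "\<zero>\<^bsub>M\<^esub>"] left_module_homD(1)[OF assms(3), of "\<zero>\<^bsub>M\<^esub>"] by simp
qed

lemma left_submodule_image:
  assumes M: "left_module A M" and N: "left_module A N" and h: "h \<in> left_module_hom A M N"
  shows "left_submodule A N (h ` carrier M)"
proof -
  interpret M: left_module A M by fact
  interpret N: left_module A N by fact
  note D = left_module_homD[OF h]
  have "h x \<oplus>\<^bsub>N\<^esub> h y \<in> h ` carrier M" if "x \<in> carrier M" "y \<in> carrier M" for x y
    using that D(2)[of x y] by (metis M.a_closed imageI)
  moreover have "a \<odot>\<^bsub>N\<^esub> h x \<in> h ` carrier M" if "a \<in> carrier A" "x \<in> carrier M" for a x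
    using that D(3)[of a x] by (metis M.smult_closed imageI)
  moreover have "\<zero>\<^bsub>N\<^esub> \<in> h ` carrier M"
    using left_module_hom_zero[OF M N h] by (metis M.M.zero_closed imageI)
  ultimately show ?thesis using D(1) by (auto simp: left_submodule_def)
qed

lemma is_quotient_if_isomorphic: "left_module_isomorphic A M N \<Longrightarrow> is_quotient A M N"
  unfolding left_module_isomorphic_def is_quotient_def bij_betw_def by blast

lemma torsion_classI:
  fixes K :: "('k, 'c) ring_scheme" and A :: "('k, 'a, 'd) module_scheme"
    and T :: "('a, 'k list) module set"
  assumes "T \<noteq> {}" and "\<And>M. M \<in> T \<Longrightarrow> fd_module K A M"
    and "\<And>M N. \<lbrakk>M \<in> T; fd_module K A N; is_quotient A M N\<rbrakk> \<Longrightarrow> N \<in> T"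
    and "\<And>L M N. \<lbrakk>L \<in> T; N \<in> T; fd_module K A M; is_extension A L M N\<rbrakk> \<Longrightarrow> M \<in> T"
  shows "torsion_class K A T"
  unfolding torsion_class_def
proof (intro conjI allI impI)
  show "T \<subseteq> {M. fd_module K A M}" using assms(2) by auto
  fix M N :: "('a, 'k list) module"
  assume "M \<in> T \<and> fd_module K A N \<and> left_module_isomorphic A M N"
  then show "N \<in> T" using assms(3) is_quotient_if_isomorphic by metis
next
  fix M N :: "('a, 'k list) module"
  assume "M \<in> T \<and> fd_module K A N \<and> is_quotient A M N"
  then show "N \<in> T" using assms(3) by metis
next
  fix L M N :: "('a, 'k list) module"
  assume "L \<in> T \<and> N \<in> T \<and> fd_module K A M \<and> is_extension A L M N"
  then show "M \<in> T" using assms(4) by metis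
qed (fact assms(1))

lemma torsion_classD:
  assumes "torsion_class K A T"
  shows "T \<noteq> {}" and "M \<in> T \<Longrightarrow> fd_module K A M"
    and "\<lbrakk>M \<in> T; fd_module K A N; is_quotient A M N\<rbrakk> \<Longrightarrow> N \<in> T"
    and "\<lbrakk>L \<in> T; N \<in> T; fd_module K A M; is_extension A L M N\<rbrakk> \<Longrightarrow> M \<in> T"
proof -
  note * = assms[unfolded torsion_class_def]
  show "T \<noteq> {}" using * by (elim conjE)
  show "fd_module K A M" if "M \<in> T" using *[THEN conjunct1] that by auto
  note q = *[THEN conjunct2, THEN conjunct2, THEN conjunct2, THEN conjunct1]
    and e = *[THEN conjunct2, THEN conjunct2, THEN conjunct2, THEN conjunct2]
  show "N \<in> T" if "M \<in> T" "fd_module K A N" "is_quotient A M N"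
    using q[rule_format, of M N] that by simp
  show "M \<in> T" if "L \<in> T" "N \<in> T" "fd_module K A M" "is_extension A L M N"
    using e[rule_format, of L N M] that by simp
qed

text \<open>For an idempotent \<open>e\<close> with \<open>e f = f\<close> these are torsion classes, from which all torsion classes of the
algebras below are obtained by intersection.\<close>

definition factor_class where
  "factor_class K A e f =
     {M. fd_module K A M \<and> (\<forall>x\<in>carrier M. \<exists>y\<in>carrier M. e \<odot>\<^bsub>M\<^esub> x = f \<odot>\<^bsub>M\<^esub> y)}"

context fd_algebra
begin

lemma module_underlying_space:
  assumes "left_module A M"
  shows "module K (underlying_space A M)"
proof -
  interpret M: left_module A M by fact
  have V: "abelian_group (underlying_space A M)"
    by (rule abelian_groupI) (auto simp: M.a_ac intro: M.add.l_inv_ex)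
  show ?thesis
  proof (rule moduleI[OF K.is_cring V])
    fix a b x assume a: "a \<in> carrier K" and b: "b \<in> carrier K" and x: "x \<in> carrier (underlying_space A M)"
    have "(a \<odot>\<^bsub>A\<^esub> \<one>\<^bsub>A\<^esub>) \<otimes>\<^bsub>A\<^esub> (b \<odot>\<^bsub>A\<^esub> \<one>\<^bsub>A\<^esub>) = (a \<otimes> b) \<odot>\<^bsub>A\<^esub> \<one>\<^bsub>A\<^esub>"
      using a b by (simp add: smult_mult_left smult_assoc1)
    then show "(a \<otimes> b) \<odot>\<^bsub>underlying_space A M\<^esub> x =
        a \<odot>\<^bsub>underlying_space A M\<^esub> (b \<odot>\<^bsub>underlying_space A M\<^esub> x)"
      using a b x by (simp add: M.smult_assoc[symmetric])
  qed (auto simp: M.smult_closed M.smult_l_distr M.smult_r_distr M.smult_one smult_l_distr)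
qed

lemma linear_map_hom:
  assumes "left_module A M" "left_module A N" "h \<in> left_module_hom A M N"
  shows "linear_map K (underlying_space A M) (underlying_space A N) h"
  by (intro linear_map.intro linear_map_axioms.intro module_underlying_space assms)
    (use left_module_homD[OF assms(3)] in auto)

lemma fd_module_image:
  assumes "fd_module K A M" "left_module A N" "h \<in> left_module_hom A M N" "h ` carrier M = carrier N"
  shows "fd_module K A N"
  using linear_map.finite_dimensional_image[OF linear_map_hom[OF _ assms(2,3)]] assms
  by (simp add: fd_module_def)

lemma zero_module_exists: "\<exists>Z :: ('c, 'a list) module. fd_module K A Z \<and> carrier Z = {[]} \<and> \<zero>\<^bsub>Z\<^esub> = []"
proof -
  define Z :: "('c, 'a list) module" where
    "Z = \<lparr>carrier = {[]}, mult = undefined, one = undefined, zero = [], add = (\<lambda>_ _. []), smult = (\<lambda>_ _. [])\<rparr>"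
  have Z: "left_module A Z"
    by (intro left_module.intro left_module_axioms.intro A.ring_axioms abelian_groupI) (auto simp: Z_def)
  interpret U: module K "underlying_space A Z" by (rule module_underlying_space[OF Z])
  have "generates K (underlying_space A Z) {}"
    unfolding generates_def using U.submodule_addD(2) by (fastforce simp: Z_def)
  then have "finite_dimensional K (underlying_space A Z)"
    using U.finite_dimensional_iff by blast
  with Z have "fd_module K A Z \<and> carrier Z = {[]} \<and> \<zero>\<^bsub>Z\<^esub> = []" by (simp add: fd_module_def Z_def)
  then show ?thesis ..
qed

lemma torsion_class_zero_module:
  assumes T: "torsion_class K A T" and Z: "fd_module K A Z" "carrier Z = {\<zero>\<^bsub>Z\<^esub>}"
  shows "Z \<in> T"
proof -
  obtain M where M: "M \<in> T" "fd_module K A M" using torsion_classD(1,2)[OF T] by blast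
  interpret M: left_module A M using M by (simp add: fd_module_def)
  interpret Z: left_module A Z using Z by (simp add: fd_module_def)
  have "(\<lambda>_. \<zero>\<^bsub>Z\<^esub>) \<in> left_module_hom A M Z" by (auto simp: left_module_hom_def)
  moreover have "(\<lambda>_. \<zero>\<^bsub>Z\<^esub>) ` carrier M = carrier Z" using M.M.zero_closed Z(2) by blast
  ultimately have "is_quotient A M Z" unfolding is_quotient_def by blast
  with torsion_classD(3)[OF T M(1) Z(1)] show ?thesis .
qed

lemma torsion_class_all: "torsion_class K A {M. fd_module K A M}"
  using zero_module_exists by (auto simp: torsion_class_def)

lemma torsion_class_Inter:
  assumes "\<T> \<noteq> {}" "\<And>T. T \<in> \<T> \<Longrightarrow> torsion_class K A T"
  shows "torsion_class K A (\<Inter>\<T>)"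
proof (rule torsion_classI)
  obtain Z :: "('c, 'a list) module" where Z: "fd_module K A Z" "carrier Z = {\<zero>\<^bsub>Z\<^esub>}"
    using zero_module_exists by metis
  have "Z \<in> \<Inter>\<T>" using assms(2) torsion_class_zero_module Z by blast
  then show "\<Inter>\<T> \<noteq> {}" by blast
  show "fd_module K A M" if "M \<in> \<Inter>\<T>" for M
    using that assms torsion_classD(2) by blast
  show "N \<in> \<Inter>\<T>" if "M \<in> \<Inter>\<T>" "fd_module K A N" "is_quotient A M N" for M N
  proof
    fix T assume "T \<in> \<T>"
    then show "N \<in> T" using torsion_classD(3)[OF assms(2) _ that(2,3)] that(1) by blast
  qed
  show "M \<in> \<Inter>\<T>" if "L \<in> \<Inter>\<T>" "N \<in> \<Inter>\<T>" "fd_module K A M" "is_extension A L M N" for L M N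
  proof
    fix T assume "T \<in> \<T>"
    then show "M \<in> T" using torsion_classD(4)[OF assms(2) _ _ that(3,4)] that(1,2) by blast
  qed
qed

lemma complete_lattice_tors: "complete_lattice (tors K A)"
proof (rule partial_order.complete_lattice_criterion1)
  show "partial_order (tors K A)" by standard (auto simp: tors_def)
  show "\<exists>g. greatest (tors K A) g (carrier (tors K A))"
  proof
    show "greatest (tors K A) {M. fd_module K A M} (carrier (tors K A))"
      using torsion_class_all torsion_classD(2) by (auto simp: greatest_def tors_def)
  qed
  fix \<T> assume \<T>: "\<T> \<subseteq> carrier (tors K A)" "\<T> \<noteq> {}"
  have "greatest (tors K A) (\<Inter>\<T>) (Lower (tors K A) \<T>)"
  proof (rule greatest_LowerI)
    show "\<Inter>\<T> \<in> carrier (tors K A)"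
      using torsion_class_Inter[OF \<T>(2)] \<T>(1) by (auto simp: tors_def)
    show "\<And>y. y \<in> Lower (tors K A) \<T> \<Longrightarrow> y \<sqsubseteq>\<^bsub>tors K A\<^esub> \<Inter>\<T>"
      using \<T>(1) by (auto simp: tors_def Lower_def)
  qed (use \<T>(1) in \<open>auto simp: tors_def\<close>)
  then show "\<exists>i. greatest (tors K A) i (Lower (tors K A) \<T>)" ..
qed

lemma factor_class_quotient:
  assumes e: "e \<in> carrier A" "f \<in> carrier A" and M: "M \<in> factor_class K A e f"
    and N: "fd_module K A N" and q: "is_quotient A M N"
  shows "N \<in> factor_class K A e f"
proof -
  obtain p where p: "p \<in> left_module_hom A M N" "p ` carrier M = carrier N"
    using q by (auto simp: is_quotient_def)
  note D = left_module_homD[OF p(1)]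
  have "\<exists>y\<in>carrier N. e \<odot>\<^bsub>N\<^esub> x = f \<odot>\<^bsub>N\<^esub> y" if x: "x \<in> carrier N" for x
  proof -
    obtain x' where x': "x' \<in> carrier M" "x = p x'" using x p(2) by (metis imageE)
    then obtain y where y: "y \<in> carrier M" "e \<odot>\<^bsub>M\<^esub> x' = f \<odot>\<^bsub>M\<^esub> y"
      using M by (auto simp: factor_class_def)
    have "e \<odot>\<^bsub>N\<^esub> x = f \<odot>\<^bsub>N\<^esub> p y" using D(3) e x' y by metis
    with D(1)[OF y(1)] show ?thesis by blast
  qed
  with N show ?thesis by (auto simp: factor_class_def)
qed

text \<open>In an extension \<open>0 \<rightarrow> L \<rightarrow> M \<rightarrow> N \<rightarrow> 0\<close> an element \<open>e x\<close> of \<open>M\<close> agrees, modulo \<open>L\<close>, with some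
  \<open>f y\<close>; the difference is fixed by \<open>e\<close> and lies in \<open>L\<close>, so it is again in the image of \<open>f\<close>.\<close>

lemma torsion_class_factor_class:
  assumes e: "e \<in> carrier A" "f \<in> carrier A" "e \<otimes>\<^bsub>A\<^esub> e = e" "e \<otimes>\<^bsub>A\<^esub> f = f"
  shows "torsion_class K A (factor_class K A e f)"
proof -
  have ne: "(factor_class K A e f :: ('c, 'a list) module set) \<noteq> {}"
  proof -
    obtain Z :: "('c, 'a list) module" where Z: "fd_module K A Z" "carrier Z = {[]}" "\<zero>\<^bsub>Z\<^esub> = []"
      using zero_module_exists by blast
    interpret Z: left_module A Z using Z by (simp add: fd_module_def)
    have "a \<odot>\<^bsub>Z\<^esub> [] = []" if "a \<in> carrier A" for a
      using Z.smult_zero[OF that] unfolding Z(3) .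
    from this[OF e(1)] this[OF e(2)]
    have "\<forall>x\<in>carrier Z. \<exists>y\<in>carrier Z. e \<odot>\<^bsub>Z\<^esub> x = f \<odot>\<^bsub>Z\<^esub> y"
      unfolding Z(2) by simp
    with Z(1) have "Z \<in> factor_class K A e f" unfolding factor_class_def by blast
    then show ?thesis by blast
  qed
  have ext: "M \<in> factor_class K A e f"
    if L: "L \<in> factor_class K A e f" and N: "N \<in> factor_class K A e f" and M: "fd_module K A M"
      and ex: "is_extension A L M N" for L M N
  proof -
    obtain i q where i: "i \<in> left_module_hom A L M" and q: "q \<in> left_module_hom A M N"
      and im: "i ` carrier L = {x \<in> carrier M. q x = \<zero>\<^bsub>N\<^esub>}" and surj: "q ` carrier M = carrier N"
      using ex by (auto simp: is_extension_def)
    interpret L: left_module A L using L by (simp add: factor_class_def fd_module_def)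
    interpret M: left_module A M using M by (simp add: fd_module_def)
    interpret N: left_module A N using N by (simp add: factor_class_def fd_module_def)
    note I = left_module_homD[OF i] and P = left_module_homD[OF q]
    have "\<exists>y\<in>carrier M. e \<odot>\<^bsub>M\<^esub> x = f \<odot>\<^bsub>M\<^esub> y" if x: "x \<in> carrier M" for x
    proof -
      obtain y' where y': "y' \<in> carrier N" "e \<odot>\<^bsub>N\<^esub> q x = f \<odot>\<^bsub>N\<^esub> y'"
        using N P(1)[OF x] by (auto simp: factor_class_def)
      obtain y where "y \<in> carrier M" "y' = q y" using y'(1) surj by (metis imageE)
      with y' have y: "y \<in> carrier M" "e \<odot>\<^bsub>N\<^esub> q x = f \<odot>\<^bsub>N\<^esub> q y" by simp_all
      define d where "d = e \<odot>\<^bsub>M\<^esub> x \<oplus>\<^bsub>M\<^esub> \<ominus>\<^bsub>M\<^esub> (f \<odot>\<^bsub>M\<^esub> y)"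
      have cl: "e \<odot>\<^bsub>M\<^esub> x \<in> carrier M" "f \<odot>\<^bsub>M\<^esub> y \<in> carrier M" using e x y by (auto simp: M.smult_closed)
      have dc: "d \<in> carrier M" using cl by (simp add: d_def)
      have d2: "d \<oplus>\<^bsub>M\<^esub> f \<odot>\<^bsub>M\<^esub> y = e \<odot>\<^bsub>M\<^esub> x" using cl by (simp add: d_def M.a_assoc M.l_neg)
      have "q d \<oplus>\<^bsub>N\<^esub> q (f \<odot>\<^bsub>M\<^esub> y) = q (f \<odot>\<^bsub>M\<^esub> y)"
        using P(2)[OF dc cl(2)] d2 P(3) e x y by simp
      then have "q d = \<zero>\<^bsub>N\<^esub>" using P(1)[OF dc] P(1)[OF cl(2)] by (metis N.M.add.r_cancel_one)
      then have "d \<in> i ` carrier L" using im dc by simp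
      then obtain l where l: "l \<in> carrier L" "d = i l" by blast
      obtain l' where l': "l' \<in> carrier L" "e \<odot>\<^bsub>L\<^esub> l = f \<odot>\<^bsub>L\<^esub> l'"
        using L l by (auto simp: factor_class_def)
      have ed: "e \<odot>\<^bsub>M\<^esub> d = d"
        using e x y cl by (simp add: d_def M.smult_r_distr M.smult_minus M.smult_assoc[symmetric])
      have "d = f \<odot>\<^bsub>M\<^esub> i l'" using ed I(3)[of e l] I(3)[of f l'] l l' e by simp
      then have "e \<odot>\<^bsub>M\<^esub> x = f \<odot>\<^bsub>M\<^esub> (i l' \<oplus>\<^bsub>M\<^esub> y)"
        using d2 e I(1)[OF l'(1)] y by (simp add: M.smult_r_distr)
      with I(1)[OF l'(1)] y show ?thesis by blast
    qed
    with M show ?thesis by (auto simp: factor_class_def)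
  qed
  show ?thesis
    by (rule torsion_classI[OF ne _ factor_class_quotient[OF e(1,2)] ext])
      (auto simp: factor_class_def)
qed

text \<open>A nonzero homomorphism from \<open>M'\<close> in \<open>T\<close> to \<open>M\<close> has its image in \<open>T\<close>; the quotient by the image is
  smaller and still in \<open>C\<close>, and \<open>T\<close> is closed under extensions.\<close>

lemma subset_torsion_class_by_homs:
  fixes C T :: "('c, 'a list) module set"
  assumes T: "torsion_class K A T"
    and C: "\<And>M. M \<in> C \<Longrightarrow> fd_module K A M"
    and quot: "\<And>M N. M \<in> C \<Longrightarrow> fd_module K A N \<Longrightarrow> is_quotient A M N \<Longrightarrow> N \<in> C"
    and homs: "\<And>M. M \<in> C \<Longrightarrow> carrier M \<noteq> {\<zero>\<^bsub>M\<^esub>} \<Longrightarrow>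
      \<exists>M'\<in>T. \<exists>g\<in>left_module_hom A M' M. \<exists>x\<in>carrier M'. g x \<noteq> \<zero>\<^bsub>M\<^esub>"
  shows "C \<subseteq> T"
proof
  fix M assume "M \<in> C"
  then show "M \<in> T"
  proof (induction "min_generators K (underlying_space A M)" arbitrary: M rule: less_induct)
    case (less M)
    have fdM: "fd_module K A M" using C less.prems .
    then have M: "left_module A M" by (simp add: fd_module_def)
    interpret M: left_module A M by (fact M)
    show ?case
    proof (cases "carrier M = {\<zero>\<^bsub>M\<^esub>}")
      case True
      then show ?thesis using torsion_class_zero_module[OF T fdM] by simp
    next
      case False
      then obtain M' g x where M': "M' \<in> T" and g: "g \<in> left_module_hom A M' M"
        and x: "x \<in> carrier M'" "g x \<noteq> \<zero>\<^bsub>M\<^esub>" using homs less.prems by blast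
      have fdM': "fd_module K A M'" by (rule torsion_classD(2)[OF T M'])
      then have lM': "left_module A M'" by (simp add: fd_module_def)
      define H where "H = g ` carrier M'"
      have H: "left_submodule A M H" unfolding H_def by (rule left_submodule_image[OF lM' M g])
      define N where "N = M\<lparr>carrier := H\<rparr>"
      have N: "left_module A N" unfolding N_def by (rule M.left_module_submodule[OF H])
      have gN: "g \<in> left_module_hom A M' N" "g ` carrier M' = carrier N"
        using g by (auto simp: left_module_hom_def N_def H_def)
      have fdN: "fd_module K A N" by (rule fd_module_image[OF fdM' N gN])
      have "is_quotient A M' N" using gN unfolding is_quotient_def by blast
      then have NT: "N \<in> T" by (rule torsion_classD(3)[OF T M' fdN])
      obtain Q :: "('c, 'a list) module" and p where Q: "left_module A Q" and p: "p \<in> left_module_hom A M Q"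
        "p ` carrier M = carrier Q" "{x \<in> carrier M. p x = \<zero>\<^bsub>Q\<^esub>} = H"
        using quotient_exists[OF M H] .
      have fdQ: "fd_module K A Q" by (rule fd_module_image[OF fdM Q p(1,2)])
      have "is_quotient A M Q" using p unfolding is_quotient_def by blast
      then have QC: "Q \<in> C" using quot less.prems fdQ by blast
      have gx: "g x \<in> carrier M" "p (g x) = \<zero>\<^bsub>Q\<^esub>" using p(3) x(1) by (auto simp: H_def)
      interpret lin: linear_map K "underlying_space A M" "underlying_space A Q" p
        by (rule linear_map_hom[OF M Q p(1)])
      have "min_generators K (underlying_space A Q) < min_generators K (underlying_space A M)"
        by (rule lin.min_generators_image_less[OF K.field_axioms, of "g x"])
          (use fdM p(2) gx x(2) in \<open>auto simp: fd_module_def\<close>)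
      from less.hyps[OF this QC] have QT: "Q \<in> T" .
      have "(\<lambda>x. x) \<in> left_module_hom A N M" "inj_on (\<lambda>x. x) (carrier N)"
        "(\<lambda>x. x) ` carrier N = {x \<in> carrier M. p x = \<zero>\<^bsub>Q\<^esub>}"
        using M.left_submoduleD(1)[OF H] p(3) by (auto simp: left_module_hom_def N_def)
      then have "is_extension A N M Q" unfolding is_extension_def using p(1,2) by blast
      then show ?thesis by (rule torsion_classD(4)[OF T NT QT fdM])
    qed
  qed
qed

end

section \<open>The path algebras\<close>

text \<open>The paths that form a basis of the algebra: \<open>Vert i\<close> is the trivial path at \<open>i\<close>, \<open>Arr i\<close> the arrow from
\<open>i\<close> to \<open>i + 1\<close>, \<open>Loop\<close> a loop at \<open>0\<close>, \<open>Comp\<close> the path that first runs through \<open>Loop\<close> and then through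
\<open>Arr 0\<close>, and the \<open>Null j\<close> are further loops at \<open>0\<close>.\<close>

datatype path = Vert nat | Arr nat | Loop | Comp | Null nat

fun src :: "path \<Rightarrow> nat" where
  "src (Vert i) = i" | "src (Arr i) = i" | "src Loop = 0" | "src Comp = 0" | "src (Null j) = 0"

fun tgt :: "path \<Rightarrow> nat" where
  "tgt (Vert i) = i" | "tgt (Arr i) = Suc i" | "tgt Loop = 0" | "tgt Comp = 1" | "tgt (Null j) = 0"

fun is_vert :: "path \<Rightarrow> bool" where
  "is_vert (Vert i) = True" | "is_vert _ = False"

text \<open>The number \<open>d\<close> only serves as a flag: the path \<open>Comp\<close> is nonzero if and only if \<open>0 < d\<close>.\<close>

definition paths :: "nat \<Rightarrow> nat \<Rightarrow> nat \<Rightarrow> path list" where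
  "paths n d N = map Vert [0..<n] @ map Arr [0..<n - 1] @ [Loop] @ (if 0 < d then [Comp] else []) @
     map Null [0..<N]"

lemma distinct_paths: "distinct (paths n d N)"
  by (auto simp: paths_def distinct_map inj_on_def)

lemma in_paths [simp]:
  "Vert i \<in> set (paths n d N) \<longleftrightarrow> i < n"
  "Arr i \<in> set (paths n d N) \<longleftrightarrow> Suc i < n"
  "Loop \<in> set (paths n d N)"
  "Comp \<in> set (paths n d N) \<longleftrightarrow> 0 < d"
  "Null j \<in> set (paths n d N) \<longleftrightarrow> j < N"
  by (auto simp: paths_def)

text \<open>Elements of the algebra are lists of coefficients, in the order of \<open>paths\<close>. Paths that are not listed
have coefficient zero, which makes the formulas for the multiplication uniform.\<close>

definition coeff where
  "coeff K ps f p = (case map_of (zip ps f) p of None \<Rightarrow> \<zero>\<^bsub>K\<^esub> | Some c \<Rightarrow> c)"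

lemma coeff_map: "coeff K ps (map \<phi> ps) p = (if p \<in> set ps then \<phi> p else \<zero>\<^bsub>K\<^esub>)"
  by (simp add: coeff_def map_of_zip_map)

lemma map_coeff:
  assumes "distinct ps" "length f = length ps"
  shows "map (coeff K ps f) ps = f"
  by (rule nth_equalityI) (use assms in \<open>auto simp: coeff_def map_of_zip_nth\<close>)

text \<open>A product \<open>p q\<close> of paths means first \<open>q\<close>, then \<open>p\<close>. A path \<open>r\<close> that is not trivial arises as
\<open>Vert (tgt r) r\<close> and as \<open>r Vert (src r)\<close>; besides, \<open>Comp\<close> is \<open>Arr 0 Loop\<close>.\<close>

fun path_mult where
  "path_mult K \<phi> \<psi> (Vert i) = \<phi> (Vert i) \<otimes>\<^bsub>K\<^esub> \<psi> (Vert i)"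
| "path_mult K \<phi> \<psi> Comp =
     \<phi> (Vert 1) \<otimes>\<^bsub>K\<^esub> \<psi> Comp \<oplus>\<^bsub>K\<^esub> \<phi> Comp \<otimes>\<^bsub>K\<^esub> \<psi> (Vert 0) \<oplus>\<^bsub>K\<^esub> \<phi> (Arr 0) \<otimes>\<^bsub>K\<^esub> \<psi> Loop"
| "path_mult K \<phi> \<psi> p = \<phi> (Vert (tgt p)) \<otimes>\<^bsub>K\<^esub> \<psi> p \<oplus>\<^bsub>K\<^esub> \<phi> p \<otimes>\<^bsub>K\<^esub> \<psi> (Vert (src p))"

definition path_algebra :: "('k, 'c) ring_scheme \<Rightarrow> nat \<Rightarrow> nat \<Rightarrow> nat \<Rightarrow> ('k, 'k list) module" where
  "path_algebra K n d N = (let ps = paths n d N; co = coeff K ps in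
     \<lparr>carrier = {f. length f = length ps \<and> set f \<subseteq> carrier K},
      mult = (\<lambda>f g. map (path_mult K (co f) (co g)) ps),
      one = map (\<lambda>p. if is_vert p then \<one>\<^bsub>K\<^esub> else \<zero>\<^bsub>K\<^esub>) ps,
      zero = map (\<lambda>p. \<zero>\<^bsub>K\<^esub>) ps,
      add = (\<lambda>f g. map (\<lambda>p. co f p \<oplus>\<^bsub>K\<^esub> co g p) ps),
      smult = (\<lambda>c f. map (\<lambda>p. c \<otimes>\<^bsub>K\<^esub> co f p) ps)\<rparr>)"

locale path_algebra_locale = K?: field K for K :: "('k, 'c) ring_scheme" (structure) +
  fixes n d N :: nat
  assumes n2: "2 \<le> n"
begin

abbreviation ps where "ps \<equiv> paths n d N"
abbreviation B where "B \<equiv> path_algebra K n d N"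
abbreviation co where "co \<equiv> coeff K ps"

lemma B_simps:
  "carrier B = {f. length f = length ps \<and> set f \<subseteq> carrier K}"
  "f \<otimes>\<^bsub>B\<^esub> g = map (path_mult K (co f) (co g)) ps"
  "\<one>\<^bsub>B\<^esub> = map (\<lambda>p. if is_vert p then \<one> else \<zero>) ps"
  "\<zero>\<^bsub>B\<^esub> = map (\<lambda>p. \<zero>) ps"
  "f \<oplus>\<^bsub>B\<^esub> g = map (\<lambda>p. co f p \<oplus> co g p) ps"
  "c \<odot>\<^bsub>B\<^esub> f = map (\<lambda>p. c \<otimes> co f p) ps"
  by (simp_all add: path_algebra_def Let_def)

lemma map_closed [simp]: "(\<And>p. p \<in> set ps \<Longrightarrow> \<phi> p \<in> carrier K) \<Longrightarrow> map \<phi> ps \<in> carrier B"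
  by (auto simp: B_simps)

lemma co_closed [simp]: "f \<in> carrier B \<Longrightarrow> co f p \<in> carrier K"
  unfolding coeff_def B_simps
  by (auto split: option.split dest!: map_of_SomeD set_zip_rightD)

lemma path_mult_closed [simp]:
  "f \<in> carrier B \<Longrightarrow> g \<in> carrier B \<Longrightarrow> path_mult K (co f) (co g) p \<in> carrier K"
  by (cases p rule: path.exhaust) simp_all

lemma B_eqI:
  assumes "f \<in> carrier B" "g \<in> carrier B" "\<And>p. p \<in> set ps \<Longrightarrow> co f p = co g p"
  shows "f = g"
proof -
  have "map (co f) ps = map (co g) ps" using assms(3) by simp
  with assms(1,2) show ?thesis by (simp add: map_coeff distinct_paths B_simps)
qed

lemma co_simps:
  "co (f \<otimes>\<^bsub>B\<^esub> g) p = (if p \<in> set ps then path_mult K (co f) (co g) p else \<zero>)"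
  "co \<one>\<^bsub>B\<^esub> p = (if p \<in> set ps \<and> is_vert p then \<one> else \<zero>)"
  "co \<zero>\<^bsub>B\<^esub> p = \<zero>"
  "co (f \<oplus>\<^bsub>B\<^esub> g) p = (if p \<in> set ps then co f p \<oplus> co g p else \<zero>)"
  "co (c \<odot>\<^bsub>B\<^esub> f) p = (if p \<in> set ps then c \<otimes> co f p else \<zero>)"
  by (simp_all add: B_simps coeff_map)

lemma B_closed [simp]:
  "f \<in> carrier B \<Longrightarrow> g \<in> carrier B \<Longrightarrow> f \<otimes>\<^bsub>B\<^esub> g \<in> carrier B"
  "\<one>\<^bsub>B\<^esub> \<in> carrier B" "\<zero>\<^bsub>B\<^esub> \<in> carrier B"
  "f \<in> carrier B \<Longrightarrow> g \<in> carrier B \<Longrightarrow> f \<oplus>\<^bsub>B\<^esub> g \<in> carrier B"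
  "c \<in> carrier K \<Longrightarrow> f \<in> carrier B \<Longrightarrow> c \<odot>\<^bsub>B\<^esub> f \<in> carrier B"
  unfolding B_simps(2-) by (simp_all add: map_closed)

lemma n_pos [simp]: "0 < n" "Suc 0 < n"
  using n2 by auto

lemma abelian_group_B: "abelian_group B"
proof (rule abelian_groupI)
  fix f assume f: "f \<in> carrier B"
  have "map (\<lambda>p. \<ominus> co f p) ps \<oplus>\<^bsub>B\<^esub> f = \<zero>\<^bsub>B\<^esub>"
    using f by (intro B_eqI) (auto simp: co_simps coeff_map K.l_neg)
  moreover have "map (\<lambda>p. \<ominus> co f p) ps \<in> carrier B" using f by simp
  ultimately show "\<exists>g\<in>carrier B. g \<oplus>\<^bsub>B\<^esub> f = \<zero>\<^bsub>B\<^esub>" by blast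
qed (auto intro!: B_eqI simp: co_simps K.a_ac)

lemma ring_B: "ring B"
proof (rule ringI[OF abelian_group_B])
  show "monoid B"
  proof (rule monoidI)
    fix f g h assume fgh: "f \<in> carrier B" "g \<in> carrier B" "h \<in> carrier B"
    show "f \<otimes>\<^bsub>B\<^esub> g \<otimes>\<^bsub>B\<^esub> h = f \<otimes>\<^bsub>B\<^esub> (g \<otimes>\<^bsub>B\<^esub> h)"
    proof (rule B_eqI)
      fix p assume "p \<in> set ps"
      then show "co (f \<otimes>\<^bsub>B\<^esub> g \<otimes>\<^bsub>B\<^esub> h) p = co (f \<otimes>\<^bsub>B\<^esub> (g \<otimes>\<^bsub>B\<^esub> h)) p"
        using fgh by (cases p rule: path.exhaust) (simp_all add: co_simps K.l_distr K.r_distr K.m_assoc K.a_ac)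
    qed (use fgh in simp_all)
  next
    fix f assume f: "f \<in> carrier B"
    show "\<one>\<^bsub>B\<^esub> \<otimes>\<^bsub>B\<^esub> f = f"
    proof (rule B_eqI)
      fix p assume "p \<in> set ps"
      then show "co (\<one>\<^bsub>B\<^esub> \<otimes>\<^bsub>B\<^esub> f) p = co f p" using f by (cases p rule: path.exhaust) (simp_all add: co_simps)
    qed (use f in simp_all)
    show "f \<otimes>\<^bsub>B\<^esub> \<one>\<^bsub>B\<^esub> = f"
    proof (rule B_eqI)
      fix p assume "p \<in> set ps"
      then show "co (f \<otimes>\<^bsub>B\<^esub> \<one>\<^bsub>B\<^esub>) p = co f p" using f by (cases p rule: path.exhaust) (simp_all add: co_simps)
    qed (use f in simp_all)
  qed auto
next
  fix f g h assume fgh: "f \<in> carrier B" "g \<in> carrier B" "h \<in> carrier B"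
  show "(f \<oplus>\<^bsub>B\<^esub> g) \<otimes>\<^bsub>B\<^esub> h = f \<otimes>\<^bsub>B\<^esub> h \<oplus>\<^bsub>B\<^esub> g \<otimes>\<^bsub>B\<^esub> h"
  proof (rule B_eqI)
    fix p assume "p \<in> set ps"
    then show "co ((f \<oplus>\<^bsub>B\<^esub> g) \<otimes>\<^bsub>B\<^esub> h) p = co (f \<otimes>\<^bsub>B\<^esub> h \<oplus>\<^bsub>B\<^esub> g \<otimes>\<^bsub>B\<^esub> h) p"
      using fgh by (cases p rule: path.exhaust) (simp_all add: co_simps K.l_distr K.a_ac)
  qed (use fgh in simp_all)
  show "h \<otimes>\<^bsub>B\<^esub> (f \<oplus>\<^bsub>B\<^esub> g) = h \<otimes>\<^bsub>B\<^esub> f \<oplus>\<^bsub>B\<^esub> h \<otimes>\<^bsub>B\<^esub> g"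
  proof (rule B_eqI)
    fix p assume "p \<in> set ps"
    then show "co (h \<otimes>\<^bsub>B\<^esub> (f \<oplus>\<^bsub>B\<^esub> g)) p = co (h \<otimes>\<^bsub>B\<^esub> f \<oplus>\<^bsub>B\<^esub> h \<otimes>\<^bsub>B\<^esub> g) p"
      using fgh by (cases p rule: path.exhaust) (simp_all add: co_simps K.r_distr K.a_ac)
  qed (use fgh in simp_all)
qed

lemma module_B: "module K B"
  by (rule moduleI[OF K.is_cring abelian_group_B])
    (auto intro!: B_eqI simp: co_simps K.l_distr K.r_distr K.m_assoc)

text \<open>The basis element of a path; it is zero if the path is not listed.\<close>

definition b where "b p = map (\<lambda>q. if q = p then \<one> else \<zero>) ps"

lemma b_closed [simp]: "b p \<in> carrier B"
  by (simp add: b_def)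

lemma co_b: "co (b p) q = (if q = p \<and> p \<in> set ps then \<one> else \<zero>)"
  by (auto simp: b_def coeff_map)

lemma b_outside: "p \<notin> set ps \<Longrightarrow> b p = \<zero>\<^bsub>B\<^esub>"
  by (rule B_eqI) (auto simp: co_b co_simps)

lemma b_mult:
  "b p \<otimes>\<^bsub>B\<^esub> b q =
     (if is_vert p then if tgt q = tgt p then b q else \<zero>\<^bsub>B\<^esub>
      else if is_vert q then if src p = src q then b p else \<zero>\<^bsub>B\<^esub>
      else if p = Arr 0 \<and> q = Loop then b Comp else \<zero>\<^bsub>B\<^esub>)"
proof (rule B_eqI)
  fix r assume "r \<in> set ps"
  then show "co (b p \<otimes>\<^bsub>B\<^esub> b q) r = co (if is_vert p then if tgt q = tgt p then b q else \<zero>\<^bsub>B\<^esub>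
      else if is_vert q then if src p = src q then b p else \<zero>\<^bsub>B\<^esub>
      else if p = Arr 0 \<and> q = Loop then b Comp else \<zero>\<^bsub>B\<^esub>) r"
    by (cases r rule: path.exhaust; cases p rule: path.exhaust; cases q rule: path.exhaust) (auto simp: co_simps co_b)
qed auto

lemma B_induct [consumes 1, case_names zero add]:
  assumes f: "f \<in> carrier B" and "P \<zero>\<^bsub>B\<^esub>"
    and step: "\<And>c p g. \<lbrakk>c \<in> carrier K; p \<in> set ps; g \<in> carrier B; P g\<rbrakk> \<Longrightarrow> P (c \<odot>\<^bsub>B\<^esub> b p \<oplus>\<^bsub>B\<^esub> g)"
  shows "P f"
proof -
  define r where "r S = map (\<lambda>p. if p \<in> S then co f p else \<zero>) ps" for S
  have r: "r S \<in> carrier B" for S using f by (simp add: r_def)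
  have "finite S \<Longrightarrow> S \<subseteq> set ps \<Longrightarrow> P (r S)" for S
  proof (induction S rule: finite_induct)
    case empty
    then show ?case using \<open>P \<zero>\<^bsub>B\<^esub>\<close> by (simp add: r_def B_simps)
  next
    case (insert p S)
    have "r (insert p S) = co f p \<odot>\<^bsub>B\<^esub> b p \<oplus>\<^bsub>B\<^esub> r S"
      using insert f r by (intro B_eqI) (auto simp: co_simps co_b r_def coeff_map)
    then show ?case using insert f r step by auto
  qed
  from this[of "set ps"] have "P (r (set ps))" by simp
  moreover have "r (set ps) = f" using f r by (intro B_eqI) (auto simp: r_def coeff_map)
  ultimately show ?thesis by simp
qed

lemma fd_algebra_B: "fd_algebra K B"
proof -
  interpret M: module K B by (rule module_B)
  have fd: "finite_dimensional K B"
    unfolding M.finite_dimensional_iff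
  proof (intro exI[of _ "b ` set ps"] conjI)
    show "generates K B (b ` set ps)"
      unfolding generates_def
    proof (intro allI impI subsetI)
      fix U f assume U: "submodule U K B" "b ` set ps \<subseteq> U" and "f \<in> carrier B"
      from this(3) show "f \<in> U"
        by (induction rule: B_induct) (use U(2) M.submodule_addD[OF U(1)] in auto)
    qed
  qed auto
  show ?thesis
  proof (intro fd_algebra.intro fd_algebra_axioms.intro fd K.field_axioms module_B ring_B)
    fix c f g assume *: "c \<in> carrier K" "f \<in> carrier B" "g \<in> carrier B"
    show "(c \<odot>\<^bsub>B\<^esub> f) \<otimes>\<^bsub>B\<^esub> g = c \<odot>\<^bsub>B\<^esub> (f \<otimes>\<^bsub>B\<^esub> g)"
    proof (rule B_eqI)
      fix p assume "p \<in> set ps"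
      then show "co ((c \<odot>\<^bsub>B\<^esub> f) \<otimes>\<^bsub>B\<^esub> g) p = co (c \<odot>\<^bsub>B\<^esub> (f \<otimes>\<^bsub>B\<^esub> g)) p"
        using * by (cases p rule: path.exhaust) (simp_all add: co_simps K.m_assoc K.r_distr)
    qed (use * in simp_all)
    show "f \<otimes>\<^bsub>B\<^esub> (c \<odot>\<^bsub>B\<^esub> g) = c \<odot>\<^bsub>B\<^esub> (f \<otimes>\<^bsub>B\<^esub> g)"
    proof (rule B_eqI)
      fix p assume "p \<in> set ps"
      then show "co (f \<otimes>\<^bsub>B\<^esub> (c \<odot>\<^bsub>B\<^esub> g)) p = co (c \<odot>\<^bsub>B\<^esub> (f \<otimes>\<^bsub>B\<^esub> g)) p"
        using * by (cases p rule: path.exhaust) (simp_all add: co_simps K.m_lcomm K.r_distr)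
    qed (use * in simp_all)
  qed
qed

sublocale fd_algebra K B
  by (rule fd_algebra_B)

text \<open>Such an element lies in the radical, which is nilpotent.\<close>

lemma idempotent_eq_zero:
  assumes f: "f \<in> carrier B" "f \<otimes>\<^bsub>B\<^esub> f = f" and v: "\<And>i. i < n \<Longrightarrow> co f (Vert i) = \<zero>"
  shows "f = \<zero>\<^bsub>B\<^esub>"
proof -
  have eq: "co f p = path_mult K (co f) (co f) p" if "p \<in> set ps" for p
    using co_simps(1)[of f f p] f(2) that by simp
  have v0: "co f (Vert 0) = \<zero>" "co f (Vert (Suc 0)) = \<zero>" using v by auto
  have a: "co f (Arr 0) = \<zero>" using eq[of "Arr 0"] f(1) v0 by simp
  show ?thesis
  proof (rule B_eqI)
    fix p assume "p \<in> set ps"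
    then show "co f p = co \<zero>\<^bsub>B\<^esub> p"
      using eq[of p] f(1) v v0 a by (cases p rule: path.exhaust) (simp_all add: co_simps)
  qed (use f in simp_all)
qed

text \<open>A decomposition \<open>1 = e + e'\<close> along ideals consists of central idempotents. Commuting with the
  arrows forces the coefficients of \<open>e\<close> at neighbouring vertices to agree, so they are all \<open>0\<close> or all
  \<open>1\<close>, and one of \<open>e\<close> and \<open>e'\<close> is a nilpotent idempotent.\<close>

lemma connected_algebra_B: "connected_algebra B"
  unfolding connected_algebra_def
proof (intro conjI allI impI)
  have "\<one>\<^bsub>B\<^esub> \<noteq> \<zero>\<^bsub>B\<^esub>"
  proof
    assume "\<one>\<^bsub>B\<^esub> = \<zero>\<^bsub>B\<^esub>"
    then have "co \<one>\<^bsub>B\<^esub> (Vert 0) = co \<zero>\<^bsub>B\<^esub> (Vert 0)" by simp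
    then show False by (simp add: co_simps)
  qed
  then show "carrier B \<noteq> {\<zero>\<^bsub>B\<^esub>}" using B_closed(2) by (metis singletonD)
next
  fix I J assume "ideal I B \<and> ideal J B \<and> I <+>\<^bsub>B\<^esub> J = carrier B \<and> I \<inter> J = {\<zero>\<^bsub>B\<^esub>}"
  then have I: "ideal I B" and J: "ideal J B" and sum: "I <+>\<^bsub>B\<^esub> J = carrier B" and int: "I \<inter> J = {\<zero>\<^bsub>B\<^esub>}"
    by auto
  interpret I: ideal I B by (rule I)
  interpret J: ideal J B by (rule J)
  have "\<one>\<^bsub>B\<^esub> \<in> I <+>\<^bsub>B\<^esub> J" unfolding sum by simp
  then obtain e e' where e: "e \<in> I" and e': "e' \<in> J" and one: "\<one>\<^bsub>B\<^esub> = e \<oplus>\<^bsub>B\<^esub> e'"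
    by (auto simp: set_add_def')
  have eB: "e \<in> carrier B" "e' \<in> carrier B" using e e' I.Icarr J.Icarr by auto
  have zero: "x = \<zero>\<^bsub>B\<^esub>" if "x \<in> I" "x \<in> J" for x using that int by blast
  have split: "v = e \<otimes>\<^bsub>B\<^esub> v \<oplus>\<^bsub>B\<^esub> e' \<otimes>\<^bsub>B\<^esub> v" "v = v \<otimes>\<^bsub>B\<^esub> e \<oplus>\<^bsub>B\<^esub> v \<otimes>\<^bsub>B\<^esub> e'" if "v \<in> carrier B" for v
    using that eB A.l_distr[of e e' v] A.r_distr[of e e' v] by (simp_all add: one[symmetric])
  have ann: "e \<otimes>\<^bsub>B\<^esub> v \<otimes>\<^bsub>B\<^esub> e' = \<zero>\<^bsub>B\<^esub>" "e' \<otimes>\<^bsub>B\<^esub> v \<otimes>\<^bsub>B\<^esub> e = \<zero>\<^bsub>B\<^esub>" if v: "v \<in> carrier B" for v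
    using v e e' eB I.I_r_closed[OF I.I_r_closed[OF e v]] J.I_l_closed[OF e', of "e \<otimes>\<^bsub>B\<^esub> v"]
      J.I_r_closed[OF J.I_r_closed[OF e' v]] I.I_l_closed[OF e, of "e' \<otimes>\<^bsub>B\<^esub> v"]
    by (auto intro!: zero)
  have ee': "e \<otimes>\<^bsub>B\<^esub> e' = \<zero>\<^bsub>B\<^esub>" "e' \<otimes>\<^bsub>B\<^esub> e = \<zero>\<^bsub>B\<^esub>"
    using ann[of "\<one>\<^bsub>B\<^esub>"] eB by auto
  have idem: "e \<otimes>\<^bsub>B\<^esub> e = e" "e' \<otimes>\<^bsub>B\<^esub> e' = e'"
    using split(1)[OF eB(1)] split(1)[OF eB(2)] ee' eB by auto
  have central: "e \<otimes>\<^bsub>B\<^esub> v = v \<otimes>\<^bsub>B\<^esub> e" if v: "v \<in> carrier B" for v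
  proof -
    have "e \<otimes>\<^bsub>B\<^esub> v = e \<otimes>\<^bsub>B\<^esub> v \<otimes>\<^bsub>B\<^esub> e"
      using split(2)[of "e \<otimes>\<^bsub>B\<^esub> v"] ann(1)[OF v] v eB by simp
    moreover have "v \<otimes>\<^bsub>B\<^esub> e = e \<otimes>\<^bsub>B\<^esub> v \<otimes>\<^bsub>B\<^esub> e"
      using split(1)[of "v \<otimes>\<^bsub>B\<^esub> e"] ann(2)[OF v] v eB by (simp add: A.m_assoc)
    ultimately show ?thesis by simp
  qed
  have nb: "co e (Vert (Suc i)) = co e (Vert i)" if i: "Suc i < n" for i
  proof -
    have "co (e \<otimes>\<^bsub>B\<^esub> b (Arr i)) (Arr i) = co (b (Arr i) \<otimes>\<^bsub>B\<^esub> e) (Arr i)"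
      using central[of "b (Arr i)"] by simp
    then show ?thesis using i eB by (simp add: co_simps co_b)
  qed
  have all: "co e (Vert i) = co e (Vert 0)" if "i < n" for i
    using that by (induction i) (auto simp: nb)
  have "co (e \<otimes>\<^bsub>B\<^esub> e) (Vert 0) = co e (Vert 0)" using idem by simp
  then have sq: "co e (Vert 0) \<otimes> co e (Vert 0) = co e (Vert 0)" by (simp add: co_simps)
  have "co e (Vert 0) = \<zero> \<or> co e (Vert 0) = \<one>"
  proof (rule disjCI)
    assume "co e (Vert 0) \<noteq> \<one>"
    with sq show "co e (Vert 0) = \<zero>"
      using eB K.m_lcancel[of "co e (Vert 0)" "co e (Vert 0)" \<one>] by auto
  qed
  then show "I = {\<zero>\<^bsub>B\<^esub>} \<or> J = {\<zero>\<^bsub>B\<^esub>}"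
  proof
    assume "co e (Vert 0) = \<zero>"
    with all have "\<And>i. i < n \<Longrightarrow> co e (Vert i) = \<zero>" by simp
    from idempotent_eq_zero[OF eB(1) idem(1) this] have e0: "e = \<zero>\<^bsub>B\<^esub>" .
    have "v = \<zero>\<^bsub>B\<^esub>" if v: "v \<in> I" for v
    proof (rule zero[OF v])
      have "v = e' \<otimes>\<^bsub>B\<^esub> v" using split(1)[OF I.Icarr[OF v]] I.Icarr[OF v] eB by (simp add: e0)
      then show "v \<in> J" using J.I_r_closed[OF e' I.Icarr[OF v]] by simp
    qed
    then show ?thesis using I.zero_closed by blast
  next
    assume c1: "co e (Vert 0) = \<one>"
    have "co e' (Vert i) = \<zero>" if i: "i < n" for i
    proof -
      have "co \<one>\<^bsub>B\<^esub> (Vert i) = co e (Vert i) \<oplus> co e' (Vert i)" using i by (simp add: one co_simps(4))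
      then have "\<one> = \<one> \<oplus> co e' (Vert i)" using all[OF i] c1 i by (simp add: co_simps(2))
      then show ?thesis using eB by simp
    qed
    from idempotent_eq_zero[OF eB(2) idem(2) this] have e0: "e' = \<zero>\<^bsub>B\<^esub>" .
    have "v = \<zero>\<^bsub>B\<^esub>" if v: "v \<in> J" for v
    proof (rule zero[OF _ v])
      have "v = e \<otimes>\<^bsub>B\<^esub> v" using split(1)[OF J.Icarr[OF v]] J.Icarr[OF v] eB by (simp add: e0)
      then show "v \<in> I" using I.I_r_closed[OF e J.Icarr[OF v]] by simp
    qed
    then show ?thesis using J.zero_closed by blast
  qed
qed

end

lemma min_generators_if_algebra_isomorphic:
  assumes A: "fd_algebra K A" and B: "fd_algebra K B" and iso: "algebra_isomorphic K A B"
  shows "min_generators K A = min_generators K B"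
proof -
  interpret A: fd_algebra K A by (rule A)
  interpret B: fd_algebra K B by (rule B)
  obtain h where h: "h \<in> ring_iso A B"
    and sm: "\<And>c a. c \<in> carrier K \<Longrightarrow> a \<in> carrier A \<Longrightarrow> h (c \<odot>\<^bsub>A\<^esub> a) = c \<odot>\<^bsub>B\<^esub> h a"
    using iso by (auto simp: algebra_isomorphic_def)
  have bij: "bij_betw h (carrier A) (carrier B)" and hom: "h \<in> ring_hom A B"
    using h by (auto simp: ring_iso_def)
  interpret h: linear_map K A B h
    by (intro linear_map.intro linear_map_axioms.intro A.module_axioms B.module_axioms)
      (use hom sm in \<open>auto simp: ring_hom_def\<close>)
  interpret g: linear_map K B A "inv_into (carrier A) h" by (rule h.linear_map_inverse[OF bij])
  have "inv_into (carrier A) h ` carrier B = carrier A"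
    using bij_betw_inv_into[OF bij] by (simp add: bij_betw_def)
  then show ?thesis
    using h.min_generators_image_le[OF A.finite_dim] g.min_generators_image_le[OF B.finite_dim] bij
    by (simp add: bij_betw_def)
qed

text \<open>Forgetting the coefficients of the surplus loops is a linear map onto the smaller algebra that
kills the loop with number \<open>N\<close>.\<close>

lemma min_generators_path_algebra_less:
  assumes K: "field K" and n: "2 \<le> n" and "N < N'"
  shows "min_generators K (path_algebra K n d N) < min_generators K (path_algebra K n d N')"
proof -
  interpret P: path_algebra_locale K n d N
    by (intro path_algebra_locale.intro K path_algebra_locale_axioms.intro n)
  interpret Q: path_algebra_locale K n d N'
    by (intro path_algebra_locale.intro K path_algebra_locale_axioms.intro n)
  have sub: "set (paths n d N) \<subseteq> set (paths n d N')" using \<open>N < N'\<close> by (auto simp: paths_def)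
  define h where "h f = map (coeff K (paths n d N') f) (paths n d N)" for f
  have co_h: "coeff K (paths n d N) (h f) p = (if p \<in> set (paths n d N) then coeff K (paths n d N') f p else \<zero>\<^bsub>K\<^esub>)" for f p
    by (simp add: h_def coeff_map)
  have hc: "h f \<in> carrier P.B" if "f \<in> carrier Q.B" for f using that by (simp add: h_def)
  interpret h: linear_map K Q.B P.B h
  proof (intro linear_map.intro linear_map_axioms.intro P.module_axioms Q.module_axioms)
    fix f g assume "f \<in> carrier Q.B" "g \<in> carrier Q.B"
    then show "h (f \<oplus>\<^bsub>Q.B\<^esub> g) = h f \<oplus>\<^bsub>P.B\<^esub> h g"
      using sub by (intro P.B_eqI) (auto simp: hc co_h P.co_simps Q.co_simps)
  next
    fix c f assume "c \<in> carrier K" "f \<in> carrier Q.B"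
    then show "h (c \<odot>\<^bsub>Q.B\<^esub> f) = c \<odot>\<^bsub>P.B\<^esub> h f"
      using sub by (intro P.B_eqI) (auto simp: hc co_h P.co_simps Q.co_simps)
  qed (rule hc)
  show ?thesis
  proof (rule h.min_generators_image_less[OF K Q.finite_dim, of "Q.b (Null N)"])
    show "h ` carrier Q.B = carrier P.B"
    proof
      show "carrier P.B \<subseteq> h ` carrier Q.B"
      proof
        fix g assume g: "g \<in> carrier P.B"
        define f where "f = map (coeff K (paths n d N) g) (paths n d N')"
        have f: "f \<in> carrier Q.B" using g by (simp add: f_def)
        have "g = h f" using g f sub by (intro P.B_eqI) (auto simp: hc co_h f_def coeff_map)
        with f show "g \<in> h ` carrier Q.B" by blast
      qed
    qed (use hc in auto)
    show "Q.b (Null N) \<noteq> \<zero>\<^bsub>Q.B\<^esub>"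
    proof
      assume "Q.b (Null N) = \<zero>\<^bsub>Q.B\<^esub>"
      then have "coeff K (paths n d N') (Q.b (Null N)) (Null N) = coeff K (paths n d N') \<zero>\<^bsub>Q.B\<^esub> (Null N)" by simp
      then show False using \<open>N < N'\<close> by (simp add: Q.co_b Q.co_simps)
    qed
    show "h (Q.b (Null N)) = \<zero>\<^bsub>P.B\<^esub>"
      by (intro P.B_eqI) (auto simp: hc co_h P.co_simps Q.co_b)
  qed simp
qed

section \<open>Homomorphisms between their modules\<close>

context path_algebra_locale
begin

text \<open>The action of a path, and the scalar multiplication of the vector space underlying a module.\<close>

abbreviation act where "act M p x \<equiv> b p \<odot>\<^bsub>M\<^esub> x"
abbreviation scale where "scale M c x \<equiv> (c \<odot>\<^bsub>B\<^esub> \<one>\<^bsub>B\<^esub>) \<odot>\<^bsub>M\<^esub> x"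

definition K_linear where
  "K_linear M' M g \<longleftrightarrow> (\<forall>x\<in>carrier M'. g x \<in> carrier M) \<and>
     (\<forall>x\<in>carrier M'. \<forall>y\<in>carrier M'. g (x \<oplus>\<^bsub>M'\<^esub> y) = g x \<oplus>\<^bsub>M\<^esub> g y) \<and>
     (\<forall>c\<in>carrier K. \<forall>x\<in>carrier M'. g (scale M' c x) = scale M c (g x))"

definition functional where
  "functional M f \<longleftrightarrow> (\<forall>x\<in>carrier M. f x \<in> carrier K) \<and>
     (\<forall>x\<in>carrier M. \<forall>y\<in>carrier M. f (x \<oplus>\<^bsub>M\<^esub> y) = f x \<oplus> f y) \<and>
     (\<forall>c\<in>carrier K. \<forall>x\<in>carrier M. f (scale M c x) = c \<otimes> f x)"

context
  fixes M :: "('k list, 'm, 'e) module_scheme"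
  assumes M: "left_module B M"
begin

interpretation M: left_module B M by (rule M)
interpretation U: module K "underlying_space B M" by (rule module_underlying_space[OF M])

lemma act_closed [simp]: "x \<in> carrier M \<Longrightarrow> act M p x \<in> carrier M"
  by (simp add: M.smult_closed)

lemma scale_closed [simp]: "c \<in> carrier K \<Longrightarrow> x \<in> carrier M \<Longrightarrow> scale M c x \<in> carrier M"
  by (simp add: M.smult_closed)

lemma act_zero: "act M p \<zero>\<^bsub>M\<^esub> = \<zero>\<^bsub>M\<^esub>"
  by simp

lemma act_add: "x \<in> carrier M \<Longrightarrow> y \<in> carrier M \<Longrightarrow> act M p (x \<oplus>\<^bsub>M\<^esub> y) = act M p x \<oplus>\<^bsub>M\<^esub> act M p y"
  by (simp add: M.smult_r_distr)

lemma act_minus: "x \<in> carrier M \<Longrightarrow> act M p (\<ominus>\<^bsub>M\<^esub> x) = \<ominus>\<^bsub>M\<^esub> act M p x"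
  by (simp add: M.smult_minus)

lemma act_outside: "p \<notin> set ps \<Longrightarrow> x \<in> carrier M \<Longrightarrow> act M p x = \<zero>\<^bsub>M\<^esub>"
  by (simp add: b_outside)

lemma act_act:
  assumes x: "x \<in> carrier M"
  shows "act M p (act M q x) =
     (if is_vert p then if tgt q = tgt p then act M q x else \<zero>\<^bsub>M\<^esub>
      else if is_vert q then if src p = src q then act M p x else \<zero>\<^bsub>M\<^esub>
      else if p = Arr 0 \<and> q = Loop then act M Comp x else \<zero>\<^bsub>M\<^esub>)"
  unfolding M.smult_assoc[OF b_closed b_closed x, symmetric] b_mult using x by simp

lemma act_scale:
  assumes c: "c \<in> carrier K" and x: "x \<in> carrier M"
  shows "act M p (scale M c x) = scale M c (act M p x)"
proof -
  have "b p \<otimes>\<^bsub>B\<^esub> (c \<odot>\<^bsub>B\<^esub> \<one>\<^bsub>B\<^esub>) = (c \<odot>\<^bsub>B\<^esub> \<one>\<^bsub>B\<^esub>) \<otimes>\<^bsub>B\<^esub> b p"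
    using c by (simp add: smult_mult_left smult_mult_right)
  then show ?thesis using c x by (simp add: M.smult_assoc[symmetric])
qed

lemma scale_add: "c \<in> carrier K \<Longrightarrow> x \<in> carrier M \<Longrightarrow> y \<in> carrier M \<Longrightarrow> scale M c (x \<oplus>\<^bsub>M\<^esub> y) = scale M c x \<oplus>\<^bsub>M\<^esub> scale M c y"
  using U.smult_r_distr by simp

lemma scale_add_left: "c \<in> carrier K \<Longrightarrow> c' \<in> carrier K \<Longrightarrow> x \<in> carrier M \<Longrightarrow> scale M (c \<oplus> c') x = scale M c x \<oplus>\<^bsub>M\<^esub> scale M c' x"
  using U.smult_l_distr by simp

lemma scale_scale: "c \<in> carrier K \<Longrightarrow> c' \<in> carrier K \<Longrightarrow> x \<in> carrier M \<Longrightarrow> scale M (c \<otimes> c') x = scale M c (scale M c' x)"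
  using U.smult_assoc1 by simp

lemma scale_zero [simp]: "x \<in> carrier M \<Longrightarrow> scale M \<zero> x = \<zero>\<^bsub>M\<^esub>"
  using U.smult_l_null by simp

lemma scale_zero_right [simp]: "c \<in> carrier K \<Longrightarrow> scale M c \<zero>\<^bsub>M\<^esub> = \<zero>\<^bsub>M\<^esub>"
  using U.smult_r_null by simp

lemma scale_one: "x \<in> carrier M \<Longrightarrow> scale M \<one> x = x"
  using U.smult_one by simp

lemma smult_induct_step:
  assumes "c \<in> carrier K" "g \<in> carrier B" "x \<in> carrier M"
  shows "(c \<odot>\<^bsub>B\<^esub> b p \<oplus>\<^bsub>B\<^esub> g) \<odot>\<^bsub>M\<^esub> x = scale M c (act M p x) \<oplus>\<^bsub>M\<^esub> g \<odot>\<^bsub>M\<^esub> x"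
proof -
  have "c \<odot>\<^bsub>B\<^esub> b p = (c \<odot>\<^bsub>B\<^esub> \<one>\<^bsub>B\<^esub>) \<otimes>\<^bsub>B\<^esub> b p" using assms by (simp add: smult_mult_left)
  then show ?thesis using assms by (simp add: M.smult_l_distr M.smult_assoc)
qed

text \<open>Every path factors through the vertex in which it starts, so all paths kill such an \<open>x\<close>; but the unit
is a combination of paths.\<close>

lemma eq_zero_if_vertices_zero:
  assumes x: "x \<in> carrier M" and v: "\<And>i. i < n \<Longrightarrow> act M (Vert i) x = \<zero>\<^bsub>M\<^esub>"
  shows "x = \<zero>\<^bsub>M\<^esub>"
proof -
  have a: "act M p x = \<zero>\<^bsub>M\<^esub>" if "p \<in> set ps" for p
  proof -
    have "src p < n" using that by (cases p rule: path.exhaust) auto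
    have "act M p x = act M p (act M (Vert (src p)) x)"
      using x by (cases p rule: path.exhaust) (simp_all add: act_act)
    also have "\<dots> = \<zero>\<^bsub>M\<^esub>" using v[OF \<open>src p < n\<close>] by simp
    finally show ?thesis .
  qed
  have "f \<odot>\<^bsub>M\<^esub> x = \<zero>\<^bsub>M\<^esub>" if "f \<in> carrier B" for f
    using that by (induction rule: B_induct) (use x a in \<open>simp_all add: smult_induct_step\<close>)
  from this[of "\<one>\<^bsub>B\<^esub>"] show ?thesis using x by (simp add: M.smult_one)
qed

lemma submodule_zero: "submodule {\<zero>\<^bsub>M\<^esub>} K (underlying_space B M)"
  by (rule U.submoduleI') auto

lemma submodule_act_image: "submodule (act M p ` carrier M) K (underlying_space B M)"
proof (rule U.submoduleI')
  show "\<zero>\<^bsub>underlying_space B M\<^esub> \<in> act M p ` carrier M"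
    using act_zero[of p] by (metis M.M.zero_closed imageI underlying_space_simps(2))
  fix x y assume "x \<in> act M p ` carrier M" "y \<in> act M p ` carrier M"
  then obtain x' y' where *: "x = act M p x'" "y = act M p y'" "x' \<in> carrier M" "y' \<in> carrier M" by auto
  show "x \<oplus>\<^bsub>underlying_space B M\<^esub> y \<in> act M p ` carrier M"
    by (rule image_eqI[of _ _ "x' \<oplus>\<^bsub>M\<^esub> y'"]) (use * in \<open>simp_all add: act_add\<close>)
next
  fix c x assume "c \<in> carrier K" "x \<in> act M p ` carrier M"
  then obtain x' where *: "x = act M p x'" "x' \<in> carrier M" by auto
  show "c \<odot>\<^bsub>underlying_space B M\<^esub> x \<in> act M p ` carrier M"
    by (rule image_eqI[of _ _ "scale M c x'"]) (use * \<open>c \<in> carrier K\<close> in \<open>simp_all add: act_scale\<close>)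
qed auto

lemma submodule_annihilated:
  "submodule {x \<in> carrier M. \<forall>p\<in>P. act M p x = \<zero>\<^bsub>M\<^esub>} K (underlying_space B M)"
  by (rule U.submoduleI') (auto simp: act_add act_scale)

lemma functional_exists:
  assumes "submodule W K (underlying_space B M)" "v \<in> carrier M" "v \<notin> W"
  obtains f where "functional M f" "f v = \<one>" "\<And>x. x \<in> W \<Longrightarrow> f x = \<zero>"
proof -
  have "\<exists>f. f \<in> carrier M \<rightarrow> carrier K \<and> f v = \<one> \<and> (\<forall>u\<in>W. f u = \<zero>) \<and>
    (\<forall>x\<in>carrier M. \<forall>y\<in>carrier M. f (x \<oplus>\<^bsub>M\<^esub> y) = f x \<oplus> f y) \<and>
    (\<forall>c\<in>carrier K. \<forall>x\<in>carrier M. f (scale M c x) = c \<otimes> f x)"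
    using linear_functional_exists[OF K.field_axioms U.module_axioms assms(1), of v] assms(2,3) by simp
  then obtain f where "f \<in> carrier M \<rightarrow> carrier K \<and> f v = \<one> \<and> (\<forall>u\<in>W. f u = \<zero>) \<and>
    (\<forall>x\<in>carrier M. \<forall>y\<in>carrier M. f (x \<oplus>\<^bsub>M\<^esub> y) = f x \<oplus> f y) \<and>
    (\<forall>c\<in>carrier K. \<forall>x\<in>carrier M. f (scale M c x) = c \<otimes> f x)" ..
  then show ?thesis using that[of f] by (auto simp: functional_def)
qed

lemma functional_simps:
  assumes "functional M f"
  shows "x \<in> carrier M \<Longrightarrow> f x \<in> carrier K"
    and "x \<in> carrier M \<Longrightarrow> y \<in> carrier M \<Longrightarrow> f (x \<oplus>\<^bsub>M\<^esub> y) = f x \<oplus> f y"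
    and "c \<in> carrier K \<Longrightarrow> x \<in> carrier M \<Longrightarrow> f (scale M c x) = c \<otimes> f x"
    and "f \<zero>\<^bsub>M\<^esub> = \<zero>"
proof -
  show *: "x \<in> carrier M \<Longrightarrow> f x \<in> carrier K"
    "x \<in> carrier M \<Longrightarrow> y \<in> carrier M \<Longrightarrow> f (x \<oplus>\<^bsub>M\<^esub> y) = f x \<oplus> f y"
    "c \<in> carrier K \<Longrightarrow> x \<in> carrier M \<Longrightarrow> f (scale M c x) = c \<otimes> f x" for x y c
    using assms by (auto simp: functional_def)
  have z: "f \<zero>\<^bsub>M\<^esub> \<in> carrier K" using *(1) by simp
  have "f (scale M \<zero> \<zero>\<^bsub>M\<^esub>) = \<zero> \<otimes> f \<zero>\<^bsub>M\<^esub>" by (rule *(3)) auto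
  then show "f \<zero>\<^bsub>M\<^esub> = \<zero>" using z by simp
qed

lemma functional_act:
  assumes "functional M f"
  shows "functional M (\<lambda>x. f (act M p x))"
  using functional_simps[OF assms] by (auto simp: functional_def act_add act_scale)

end

lemma K_linear_scale:
  assumes M': "left_module B M'" and M: "left_module B M" and f: "functional M' f" and u: "u \<in> carrier M"
  shows "K_linear M' M (\<lambda>x. scale M (f x) u)"
  using functional_simps[OF M' f] u by (auto simp: K_linear_def scale_closed[OF M] scale_add_left[OF M] scale_scale[OF M])

lemma K_linear_add:
  assumes M: "left_module B M" and g: "K_linear M' M g" and h: "K_linear M' M h"
  shows "K_linear M' M (\<lambda>x. g x \<oplus>\<^bsub>M\<^esub> h x)"
proof -
  interpret M: left_module B M by (rule M)
  show ?thesis using g h by (auto simp: K_linear_def scale_add[OF M] M.M.a_ac)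
qed

text \<open>The paths form a basis of the algebra.\<close>

lemma K_linear_hom:
  assumes M': "left_module B M'" and M: "left_module B M" and g: "K_linear M' M g"
    and act: "\<And>p x. p \<in> set ps \<Longrightarrow> x \<in> carrier M' \<Longrightarrow> g (act M' p x) = act M p (g x)"
  shows "g \<in> left_module_hom B M' M"
proof -
  interpret M: left_module B M by (rule M)
  interpret M': left_module B M' by (rule M')
  have cl: "g x \<in> carrier M" if "x \<in> carrier M'" for x using that g by (simp add: K_linear_def)
  have "g (f \<odot>\<^bsub>M'\<^esub> x) = f \<odot>\<^bsub>M\<^esub> g x" if "f \<in> carrier B" "x \<in> carrier M'" for f x
    using that(1)
  proof (induction rule: B_induct)
    case zero
    have "g (scale M' \<zero> x) = scale M \<zero> (g x)" using g that(2) unfolding K_linear_def by blast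
    then show ?case using that(2) cl scale_zero[OF M'] scale_zero[OF M] by simp
  next
    case (add c p h)
    have "g (scale M' c (act M' p x) \<oplus>\<^bsub>M'\<^esub> h \<odot>\<^bsub>M'\<^esub> x) = scale M c (act M p (g x)) \<oplus>\<^bsub>M\<^esub> h \<odot>\<^bsub>M\<^esub> g x"
      using g act[OF add(2) that(2)] add that(2) by (simp add: K_linear_def M'.smult_closed)
    then show ?case
      using smult_induct_step[OF M' add(1,3) that(2)] smult_induct_step[OF M add(1,3) cl[OF that(2)]] by simp
  qed
  then show ?thesis using g by (auto simp: left_module_hom_def K_linear_def)
qed

text \<open>The next three lemmas give homomorphisms of rank at most one, two and three that are built from a
linear functional \<open>f\<close> on \<open>M'\<close> and an element of \<open>M\<close>. Each factors through an explicit module: here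
through the simple module at \<open>i\<close>, where \<open>f\<close> must vanish on the radical at \<open>i\<close> and \<open>u\<close> must lie in the socle.\<close>

lemma hom_through_simple:
  assumes M': "left_module B M'" and M: "left_module B M" and f: "functional M' f"
    and fr: "\<And>p x. \<not> is_vert p \<Longrightarrow> x \<in> carrier M' \<Longrightarrow> f (act M' (Vert i) (act M' p x)) = \<zero>"
    and u: "u \<in> carrier M" "act M (Vert i) u = u" and ru: "\<And>p. \<not> is_vert p \<Longrightarrow> act M p u = \<zero>\<^bsub>M\<^esub>"
  shows "(\<lambda>x. scale M (f (act M' (Vert i) x)) u) \<in> left_module_hom B M' M"
proof (rule K_linear_hom[OF M' M K_linear_scale[OF M' M functional_act[OF M' f] u(1)]])
  fix p x assume "p \<in> set ps" and x: "x \<in> carrier M'"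
  interpret M: left_module B M by (rule M)
  note fs = functional_simps[OF M' f]
  have c: "f (act M' (Vert i) x) \<in> carrier K" using fs(1) x act_closed[OF M'] by simp
  show "scale M (f (act M' (Vert i) (act M' p x))) u = act M p (scale M (f (act M' (Vert i) x)) u)"
  proof (cases "is_vert p")
    case False
    then show ?thesis using fr[OF False x] ru[OF False] c u(1)
      by (simp add: act_scale[OF M] scale_zero[OF M] scale_zero_right[OF M])
  next
    case True
    then obtain j where p: "p = Vert j" by (cases p rule: path.exhaust) auto
    have "act M (Vert j) u = (if j = i then u else \<zero>\<^bsub>M\<^esub>)"
      using act_act[OF M u(1), of "Vert j" "Vert i"] u(2) by auto
    then show ?thesis
      using c u(1) x fs(4) by (auto simp: p act_act[OF M'] act_scale[OF M] scale_zero[OF M] scale_zero_right[OF M])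
  qed
qed

text \<open>This homomorphism factors through the module of length two with top at \<open>i\<close> and socle at \<open>i + 1\<close>; its
image lies in the span of \<open>u\<close> and \<open>Arr i u\<close>.\<close>

lemma hom_through_arrow:
  assumes M': "left_module B M'" and M: "left_module B M" and f: "functional M' f"
    and fr: "\<And>x. i = 0 \<Longrightarrow> x \<in> carrier M' \<Longrightarrow> f (act M' Comp x) = \<zero>"
    and u: "u \<in> carrier M" "act M (Vert i) u = u"
    and ru: "\<And>p. \<not> is_vert p \<Longrightarrow> p \<noteq> Arr i \<Longrightarrow> act M p u = \<zero>\<^bsub>M\<^esub>"
  shows "(\<lambda>x. scale M (f (act M' (Arr i) x)) u \<oplus>\<^bsub>M\<^esub> scale M (f (act M' (Vert (Suc i)) x)) (act M (Arr i) u))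
    \<in> left_module_hom B M' M"
proof (rule K_linear_hom[OF M' M])
  show "K_linear M' M (\<lambda>x. scale M (f (act M' (Arr i) x)) u \<oplus>\<^bsub>M\<^esub> scale M (f (act M' (Vert (Suc i)) x)) (act M (Arr i) u))"
    by (intro K_linear_add[OF M] K_linear_scale[OF M' M] functional_act[OF M' f] u act_closed[OF M])
  fix p x assume "p \<in> set ps" and x: "x \<in> carrier M'"
  interpret M: left_module B M by (rule M)
  note fs = functional_simps[OF M' f]
  have c: "f (act M' q x) \<in> carrier K" for q using fs(1) x act_closed[OF M'] by simp
  have v: "act M (Vert j) u = (if j = i then u else \<zero>\<^bsub>M\<^esub>)" for j
    using act_act[OF M u(1), of "Vert j" "Vert i"] u(2) by auto
  note simps = act_act[OF M'] act_act[OF M] act_scale[OF M] scale_zero[OF M] scale_zero_right[OF M]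
    act_add[OF M] scale_closed[OF M] act_closed[OF M] fs(4) v c u(1) x
  show "scale M (f (act M' (Arr i) (act M' p x))) u \<oplus>\<^bsub>M\<^esub> scale M (f (act M' (Vert (Suc i)) (act M' p x))) (act M (Arr i) u) =
    act M p (scale M (f (act M' (Arr i) x)) u \<oplus>\<^bsub>M\<^esub> scale M (f (act M' (Vert (Suc i)) x)) (act M (Arr i) u))"
    using fr[OF _ x] ru[of p] by (cases p rule: path.exhaust) (auto simp: simps)
qed

text \<open>This homomorphism factors through the uniserial module with composition factors at \<open>0, 0, 1\<close>; its
image lies in the span of \<open>w\<close>, \<open>Loop w\<close> and \<open>Comp w\<close>.\<close>

lemma hom_through_loop:
  assumes M': "left_module B M'" and M: "left_module B M" and f: "functional M' f"
    and w: "w \<in> carrier M" "act M (Vert 0) w = w"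
    and rw: "act M (Arr 0) w = \<zero>\<^bsub>M\<^esub>" "\<And>j. act M (Null j) w = \<zero>\<^bsub>M\<^esub>"
  shows "(\<lambda>x. scale M (f (act M' Comp x)) w \<oplus>\<^bsub>M\<^esub> (scale M (f (act M' (Arr 0) x)) (act M Loop w) \<oplus>\<^bsub>M\<^esub>
      scale M (f (act M' (Vert 1) x)) (act M Comp w))) \<in> left_module_hom B M' M"
proof (rule K_linear_hom[OF M' M])
  show "K_linear M' M (\<lambda>x. scale M (f (act M' Comp x)) w \<oplus>\<^bsub>M\<^esub> (scale M (f (act M' (Arr 0) x)) (act M Loop w) \<oplus>\<^bsub>M\<^esub>
      scale M (f (act M' (Vert 1) x)) (act M Comp w)))"
    by (intro K_linear_add[OF M] K_linear_scale[OF M' M] functional_act[OF M' f] w act_closed[OF M])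
  fix p x assume "p \<in> set ps" and x: "x \<in> carrier M'"
  interpret M: left_module B M by (rule M)
  note fs = functional_simps[OF M' f]
  have c: "f (act M' q x) \<in> carrier K" for q using fs(1) x act_closed[OF M'] by simp
  have v: "act M (Vert j) w = (if j = 0 then w else \<zero>\<^bsub>M\<^esub>)" for j
    using act_act[OF M w(1), of "Vert j" "Vert 0"] w(2) by auto
  have a: "act M (Arr j) w = \<zero>\<^bsub>M\<^esub>" for j
    using act_act[OF M w(1), of "Arr j" "Vert 0"] w(2) rw(1) by (cases "j = 0") auto
  note simps = act_act[OF M'] act_act[OF M] act_scale[OF M] scale_zero[OF M] scale_zero_right[OF M]
    act_add[OF M] scale_closed[OF M] act_closed[OF M] fs(4) v c a rw w(1) x
  show "scale M (f (act M' Comp (act M' p x))) w \<oplus>\<^bsub>M\<^esub> (scale M (f (act M' (Arr 0) (act M' p x))) (act M Loop w) \<oplus>\<^bsub>M\<^esub>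
      scale M (f (act M' (Vert 1) (act M' p x))) (act M Comp w)) =
    act M p (scale M (f (act M' Comp x)) w \<oplus>\<^bsub>M\<^esub> (scale M (f (act M' (Arr 0) x)) (act M Loop w) \<oplus>\<^bsub>M\<^esub>
      scale M (f (act M' (Vert 1) x)) (act M Comp w)))"
    by (cases p rule: path.exhaust) (auto simp: simps)
qed

end

section \<open>Torsion classes are determined by levels\<close>

context path_algebra_locale
begin

text \<open>At vertex \<open>i\<close> there are the levels \<open>0, \<dots>, top_level i\<close>. The classes \<open>level_class i l\<close> increase with \<open>l\<close>,
from the modules that vanish at \<open>i\<close> to all modules.\<close>

definition top_level :: "nat \<Rightarrow> nat" where
  "top_level i = (if i = 0 then 1 else if i = 1 \<and> 0 < d then 3 else 2)"

definition level_path :: "nat \<Rightarrow> nat \<Rightarrow> 'k list" where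
  "level_path i l = (if l = 0 then \<zero>\<^bsub>B\<^esub> else if top_level i \<le> l then b (Vert i)
     else if Suc l = top_level i then b (Arr (i - 1)) else b Comp)"

definition level_class :: "nat \<Rightarrow> nat \<Rightarrow> ('k list, 'k list) module set" where
  "level_class i l = factor_class K B (b (Vert i)) (level_path i l)"

definition level :: "('k list, 'k list) module set \<Rightarrow> nat \<Rightarrow> nat" where
  "level T i = (LEAST l. T \<subseteq> level_class i l)"

definition torsion_of :: "(nat \<Rightarrow> nat) \<Rightarrow> ('k list, 'k list) module set" where
  "torsion_of c = (\<Inter>i<n. level_class i (c i))"

text \<open>If the simple module at \<open>i\<close> is not in a torsion class, then the modules in that class have no top at
\<open>i\<close>. What they have at \<open>i\<close> comes from an arrow and contributes nothing to \<open>i + 1\<close>, so the intermediate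
levels at \<open>i + 1\<close> collapse to \<open>0\<close>.\<close>

definition admissible :: "(nat \<Rightarrow> nat) \<Rightarrow> bool" where
  "admissible c \<longleftrightarrow> (\<forall>i<n. c i \<le> top_level i) \<and>
     (\<forall>i. Suc i < n \<longrightarrow> c i < top_level i \<longrightarrow> c (Suc i) = 0 \<or> c (Suc i) = top_level (Suc i))"

lemma top_level_pos [simp]: "0 < top_level i"
  by (simp add: top_level_def)

lemma level_path_closed [simp]: "level_path i l \<in> carrier B"
  by (simp add: level_path_def)

lemma level_path_cases:
  fixes i l :: nat
  obtains "l = 0" | "top_level i \<le> l" | k where "i = Suc k" "Suc l = top_level i" "0 < l" | "i = 1" "l = 1" "top_level i = 3" "0 < d"
proof -
  have "l = 0 \<or> top_level i \<le> l \<or> (\<exists>k. i = Suc k \<and> Suc l = top_level i \<and> 0 < l) \<or> i = 1 \<and> l = 1 \<and> top_level i = 3 \<and> 0 < d"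
    by (cases i) (auto simp: top_level_def)
  then show ?thesis using that by blast
qed

lemma vert_level_path: "b (Vert i) \<otimes>\<^bsub>B\<^esub> level_path i l = level_path i l"
  by (cases rule: level_path_cases[where i = i and l = l]) (auto simp: level_path_def b_mult)

lemma level_path_factor:
  assumes "l \<le> l'"
  shows "\<exists>r\<in>carrier B. level_path i l = level_path i l' \<otimes>\<^bsub>B\<^esub> r"
proof (cases "l = 0 \<or> top_level i \<le> l \<or> l = l'")
  case True
  have "level_path i l = level_path i l' \<otimes>\<^bsub>B\<^esub> (if l = 0 then \<zero>\<^bsub>B\<^esub> else \<one>\<^bsub>B\<^esub>)"
    using True assms by (auto simp: level_path_def)
  then show ?thesis by (rule bexI) simp
next
  case False
  show ?thesis
  proof (cases "top_level i \<le> l'")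
    case True
    then have "level_path i l' = b (Vert i)" using False assms by (auto simp: level_path_def)
    with vert_level_path[of i l] have "level_path i l = level_path i l' \<otimes>\<^bsub>B\<^esub> level_path i l" by simp
    then show ?thesis by (rule bexI) simp
  next
    case ne: False
    then have *: "i = 1" "l = 1" "l' = 2" "top_level i = 3"
      using False assms by (cases rule: level_path_cases[where i = i and l = l]; auto)+
    then have "level_path i l = level_path i l' \<otimes>\<^bsub>B\<^esub> b Loop"
      by (simp add: level_path_def b_mult)
    then show ?thesis by (rule bexI) simp
  qed
qed

lemma level_class_iff:
  "M \<in> level_class i l \<longleftrightarrow> fd_module K B M \<and> (\<forall>x\<in>carrier M. \<exists>y\<in>carrier M. act M (Vert i) x = level_path i l \<odot>\<^bsub>M\<^esub> y)"
  by (simp add: level_class_def factor_class_def)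

lemma torsion_class_level_class: "torsion_class K B (level_class i l)"
  unfolding level_class_def by (rule torsion_class_factor_class) (auto simp: b_mult vert_level_path)

lemma level_class_mono: "l \<le> l' \<Longrightarrow> level_class i l \<subseteq> level_class i l'"
proof
  fix M assume "l \<le> l'" and M: "M \<in> level_class i l"
  then obtain r where r: "r \<in> carrier B" "level_path i l = level_path i l' \<otimes>\<^bsub>B\<^esub> r" using level_path_factor by blast
  interpret M: left_module B M using M by (simp add: level_class_iff fd_module_def)
  have "\<exists>z\<in>carrier M. level_path i l \<odot>\<^bsub>M\<^esub> y = level_path i l' \<odot>\<^bsub>M\<^esub> z" if y: "y \<in> carrier M" for y
    using M.smult_assoc[OF level_path_closed r(1) y] unfolding r(2)
    by (intro bexI[of _ "r \<odot>\<^bsub>M\<^esub> y"]) (simp_all add: M.smult_closed r(1) y)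
  then show "M \<in> level_class i l'" using M unfolding level_class_iff by metis
qed

lemma level_class_top: "top_level i \<le> l \<Longrightarrow> M \<in> level_class i l \<longleftrightarrow> fd_module K B M"
proof -
  assume "top_level i \<le> l"
  moreover from this have "l \<noteq> 0" using top_level_pos[of i] by linarith
  ultimately have "level_path i l = b (Vert i)" by (simp add: level_path_def)
  then show ?thesis by (auto simp: level_class_iff)
qed

lemma level_class_zero: "M \<in> level_class i 0 \<longleftrightarrow> fd_module K B M \<and> (\<forall>x\<in>carrier M. act M (Vert i) x = \<zero>\<^bsub>M\<^esub>)"
proof (cases "fd_module K B M")
  case True
  then interpret M: left_module B M by (simp add: fd_module_def)
  have "\<zero>\<^bsub>B\<^esub> \<odot>\<^bsub>M\<^esub> y = \<zero>\<^bsub>M\<^esub>" if "y \<in> carrier M" for y using that by simp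
  then show ?thesis using True M.M.zero_closed by (auto simp: level_class_iff level_path_def)
qed (simp add: level_class_iff)

lemma level_class_image:
  "M \<in> level_class (Suc k) (top_level (Suc k) - Suc 0) \<longleftrightarrow> fd_module K B M \<and>
     (\<forall>x\<in>carrier M. \<exists>y\<in>carrier M. act M (Vert (Suc k)) x = act M (Arr k) y)"
  by (simp add: level_class_iff level_path_def top_level_def)

text \<open>When there is no path \<open>Comp\<close>, both sides below say that \<open>M\<close> vanishes at the second vertex.\<close>

lemma level_class_comp:
  "M \<in> level_class 1 (top_level 1 - 2) \<longleftrightarrow> fd_module K B M \<and>
     (\<forall>x\<in>carrier M. \<exists>y\<in>carrier M. act M (Vert 1) x = act M Comp y)"
proof (cases "0 < d")
  case True
  then show ?thesis by (simp add: level_class_iff level_path_def top_level_def)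
next
  case False
  then have "b Comp = \<zero>\<^bsub>B\<^esub>" by (intro b_outside) simp
  moreover have "top_level 1 - 2 = 0" unfolding top_level_def using False by simp
  ultimately show ?thesis by (simp only: level_class_iff level_path_def if_True simp_thms)
qed

lemma top_level_minus_two: "i \<noteq> 1 \<Longrightarrow> top_level i - 2 = 0"
  by (simp add: top_level_def)

lemma torsion_class_torsion_of: "torsion_class K B (torsion_of c)"
  unfolding torsion_of_def by (rule torsion_class_Inter) (auto simp: torsion_class_level_class lessThan_empty_iff)

lemma torsion_of_iff: "M \<in> torsion_of c \<longleftrightarrow> (\<forall>i<n. M \<in> level_class i (c i))"
  by (auto simp: torsion_of_def)

lemma torsion_of_mono: "(\<And>i. i < n \<Longrightarrow> c i \<le> c' i) \<Longrightarrow> torsion_of c \<subseteq> torsion_of c'"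
  unfolding subset_iff torsion_of_iff using level_class_mono by (meson subsetD)

context
  fixes T :: "('k list, 'k list) module set"
  assumes T: "torsion_class K B T"
begin

lemma subset_level_class_level: "T \<subseteq> level_class i (level T i)"
proof -
  have "T \<subseteq> level_class i (top_level i)" using torsion_classD(2)[OF T] by (auto simp: level_class_top)
  then show ?thesis unfolding level_def by (rule LeastI)
qed

lemma level_le: "T \<subseteq> level_class i l \<Longrightarrow> level T i \<le> l"
  unfolding level_def by (rule Least_le)

lemma level_le_top_level: "level T i \<le> top_level i"
  using torsion_classD(2)[OF T] by (intro level_le) (auto simp: level_class_top)

lemma not_in_level_class_below_level:
  assumes "0 < level T i"
  obtains M where "M \<in> T" "M \<notin> level_class i (level T i - 1)"
  using level_le[of i "level T i - 1"] assms by fastforce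

lemma subset_torsion_of_level: "T \<subseteq> torsion_of (level T)"
  unfolding subset_iff torsion_of_iff using subset_level_class_level by (meson subsetD)

text \<open>Below the top level, each element of \<open>M\<close> at \<open>i\<close> comes from an arrow (or is zero), and is killed by
\<open>Arr i\<close>. If \<open>M\<close> at \<open>i + 1\<close> is the image of \<open>Arr i\<close>, it is therefore zero.\<close>

lemma admissible_level: "admissible (level T)"
  unfolding admissible_def
proof (intro conjI allI impI level_le_top_level)
  fix i assume i: "Suc i < n" and lt: "level T i < top_level i"
  show "level T (Suc i) = 0 \<or> level T (Suc i) = top_level (Suc i)"
  proof (rule disjCI)
    assume "level T (Suc i) \<noteq> top_level (Suc i)"
    then have lt': "level T (Suc i) \<le> top_level (Suc i) - 1" using level_le_top_level[of "Suc i"] by simp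
    have "T \<subseteq> level_class (Suc i) 0"
    proof
      fix M assume MT: "M \<in> T"
      have M: "left_module B M" using torsion_classD(2)[OF T MT] by (simp add: fd_module_def)
      have 1: "M \<in> level_class (Suc i) (top_level (Suc i) - 1)" and 2: "M \<in> level_class i (top_level i - 1)"
        using subsetD[OF level_class_mono[OF lt'] subsetD[OF subset_level_class_level MT]]
          subsetD[OF level_class_mono subsetD[OF subset_level_class_level MT], of i "top_level i - 1"] lt by auto
      have "act M (Arr i) y = \<zero>\<^bsub>M\<^esub>" if y: "y \<in> carrier M" for y
      proof -
        have "act M (Arr i) y = act M (Arr i) (act M (Vert i) y)"
          using y by (simp add: act_act[OF M])
        also have "\<dots> = \<zero>\<^bsub>M\<^esub>"
        proof (cases i)
          case 0
          then show ?thesis using 2 y act_zero[OF M] by (auto simp: top_level_def level_class_zero)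
        next
          case (Suc k)
          then obtain z where "z \<in> carrier M" "act M (Vert i) y = act M (Arr k) z"
            using 2 y level_class_image[of M k] by auto
          then show ?thesis using Suc by (simp add: act_act[OF M])
        qed
        finally show ?thesis .
      qed
      then show "M \<in> level_class (Suc i) 0" using 1 by (auto simp: level_class_image level_class_zero)
    qed
    then show "level T (Suc i) = 0" using level_le[of "Suc i" 0] by simp
  qed
qed

end

text \<open>Products of two loops vanish, so one loop that is applied to \<open>x\<close> with a nonzero result gives \<open>u\<close>; if
there is none, \<open>u\<close> is \<open>x\<close> at vertex \<open>0\<close>.\<close>

lemma soc_at_start:
  assumes M: "left_module B M" and x: "x \<in> carrier M" "act M (Vert 0) x \<noteq> \<zero>\<^bsub>M\<^esub>"
  obtains u where "u \<in> carrier M" "u \<noteq> \<zero>\<^bsub>M\<^esub>" "act M (Vert 0) u = u" "act M Loop u = \<zero>\<^bsub>M\<^esub>"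
    "\<And>j. act M (Null j) u = \<zero>\<^bsub>M\<^esub>"
proof -
  note simps = act_act[OF M] act_closed[OF M] x(1)
  consider "act M Loop x \<noteq> \<zero>\<^bsub>M\<^esub>" | j where "act M (Null j) x \<noteq> \<zero>\<^bsub>M\<^esub>"
    | "act M Loop x = \<zero>\<^bsub>M\<^esub>" "\<And>j. act M (Null j) x = \<zero>\<^bsub>M\<^esub>" by blast
  then show ?thesis
  proof cases
    case 1
    then show ?thesis using that[of "act M Loop x"] by (simp add: simps)
  next
    case (2 j)
    then show ?thesis using that[of "act M (Null j) x"] by (simp add: simps)
  next
    case 3
    then show ?thesis using that[of "act M (Vert 0) x"] x(2) by (simp add: simps)
  qed
qed

text \<open>\<open>M'\<close> at \<open>i\<close> is not contained in the radical, so some functional vanishes on the radical at \<open>i\<close> but not on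
all of \<open>M'\<close> at \<open>i\<close>. For \<open>0 < i\<close> the radical at \<open>i\<close> is the image of an arrow. At \<open>0\<close> it is a sum of images of
several loops; in place of it the proof uses the subspace \<open>H\<close> killed by all loops, which contains it
because products of loops vanish. If \<open>H\<close> contains all of \<open>M'\<close> at \<open>0\<close>, the radical there is zero.\<close>

lemma nonzero_hom_simple:
  assumes M': "fd_module K B M'" "M' \<notin> level_class i (top_level i - 1)" and M: "left_module B M"
    and u: "u \<in> carrier M" "u \<noteq> \<zero>\<^bsub>M\<^esub>" "act M (Vert i) u = u"
    and ru: "\<And>p. \<not> is_vert p \<Longrightarrow> act M p u = \<zero>\<^bsub>M\<^esub>"
  shows "\<exists>g\<in>left_module_hom B M' M. \<exists>x\<in>carrier M'. g x \<noteq> \<zero>\<^bsub>M\<^esub>"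
proof -
  have lM': "left_module B M'" using M' by (simp add: fd_module_def)
  interpret M': left_module B M' by (rule lM')
  interpret M: left_module B M by (rule M)
  note simps = act_act[OF lM'] act_closed[OF lM']
  have "\<exists>f x. functional M' f \<and> x \<in> carrier M' \<and> f (act M' (Vert i) x) = \<one> \<and>
    (\<forall>p. \<forall>y\<in>carrier M'. \<not> is_vert p \<longrightarrow> tgt p = i \<longrightarrow> f (act M' p y) = \<zero>)"
  proof (cases i)
    case 0
    then obtain x where x: "x \<in> carrier M'" "act M' (Vert 0) x \<noteq> \<zero>\<^bsub>M'\<^esub>"
      using M' by (auto simp: top_level_def level_class_zero)
    define P where "P = insert Loop (range Null)"
    have P: "p \<in> P" if "\<not> is_vert p" "tgt p = 0" for p
      using that by (cases p rule: path.exhaust) (auto simp: P_def)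
    let ?H = "{x \<in> carrier M'. \<forall>p\<in>P. act M' p x = \<zero>\<^bsub>M'\<^esub>}"
    show ?thesis
    proof (cases "\<exists>x\<in>carrier M'. act M' (Vert 0) x \<notin> ?H")
      case True
      then obtain x where x: "x \<in> carrier M'" "act M' (Vert 0) x \<notin> ?H" by blast
      obtain f where f: "functional M' f" "f (act M' (Vert 0) x) = \<one>" "\<And>y. y \<in> ?H \<Longrightarrow> f y = \<zero>"
        using functional_exists[OF lM' submodule_annihilated[OF lM', of P] act_closed[OF lM' x(1)] x(2)] by blast
      have "f (act M' p y) = \<zero>" if "y \<in> carrier M'" "\<not> is_vert p" "tgt p = 0" for p y
        using P[OF that(2,3)] that(1) by (intro f(3)) (auto simp: P_def simps)
      with f x show ?thesis using \<open>i = 0\<close> by blast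
    next
      case False
      obtain f where f: "functional M' f" "f (act M' (Vert 0) x) = \<one>"
        using functional_exists[OF lM' submodule_zero[OF lM'] act_closed[OF lM' x(1), of "Vert 0"]] x(2) by blast
      have "f (act M' p y) = \<zero>" if y: "y \<in> carrier M'" "\<not> is_vert p" "tgt p = 0" for p y
      proof -
        have "act M' p y = act M' p (act M' (Vert 0) y)"
          using P[OF y(2,3)] y(1) by (auto simp: P_def simps)
        also have "\<dots> = \<zero>\<^bsub>M'\<^esub>" using False y(1) P[OF y(2,3)] by blast
        finally show ?thesis using functional_simps(4)[OF lM' f(1)] by simp
      qed
      with f x show ?thesis using \<open>i = 0\<close> by blast
    qed
  next
    case (Suc k)
    then obtain x where x: "x \<in> carrier M'" "act M' (Vert i) x \<notin> act M' (Arr k) ` carrier M'"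
      using M' level_class_image[of M' k] by auto
    obtain f where f: "functional M' f" "f (act M' (Vert i) x) = \<one>"
        "\<And>y. y \<in> act M' (Arr k) ` carrier M' \<Longrightarrow> f y = \<zero>"
      using functional_exists[OF lM' submodule_act_image[OF lM', of "Arr k"] act_closed[OF lM' x(1)] x(2)] by blast
    have "f (act M' p y) = \<zero>" if y: "y \<in> carrier M'" "\<not> is_vert p" "tgt p = i" for p y
    proof -
      have "p = Arr k \<or> p = Comp \<and> k = 0"
        using y(2,3) Suc by (cases p rule: path.exhaust) auto
      then have "act M' p y = act M' (Arr k) y \<or> act M' p y = act M' (Arr k) (act M' Loop y)"
        using y(1) by (auto simp: simps)
      then show ?thesis using f(3) y(1) act_closed[OF lM'] by auto
    qed
    with f x show ?thesis by blast
  qed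
  then obtain f x where f: "functional M' f" and x: "x \<in> carrier M'" "f (act M' (Vert i) x) = \<one>"
    and fr: "\<And>p y. y \<in> carrier M' \<Longrightarrow> \<not> is_vert p \<Longrightarrow> tgt p = i \<Longrightarrow> f (act M' p y) = \<zero>" by blast
  have "f (act M' (Vert i) (act M' p y)) = \<zero>" if "\<not> is_vert p" "y \<in> carrier M'" for p y
    using fr[OF that(2,1)] that functional_simps(4)[OF lM' f] by (auto simp: simps)
  from hom_through_simple[OF lM' M f this u(1,3) ru]
  have g: "(\<lambda>x. scale M (f (act M' (Vert i) x)) u) \<in> left_module_hom B M' M" .
  have gx: "scale M (f (act M' (Vert i) x)) u \<noteq> \<zero>\<^bsub>M\<^esub>" unfolding x(2) using scale_one[OF M u(1)] u(2) by simp
  show ?thesis by (rule bexI[OF _ g], rule bexI[OF _ x(1)], rule gx)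
qed

lemma nonzero_hom_arrow:
  assumes M': "M' \<in> level_class (Suc i) (top_level (Suc i) - 1)" "M' \<notin> level_class (Suc i) (top_level (Suc i) - 2)" and M: "left_module B M"
    and u: "u \<in> carrier M" "act M (Vert i) u = u" "act M (Arr i) u \<noteq> \<zero>\<^bsub>M\<^esub>"
    and ru: "\<And>p. \<not> is_vert p \<Longrightarrow> p \<noteq> Arr i \<Longrightarrow> act M p u = \<zero>\<^bsub>M\<^esub>"
  shows "\<exists>g\<in>left_module_hom B M' M. \<exists>x\<in>carrier M'. g x \<noteq> \<zero>\<^bsub>M\<^esub>"
proof -
  have fd: "fd_module K B M'" using M'(1) by (simp add: level_class_image)
  then have lM': "left_module B M'" by (simp add: fd_module_def)
  interpret M': left_module B M' by (rule lM')
  interpret M: left_module B M by (rule M)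
  note simps = act_act[OF lM'] act_closed[OF lM']
  have "\<exists>f x. functional M' f \<and> x \<in> carrier M' \<and> f (act M' (Vert (Suc i)) x) = \<one> \<and>
    (i = 0 \<longrightarrow> (\<forall>y\<in>carrier M'. f (act M' Comp y) = \<zero>))"
  proof (cases i)
    case 0
    then obtain x where x: "x \<in> carrier M'" "act M' (Vert 1) x \<notin> act M' Comp ` carrier M'"
      using M'(2) level_class_comp[of M'] fd by auto
    obtain f where "functional M' f" "f (act M' (Vert 1) x) = \<one>" "\<And>y. y \<in> act M' Comp ` carrier M' \<Longrightarrow> f y = \<zero>"
      using functional_exists[OF lM' submodule_act_image[OF lM', of Comp] act_closed[OF lM' x(1)] x(2)] by blast
    with x(1) 0 show ?thesis by auto
  next
    case (Suc k)
    then obtain x where x: "x \<in> carrier M'" "act M' (Vert (Suc i)) x \<noteq> \<zero>\<^bsub>M'\<^esub>"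
      using M'(2) fd by (auto simp: top_level_minus_two level_class_zero)
    obtain f where "functional M' f" "f (act M' (Vert (Suc i)) x) = \<one>"
      using functional_exists[OF lM' submodule_zero[OF lM'] act_closed[OF lM' x(1), of "Vert (Suc i)"]] x(2) by blast
    with x(1) Suc show ?thesis by auto
  qed
  then obtain f x where f: "functional M' f" and x: "x \<in> carrier M'" "f (act M' (Vert (Suc i)) x) = \<one>"
    and fr: "\<And>y. i = 0 \<Longrightarrow> y \<in> carrier M' \<Longrightarrow> f (act M' Comp y) = \<zero>" by blast
  obtain y where y: "y \<in> carrier M'" "act M' (Vert (Suc i)) x = act M' (Arr i) y"
    using M'(1) x(1) by (auto simp: level_class_image)
  let ?g = "\<lambda>x. scale M (f (act M' (Arr i) x)) u \<oplus>\<^bsub>M\<^esub> scale M (f (act M' (Vert (Suc i)) x)) (act M (Arr i) u)"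
  have g: "?g \<in> left_module_hom B M' M" by (rule hom_through_arrow[OF lM' M f fr u(1,2) ru])
  have gy: "?g (act M' (Vert i) y) = u"
  proof -
    have "f (act M' (Arr i) (act M' (Vert i) y)) = \<one>" using x(2) y by (simp add: simps)
    moreover have "f (act M' (Vert (Suc i)) (act M' (Vert i) y)) = \<zero>"
      using y(1) functional_simps(4)[OF lM' f] by (simp add: simps)
    ultimately show ?thesis
      using scale_one[OF M u(1)] scale_zero[OF M act_closed[OF M u(1)]] u(1) by simp
  qed
  have "u \<noteq> \<zero>\<^bsub>M\<^esub>" using u(3) by auto
  then have gy': "?g (act M' (Vert i) y) \<noteq> \<zero>\<^bsub>M\<^esub>" unfolding gy .
  show ?thesis by (rule bexI[OF _ g], rule bexI[OF _ act_closed[OF lM' y(1)]], rule gy')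
qed

lemma nonzero_hom_loop:
  assumes M': "M' \<in> level_class 1 1" "M' \<notin> level_class 1 0" and "0 < d" and M: "left_module B M"
    and w: "w \<in> carrier M" "act M (Vert 0) w = w" "act M (Arr 0) w = \<zero>\<^bsub>M\<^esub>"
      "\<And>j. act M (Null j) w = \<zero>\<^bsub>M\<^esub>" "act M Comp w \<noteq> \<zero>\<^bsub>M\<^esub>"
  shows "\<exists>g\<in>left_module_hom B M' M. \<exists>x\<in>carrier M'. g x \<noteq> \<zero>\<^bsub>M\<^esub>"
proof -
  have fd: "fd_module K B M'" using M'(1) by (simp add: level_class_iff)
  then have lM': "left_module B M'" by (simp add: fd_module_def)
  interpret M': left_module B M' by (rule lM')
  interpret M: left_module B M by (rule M)
  note simps = act_act[OF lM'] act_closed[OF lM']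
  obtain x where x: "x \<in> carrier M'" "act M' (Vert 1) x \<noteq> \<zero>\<^bsub>M'\<^esub>"
    using M'(2) fd by (auto simp: level_class_zero)
  obtain f where f: "functional M' f" "f (act M' (Vert 1) x) = \<one>"
    using functional_exists[OF lM' submodule_zero[OF lM'] act_closed[OF lM' x(1), of "Vert 1"]] x(2) by blast
  obtain y where y: "y \<in> carrier M'" "act M' (Vert 1) x = act M' Comp y"
    using M'(1) level_class_comp[of M'] x(1) \<open>0 < d\<close> by (auto simp: top_level_def)
  note fs = functional_simps[OF lM' f(1)]
  let ?g = "\<lambda>x. scale M (f (act M' Comp x)) w \<oplus>\<^bsub>M\<^esub> (scale M (f (act M' (Arr 0) x)) (act M Loop w) \<oplus>\<^bsub>M\<^esub>
      scale M (f (act M' (Vert 1) x)) (act M Comp w))"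
  have g: "?g \<in> left_module_hom B M' M" by (rule hom_through_loop[OF lM' M f(1) w(1-4)])
  have c: "f (act M' p y) \<in> carrier K" for p using fs(1) y(1) act_closed[OF lM'] by simp
  have gy: "?g y \<noteq> \<zero>\<^bsub>M\<^esub>"
  proof
    assume "?g y = \<zero>\<^bsub>M\<^esub>"
    then have "act M Comp (?g y) = \<zero>\<^bsub>M\<^esub>" by simp
    moreover have "act M Comp (?g y) = scale M (f (act M' Comp y)) (act M Comp w)"
      using c w(1) by (simp add: act_add[OF M] act_scale[OF M] act_act[OF M] scale_closed[OF M] act_closed[OF M] scale_zero_right[OF M])
    moreover have "f (act M' Comp y) = \<one>" using f(2) y(2) by simp
    ultimately show False using scale_one[OF M act_closed[OF M w(1), of Comp]] w(5) by simp
  qed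
  show ?thesis by (rule bexI[OF _ g], rule bexI[OF _ y(1)], rule gy)
qed

text \<open>Let \<open>M\<close> be nonzero and let \<open>i\<close> be the last vertex at which it does not vanish. If \<open>i\<close> has the top level,
then \<open>M\<close> has a simple submodule at \<open>i\<close>, and some module in \<open>T\<close> has a simple quotient there. Otherwise
the vertex \<open>k\<close> before \<open>i\<close> has the top level and \<open>M\<close> at \<open>i\<close> is an image from \<open>k\<close>, so that \<open>M\<close> contains the
simple module at \<open>k\<close>, the module of length two on \<open>k, i\<close>, or the one of length three on \<open>0, 0, 1\<close>;
the level of \<open>i\<close> tells which of them \<open>T\<close> contains.\<close>

lemma torsion_of_level_subset:
  assumes T: "torsion_class K B T"
  shows "torsion_of (level T) \<subseteq> T"
proof (rule subset_torsion_class_by_homs[OF T])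
  show "fd_module K B M" if "M \<in> torsion_of (level T)" for M
    using that torsion_classD(2)[OF torsion_class_torsion_of] by blast
  show "N \<in> torsion_of (level T)" if "M \<in> torsion_of (level T)" "fd_module K B N" "is_quotient B M N" for M N
    using torsion_classD(3)[OF torsion_class_torsion_of that] .
next
  fix M assume MC: "M \<in> torsion_of (level T)" and nz: "carrier M \<noteq> {\<zero>\<^bsub>M\<^esub>}"
  have fdM: "fd_module K B M" using MC torsion_classD(2)[OF torsion_class_torsion_of] by blast
  then have M: "left_module B M" by (simp add: fd_module_def)
  interpret M: left_module B M by (rule M)
  note simps = act_act[OF M] act_closed[OF M]
  let ?S = "{i. i < n \<and> (\<exists>x\<in>carrier M. act M (Vert i) x \<noteq> \<zero>\<^bsub>M\<^esub>)}"
  have "\<exists>x\<in>carrier M. x \<noteq> \<zero>\<^bsub>M\<^esub>" using nz M.M.zero_closed by blast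
  then have ne: "?S \<noteq> {}" using eq_zero_if_vertices_zero[OF M] by blast
  have fin: "finite ?S" by simp
  define i where "i = Max ?S"
  have "i \<in> ?S" unfolding i_def using Max_in[OF fin ne] .
  then obtain x0 where i: "i < n" and x0: "x0 \<in> carrier M" "act M (Vert i) x0 \<noteq> \<zero>\<^bsub>M\<^esub>" by blast
  have above: "act M (Vert k) x = \<zero>\<^bsub>M\<^esub>" if "i < k" "k < n" "x \<in> carrier M" for k x
    using that Max_ge[OF fin, of k] unfolding i_def[symmetric] by (auto simp: not_le)
  have ar: "act M (Arr i) x = \<zero>\<^bsub>M\<^esub>" if x: "x \<in> carrier M" for x
  proof (cases "Suc i < n")
    case True
    have "act M (Arr i) x = act M (Vert (Suc i)) (act M (Arr i) x)" using x by (simp add: simps)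
    then show ?thesis using above[of "Suc i"] True x act_closed[OF M] by simp
  qed (use x act_outside[OF M] in simp)
  have co0: "act M Comp x = \<zero>\<^bsub>M\<^esub>" if x: "x \<in> carrier M" "i = 0" for x
    using ar[of "act M Loop x"] x by (simp add: simps)
  have MD: "M \<in> level_class k (level T k)" if "k < n" for k using MC that by (simp add: torsion_of_iff)
  have pos: "0 < level T i"
    using MD[OF i] x0 by (cases "level T i = 0") (auto simp: level_class_zero)
  obtain M' where M': "M' \<in> T" "M' \<notin> level_class i (level T i - 1)" using not_in_level_class_below_level[OF T pos] .
  have fdM': "fd_module K B M'" by (rule torsion_classD(2)[OF T M'(1)])
  have M'D: "M' \<in> level_class i (level T i)" using subset_level_class_level[OF T] M'(1) by blast
  show "\<exists>M'\<in>T. \<exists>g\<in>left_module_hom B M' M. \<exists>x\<in>carrier M'. g x \<noteq> \<zero>\<^bsub>M\<^esub>"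
  proof (cases "level T i = top_level i")
    case True
    have "\<exists>u\<in>carrier M. u \<noteq> \<zero>\<^bsub>M\<^esub> \<and> act M (Vert i) u = u \<and> (\<forall>p. \<not> is_vert p \<longrightarrow> act M p u = \<zero>\<^bsub>M\<^esub>)"
    proof (cases "i = 0")
      case True
      obtain u where u: "u \<in> carrier M" "u \<noteq> \<zero>\<^bsub>M\<^esub>" "act M (Vert 0) u = u" "act M Loop u = \<zero>\<^bsub>M\<^esub>"
        "\<And>j. act M (Null j) u = \<zero>\<^bsub>M\<^esub>" using soc_at_start[OF M x0(1)] x0(2) True by auto
      have "act M p u = \<zero>\<^bsub>M\<^esub>" if "\<not> is_vert p" for p
      proof (cases p rule: path.exhaust)
        case (Arr k)
        then show ?thesis
          using act_act[OF M u(1), of "Arr k" "Vert 0"] u(1,3) ar[OF u(1)] True by (cases "k = 0") auto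
      qed (use u that co0[OF u(1)] True in auto)
      with u True show ?thesis by blast
    next
      case False
      let ?u = "act M (Vert i) x0"
      have "act M p ?u = \<zero>\<^bsub>M\<^esub>" if "\<not> is_vert p" for p
        using that False x0(1) ar[OF x0(1)] by (cases p rule: path.exhaust) (auto simp: simps)
      moreover have "act M (Vert i) ?u = ?u" using x0(1) by (simp add: simps)
      ultimately show ?thesis using x0 act_closed[OF M x0(1)] by blast
    qed
    then obtain u where u: "u \<in> carrier M" "u \<noteq> \<zero>\<^bsub>M\<^esub>" "act M (Vert i) u = u"
      "\<And>p. \<not> is_vert p \<Longrightarrow> act M p u = \<zero>\<^bsub>M\<^esub>" by blast
    show ?thesis
      using nonzero_hom_simple[OF fdM' _ M u] M' True by auto
  next
    case False
    then have lt: "level T i < top_level i" using level_le_top_level[OF T, of i] by simp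
    then obtain k where k: "i = Suc k" using pos by (cases i) (auto simp: top_level_def)
    have lk: "level T k = top_level k"
    proof (rule ccontr)
      assume "level T k \<noteq> top_level k"
      then have "level T k < top_level k" using level_le_top_level[OF T, of k] by simp
      then show False using admissible_level[OF T] i k lt pos unfolding admissible_def by auto
    qed
    obtain M'' where M'': "M'' \<in> T" "M'' \<notin> level_class k (top_level k - 1)"
      using not_in_level_class_below_level[OF T, of k] lk by auto
    have fdM'': "fd_module K B M''" by (rule torsion_classD(2)[OF T M''(1)])
    have "level T i \<le> top_level i - 1" using lt by simp
    from level_class_mono[OF this, of i] have Mim: "M \<in> level_class i (top_level i - 1)" "M' \<in> level_class i (top_level i - 1)"
      using MD[OF i] M'D by blast+
    obtain y where y: "y \<in> carrier M" "act M (Vert i) x0 = act M (Arr k) y"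
      using Mim(1) x0(1) by (auto simp: k level_class_image)
    have ynz: "act M (Arr k) y \<noteq> \<zero>\<^bsub>M\<^esub>" using x0(2) y by simp
    show ?thesis
    proof (cases "k = 0")
      case False
      then have "level T i - 1 = top_level i - 2" using lt pos k by (auto simp: top_level_def)
      then have M'n: "M' \<notin> level_class (Suc k) (top_level (Suc k) - 2)" using M'(2) k by simp
      let ?u = "act M (Vert k) y"
      have u: "?u \<in> carrier M" "act M (Vert k) ?u = ?u" "act M (Arr k) ?u \<noteq> \<zero>\<^bsub>M\<^esub>"
        using y(1) ynz by (auto simp: simps)
      have "act M p ?u = \<zero>\<^bsub>M\<^esub>" if "\<not> is_vert p" "p \<noteq> Arr k" for p
        using that False y(1) by (cases p rule: path.exhaust) (auto simp: simps)
      from nonzero_hom_arrow[OF Mim(2)[unfolded k] M'n M u this] show ?thesis using M'(1) by blast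
    next
      case True
      show ?thesis
      proof (cases "\<exists>u\<in>carrier M. u \<noteq> \<zero>\<^bsub>M\<^esub> \<and> act M (Vert 0) u = u \<and> (\<forall>p. \<not> is_vert p \<longrightarrow> act M p u = \<zero>\<^bsub>M\<^esub>)")
        case soc: True
        then obtain u where u: "u \<in> carrier M" "u \<noteq> \<zero>\<^bsub>M\<^esub>" "act M (Vert 0) u = u"
          "\<And>p. \<not> is_vert p \<Longrightarrow> act M p u = \<zero>\<^bsub>M\<^esub>" by blast
        show ?thesis using nonzero_hom_simple[OF fdM'' _ M u] M'' True by blast
      next
        case nosoc: False
        \<comment> \<open>From here on \<open>M\<close> has no simple submodule at \<open>0\<close>.\<close>
        have *: "act M (Arr 0) u \<noteq> \<zero>\<^bsub>M\<^esub>"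
          if u: "u \<in> carrier M" "u \<noteq> \<zero>\<^bsub>M\<^esub>" "act M (Vert 0) u = u" "act M Loop u = \<zero>\<^bsub>M\<^esub>"
            "\<And>j. act M (Null j) u = \<zero>\<^bsub>M\<^esub>" for u
        proof
          assume a: "act M (Arr 0) u = \<zero>\<^bsub>M\<^esub>"
          have "act M p u = \<zero>\<^bsub>M\<^esub>" if "\<not> is_vert p" for p
          proof (cases p rule: path.exhaust)
            case (Arr k)
            then show ?thesis
              using act_act[OF M u(1), of "Arr k" "Vert 0"] u(3) a by (cases "k = 0") auto
          next
            case Comp
            then show ?thesis using act_act[OF M u(1), of "Arr 0" Loop] u(4) by simp
          qed (use u that in auto)
          with nosoc u show False by blast
        qed
        show ?thesis
        proof (cases "level T i - 1 = top_level i - 2")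
          case eq: True
          have e0: "act M (Vert 0) y \<noteq> \<zero>\<^bsub>M\<^esub>"
          proof
            assume "act M (Vert 0) y = \<zero>\<^bsub>M\<^esub>"
            then have "act M (Arr 0) (act M (Vert 0) y) = \<zero>\<^bsub>M\<^esub>" by simp
            then show False using ynz True y(1) by (simp add: simps)
          qed
          obtain u where u: "u \<in> carrier M" "u \<noteq> \<zero>\<^bsub>M\<^esub>" "act M (Vert 0) u = u" "act M Loop u = \<zero>\<^bsub>M\<^esub>"
            "\<And>j. act M (Null j) u = \<zero>\<^bsub>M\<^esub>" using soc_at_start[OF M y(1) e0] by blast
          have kill: "act M p u = \<zero>\<^bsub>M\<^esub>" if "\<not> is_vert p" "p \<noteq> Arr 0" for p
          proof (cases p rule: path.exhaust)
            case (Arr k)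
            then show ?thesis using act_act[OF M u(1), of "Arr k" "Vert 0"] u(3) that by auto
          next
            case Comp
            then show ?thesis using act_act[OF M u(1), of "Arr 0" Loop] u(4) by simp
          qed (use u that in auto)
          have M'n: "M' \<notin> level_class (Suc 0) (top_level (Suc 0) - 2)" using M'(2) eq k True by simp
          from nonzero_hom_arrow[OF _ M'n M u(1,3) *[OF u] kill] Mim(2) k True M'(1)
          show ?thesis by blast
        next
          case ne: False
          then have d: "0 < d" "level T i = 1" using lt pos k True by (auto simp: top_level_def split: if_splits)
          have i1: "i = 1" using k True by simp
          have MC1: "M \<in> level_class 1 1" and M'1: "M' \<in> level_class 1 1" "M' \<notin> level_class 1 0"
            using MD[OF i] M'D M'(2) d(2) i1 by auto
          have comp: "\<exists>y\<in>carrier M. act M (Vert 1) x = act M Comp y" if "x \<in> carrier M" for x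
            using MC1 level_class_comp[of M] d(1) that by (auto simp: top_level_def)
          obtain z where z: "z \<in> carrier M" "act M (Vert 1) x0 = act M Comp z" using comp[OF x0(1)] by blast
          let ?w0 = "act M (Vert 0) z"
          have w0: "?w0 \<in> carrier M" "act M Comp ?w0 \<noteq> \<zero>\<^bsub>M\<^esub>"
            using z x0(2) i1 by (auto simp: simps)
          have nul: "act M (Null j) ?w0 = \<zero>\<^bsub>M\<^esub>" for j
          proof (rule ccontr)
            assume "act M (Null j) ?w0 \<noteq> \<zero>\<^bsub>M\<^esub>"
            then have "act M (Arr 0) (act M (Null j) ?w0) \<noteq> \<zero>\<^bsub>M\<^esub>"
              using z(1) by (intro *) (simp_all add: simps)
            then show False using z(1) by (simp add: simps)
          qed
          obtain z' where z': "z' \<in> carrier M" "act M (Vert 1) (act M (Arr 0) ?w0) = act M Comp z'"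
            using comp[of "act M (Arr 0) ?w0"] w0(1) act_closed[OF M] by blast
          then have az: "act M (Arr 0) ?w0 = act M Comp z'" using z(1) by (simp add: simps)
          \<comment> \<open>Correct \<open>w0\<close> by an element in the image of \<open>Loop\<close> such that \<open>Arr 0\<close> kills the difference.\<close>
          let ?w = "?w0 \<oplus>\<^bsub>M\<^esub> \<ominus>\<^bsub>M\<^esub> act M Loop z'"
          have "?w \<in> carrier M" using z z' by (simp add: simps)
          moreover have "act M (Vert 0) ?w = ?w"
            using z z' by (simp add: simps act_add[OF M] act_minus[OF M])
          moreover have "act M (Arr 0) ?w = \<zero>\<^bsub>M\<^esub>"
            using z z' az by (simp add: simps act_add[OF M] act_minus[OF M] M.M.r_neg)
          moreover have "act M (Null j) ?w = \<zero>\<^bsub>M\<^esub>" for j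
            using z z' nul by (simp add: simps act_add[OF M] act_minus[OF M])
          moreover have "act M Comp ?w \<noteq> \<zero>\<^bsub>M\<^esub>"
            using z z' w0 by (simp add: simps act_add[OF M] act_minus[OF M])
          ultimately show ?thesis using nonzero_hom_loop[OF M'1 d(1) M] M'(1) by blast
        qed
      qed
    qed
  qed
qed

lemma torsion_of_level: "torsion_class K B T \<Longrightarrow> torsion_of (level T) = T"
  using torsion_of_level_subset subset_torsion_of_level by blast

lemma subset_iff_level:
  assumes "torsion_class K B T" "torsion_class K B T'"
  shows "T \<subseteq> T' \<longleftrightarrow> (\<forall>i<n. level T i \<le> level T' i)"
proof
  assume "T \<subseteq> T'"
  then have "T \<subseteq> level_class i (level T' i)" for i using subset_level_class_level[OF assms(2)] by blast
  then show "\<forall>i<n. level T i \<le> level T' i" using level_le[OF assms(1)] by blast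
next
  assume "\<forall>i<n. level T i \<le> level T' i"
  then have "torsion_of (level T) \<subseteq> torsion_of (level T')" by (intro torsion_of_mono) simp
  then show "T \<subseteq> T'" using torsion_of_level[OF assms(1)] torsion_of_level[OF assms(2)] by simp
qed

end

section \<open>The lattice of torsion classes\<close>

context path_algebra_locale
begin

definition regular_module :: "('k list, 'k list) module" where
  "regular_module = \<lparr>carrier = carrier B, mult = mult B, one = one B, zero = zero B, add = add B, smult = mult B\<rparr>"

lemma regular_module_simps [simp]:
  "carrier regular_module = carrier B" "zero regular_module = zero B" "add regular_module = add B" "smult regular_module = mult B"
  by (simp_all add: regular_module_def)

lemma left_module_regular_module: "left_module B regular_module"
proof (intro left_module.intro left_module_axioms.intro ring_B)
  show "abelian_group regular_module"
    by (rule abelian_groupI) (insert abelian_groupE[OF abelian_group_B], auto)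
qed (auto simp: A.l_distr A.r_distr A.m_assoc)

lemma fd_module_regular_module: "fd_module K B regular_module"
proof -
  interpret linear_map K B "underlying_space B regular_module" "\<lambda>x. x"
    by (intro linear_map.intro linear_map_axioms.intro module_axioms
        module_underlying_space[OF left_module_regular_module]) (auto simp: smult_mult_left)
  show ?thesis using finite_dimensional_image[OF finite_dim] left_module_regular_module by (simp add: fd_module_def)
qed

lemma co_b_mult:
  assumes g: "g \<in> carrier B" and q: "q \<in> set ps"
  shows "co (b p \<otimes>\<^bsub>B\<^esub> g) q =
    (if is_vert p then if tgt q = tgt p then co g q else \<zero>
     else if q = p then co g (Vert (src p)) else if p = Arr 0 \<and> q = Comp then co g Loop else \<zero>)"
  using g q by (cases q rule: path.exhaust; cases p rule: path.exhaust) (auto simp: co_simps co_b)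

text \<open>The quotient of the algebra by the elements whose coefficients at \<open>Q\<close> vanish; the conditions on \<open>Q\<close> say
that these form a left ideal. The three modules through which the homomorphisms above factor are
of this form, and they witness that all admissible families of levels occur.\<close>

lemma truncated_module_exists:
  assumes Q: "Q \<subseteq> set ps" "\<And>q. q \<in> Q \<Longrightarrow> Vert (src q) \<in> Q" "Comp \<in> Q \<Longrightarrow> Loop \<in> Q"
  obtains M :: "('k list, 'k list) module" where "fd_module K B M"
    "\<And>i l. M \<in> level_class i l \<longleftrightarrow> (\<forall>f\<in>carrier B. \<exists>g\<in>carrier B. \<forall>q\<in>Q. co (b (Vert i) \<otimes>\<^bsub>B\<^esub> f) q = co (level_path i l \<otimes>\<^bsub>B\<^esub> g) q)"
proof -
  define H where "H = {f \<in> carrier B. \<forall>q\<in>Q. co f q = \<zero>}"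
  have "co (f \<otimes>\<^bsub>B\<^esub> g) q = \<zero>" if "f \<in> carrier B" "g \<in> H" "q \<in> Q" for f g q
  proof -
    have "g \<in> carrier B" "co g q = \<zero>" "co g (Vert (src q)) = \<zero>" "q = Comp \<Longrightarrow> co g Loop = \<zero>" "q \<in> set ps"
      using that(2,3) Q by (auto simp: H_def)
    then show ?thesis using that(1) by (cases q rule: path.exhaust) (auto simp: co_simps)
  qed
  then have H: "left_submodule B regular_module H"
    by (auto simp: left_submodule_def H_def co_simps)
  obtain M :: "('k list, 'k list) module" and p where M: "left_module B M" and p: "p \<in> left_module_hom B regular_module M"
    "p ` carrier regular_module = carrier M" "{x \<in> carrier regular_module. p x = \<zero>\<^bsub>M\<^esub>} = H"
    using quotient_exists[OF left_module_regular_module H] .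
  interpret M: left_module B M by (rule M)
  note P = left_module_homD[OF p(1), simplified]
  have fd: "fd_module K B M" by (rule fd_module_image[OF fd_module_regular_module M p(1,2)])
  have peq: "p f = p g \<longleftrightarrow> (\<forall>q\<in>Q. co f q = co g q)" if f: "f \<in> carrier B" and g: "g \<in> carrier B" for f g
  proof -
    define h where "h = map (\<lambda>q. \<ominus> co g q \<oplus> co f q) ps"
    have h: "h \<in> carrier B" using f g by (simp add: h_def)
    have "f = g \<oplus>\<^bsub>B\<^esub> h"
      using f g h by (intro B_eqI) (auto simp: co_simps h_def coeff_map K.r_neg2)
    then have "p f = p g \<oplus>\<^bsub>M\<^esub> p h" using P(2)[OF g h] by simp
    then have "p f = p g \<longleftrightarrow> p h = \<zero>\<^bsub>M\<^esub>" using P(1)[OF g] P(1)[OF h] by simp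
    also have "\<dots> \<longleftrightarrow> h \<in> H" using p(3) h by auto
    also have "\<dots> \<longleftrightarrow> (\<forall>q\<in>Q. \<ominus> co g q \<oplus> co f q = \<zero>)"
      using h Q(1) by (auto simp: H_def h_def coeff_map)
    also have "\<dots> \<longleftrightarrow> (\<forall>q\<in>Q. co f q = co g q)"
    proof -
      have "\<ominus> co g q \<oplus> co f q = \<zero> \<longleftrightarrow> co f q = co g q" for q
        using f g K.l_neg[of "co g q"] K.r_neg2[of "co g q" "co f q"] by auto
      then show ?thesis by simp
    qed
    finally show ?thesis .
  qed
  have carM: "carrier M = p ` carrier B" using p(2) by simp
  have D: "M \<in> level_class i l \<longleftrightarrow> (\<forall>f\<in>carrier B. \<exists>g\<in>carrier B. \<forall>q\<in>Q. co (b (Vert i) \<otimes>\<^bsub>B\<^esub> f) q = co (level_path i l \<otimes>\<^bsub>B\<^esub> g) q)" for i l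
  proof -
    have "b (Vert i) \<odot>\<^bsub>M\<^esub> p f = level_path i l \<odot>\<^bsub>M\<^esub> p g \<longleftrightarrow> (\<forall>q\<in>Q. co (b (Vert i) \<otimes>\<^bsub>B\<^esub> f) q = co (level_path i l \<otimes>\<^bsub>B\<^esub> g) q)"
      if "f \<in> carrier B" "g \<in> carrier B" for f g
      using P(3)[of "b (Vert i)" f] P(3)[of "level_path i l" g] peq[of "b (Vert i) \<otimes>\<^bsub>B\<^esub> f" "level_path i l \<otimes>\<^bsub>B\<^esub> g"] that by simp
    then show ?thesis using fd unfolding level_class_iff carM by simp
  qed
  show ?thesis by (rule that[OF fd D])
qed

lemma simple_witness:
  assumes i: "i < n"
  obtains M :: "('k list, 'k list) module" where "fd_module K B M" "M \<notin> level_class i (top_level i - 1)" "\<And>j l. j \<noteq> i \<Longrightarrow> M \<in> level_class j l"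
proof -
  obtain M :: "('k list, 'k list) module" where fd: "fd_module K B M" and D: "\<And>j l. M \<in> level_class j l \<longleftrightarrow> (\<forall>f\<in>carrier B. \<exists>g\<in>carrier B. \<forall>q\<in>{Vert i}. co (b (Vert j) \<otimes>\<^bsub>B\<^esub> f) q = co (level_path j l \<otimes>\<^bsub>B\<^esub> g) q)"
    by (rule truncated_module_exists[of "{Vert i}"]) (use i in auto)
  have "M \<notin> level_class i (top_level i - 1)"
  proof
    assume "M \<in> level_class i (top_level i - 1)"
    then obtain g where "g \<in> carrier B" "co (b (Vert i) \<otimes>\<^bsub>B\<^esub> b (Vert i)) (Vert i) = co (level_path i (top_level i - 1) \<otimes>\<^bsub>B\<^esub> g) (Vert i)"
      unfolding D using b_closed by blast
    moreover have "level_path i (top_level i - 1) = \<zero>\<^bsub>B\<^esub> \<or> (\<exists>k. level_path i (top_level i - 1) = b (Arr k))"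
      by (cases i) (auto simp: level_path_def top_level_def)
    ultimately show False using i by (auto simp: b_mult co_b co_b_mult co_simps(2-))
  qed
  moreover have "M \<in> level_class j l" if "j \<noteq> i" for j l
    unfolding D using that i by (auto simp: co_b_mult co_simps(2-) intro!: bexI[of _ "\<zero>\<^bsub>B\<^esub>"])
  ultimately show ?thesis using that fd by blast
qed

lemma arrow_witness:
  assumes k: "Suc k < n"
  obtains M :: "('k list, 'k list) module" where "fd_module K B M" "M \<in> level_class (Suc k) (top_level (Suc k) - 1)"
    "M \<notin> level_class (Suc k) (top_level (Suc k) - 2)" "\<And>j l. j \<noteq> k \<Longrightarrow> j \<noteq> Suc k \<Longrightarrow> M \<in> level_class j l"
proof -
  let ?Q = "{Vert k, Arr k}"
  obtain M :: "('k list, 'k list) module" where fd: "fd_module K B M" and D: "\<And>j l. M \<in> level_class j l \<longleftrightarrow> (\<forall>f\<in>carrier B. \<exists>g\<in>carrier B. \<forall>q\<in>?Q. co (b (Vert j) \<otimes>\<^bsub>B\<^esub> f) q = co (level_path j l \<otimes>\<^bsub>B\<^esub> g) q)"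
    by (rule truncated_module_exists[of ?Q]) (use k in auto)
  have "M \<notin> level_class (Suc k) (top_level (Suc k) - 2)"
  proof
    assume "M \<in> level_class (Suc k) (top_level (Suc k) - 2)"
    then obtain g where g: "g \<in> carrier B" "co (b (Vert (Suc k)) \<otimes>\<^bsub>B\<^esub> b (Arr k)) (Arr k) = co (level_path (Suc k) (top_level (Suc k) - 2) \<otimes>\<^bsub>B\<^esub> g) (Arr k)"
      unfolding D using b_closed by blast
    have "level_path (Suc k) (top_level (Suc k) - 2) = \<zero>\<^bsub>B\<^esub> \<or> level_path (Suc k) (top_level (Suc k) - 2) = b Comp"
      by (auto simp: level_path_def top_level_def)
    then show False using g k by (auto simp: b_mult co_b co_b_mult co_simps(2-))
  qed
  moreover have "M \<in> level_class (Suc k) (top_level (Suc k) - 1)"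
    unfolding D
  proof
    fix f assume f: "f \<in> carrier B"
    have "level_path (Suc k) (top_level (Suc k) - 1) = b (Arr k)" by (simp add: level_path_def top_level_def)
    then show "\<exists>g\<in>carrier B. \<forall>q\<in>?Q. co (b (Vert (Suc k)) \<otimes>\<^bsub>B\<^esub> f) q = co (level_path (Suc k) (top_level (Suc k) - 1) \<otimes>\<^bsub>B\<^esub> g) q"
      using f k by (intro bexI[of _ "co f (Arr k) \<odot>\<^bsub>B\<^esub> b (Vert k)"]) (auto simp: co_b_mult co_simps(2-) co_b)
  qed
  moreover have "M \<in> level_class j l" if "j \<noteq> k" "j \<noteq> Suc k" for j l
    unfolding D using that k by (auto simp: co_b_mult co_simps(2-) intro!: bexI[of _ "\<zero>\<^bsub>B\<^esub>"])
  ultimately show ?thesis using that fd by blast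
qed

lemma loop_witness:
  assumes d: "0 < d"
  obtains M :: "('k list, 'k list) module" where "fd_module K B M" "M \<in> level_class 1 1" "M \<notin> level_class 1 0" "\<And>j l. j \<noteq> 0 \<Longrightarrow> j \<noteq> 1 \<Longrightarrow> M \<in> level_class j l"
proof -
  let ?Q = "{Vert 0, Loop, Comp}"
  obtain M :: "('k list, 'k list) module" where fd: "fd_module K B M" and D: "\<And>j l. M \<in> level_class j l \<longleftrightarrow> (\<forall>f\<in>carrier B. \<exists>g\<in>carrier B. \<forall>q\<in>?Q. co (b (Vert j) \<otimes>\<^bsub>B\<^esub> f) q = co (level_path j l \<otimes>\<^bsub>B\<^esub> g) q)"
    by (rule truncated_module_exists[of ?Q]) (use d in auto)
  have "M \<notin> level_class 1 0"
  proof
    assume "M \<in> level_class 1 0"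
    then obtain g where "g \<in> carrier B" "co (b (Vert 1) \<otimes>\<^bsub>B\<^esub> b Comp) Comp = co (level_path 1 0 \<otimes>\<^bsub>B\<^esub> g) Comp"
      unfolding D using b_closed by blast
    then show False using d by (auto simp: b_mult co_b level_path_def co_simps)
  qed
  moreover have "M \<in> level_class 1 1"
    unfolding D
  proof
    fix f assume f: "f \<in> carrier B"
    have "level_path 1 1 = b Comp" using d by (simp add: level_path_def top_level_def)
    then show "\<exists>g\<in>carrier B. \<forall>q\<in>?Q. co (b (Vert 1) \<otimes>\<^bsub>B\<^esub> f) q = co (level_path 1 1 \<otimes>\<^bsub>B\<^esub> g) q"
      using f d by (intro bexI[of _ "co f Comp \<odot>\<^bsub>B\<^esub> b (Vert 0)"]) (auto simp: co_b_mult co_simps(2-) co_b)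
  qed
  moreover have "M \<in> level_class j l" if "j \<noteq> 0" "j \<noteq> 1" for j l
    unfolding D using that d by (auto simp: co_b_mult co_simps(2-) intro!: bexI[of _ "\<zero>\<^bsub>B\<^esub>"])
  ultimately show ?thesis using that fd by blast
qed

lemma level_torsion_of:
  assumes c: "admissible c" and i: "i < n"
  shows "level (torsion_of c) i = c i"
proof (rule antisym)
  have "torsion_of c \<subseteq> level_class i (c i)" using i by (auto simp: torsion_of_iff)
  then show "level (torsion_of c) i \<le> c i" by (rule level_le[OF torsion_class_torsion_of])
  show "c i \<le> level (torsion_of c) i"
  proof (rule ccontr)
    assume "\<not> c i \<le> level (torsion_of c) i"
    then have ci: "0 < c i" "level (torsion_of c) i \<le> c i - 1" by auto
    then have sub: "torsion_of c \<subseteq> level_class i (c i - 1)"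
      using subset_level_class_level[OF torsion_class_torsion_of, of c i] level_class_mono[OF ci(2), of i] by blast
    have le: "c i \<le> top_level i" using c i by (simp add: admissible_def)
    show False
    proof (cases "c i = top_level i")
      case True
      obtain M :: "('k list, 'k list) module" where M: "fd_module K B M" "M \<notin> level_class i (top_level i - 1)" "\<And>j l. j \<noteq> i \<Longrightarrow> M \<in> level_class j l"
        using simple_witness[OF i] by blast
      have "M \<in> level_class i (c i)" using M(1) True by (simp add: level_class_top)
      then have "M \<in> torsion_of c" using M(3) unfolding torsion_of_iff by metis
      with sub M(2) True show False by auto
    next
      case False
      then obtain k where k: "i = Suc k" using ci le by (cases i) (auto simp: top_level_def)
      have ck: "c k = top_level k"
      proof (rule ccontr)
        assume "c k \<noteq> top_level k"
        then have "c k < top_level k" using c i k unfolding admissible_def by (metis Suc_lessD le_neq_implies_less)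
        then show False using c i k ci(1) False unfolding admissible_def by auto
      qed
      have top: "M \<in> level_class k (c k)" if "fd_module K B M" for M using that ck by (simp add: level_class_top)
      show False
      proof (cases "c i = top_level i - 1")
        case True
        obtain M :: "('k list, 'k list) module" where M: "fd_module K B M" "M \<in> level_class (Suc k) (top_level (Suc k) - 1)"
          "M \<notin> level_class (Suc k) (top_level (Suc k) - 2)" "\<And>j l. j \<noteq> k \<Longrightarrow> j \<noteq> Suc k \<Longrightarrow> M \<in> level_class j l"
          using arrow_witness[of k] i k by blast
        have "M \<in> level_class j (c j)" for j
          using M(2) M(4)[of j] top[OF M(1)] True k by (cases "j = k"; cases "j = Suc k") auto
        then have "M \<in> torsion_of c" unfolding torsion_of_iff by blast
        moreover have "c i - 1 = top_level (Suc k) - 2" using True k by simp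
        ultimately show False using sub M(3) k by auto
      next
        case ne: False
        then have *: "0 < d" "i = 1" "c 1 = 1" "k = 0"
          using False le ci(1) k by (auto simp: top_level_def split: if_splits)
        obtain M :: "('k list, 'k list) module" where M: "fd_module K B M" "M \<in> level_class 1 1" "M \<notin> level_class 1 0"
          "\<And>j l. j \<noteq> 0 \<Longrightarrow> j \<noteq> 1 \<Longrightarrow> M \<in> level_class j l"
          using loop_witness[OF *(1)] by blast
        have "M \<in> level_class j (c j)" for j
          using M(2) M(4)[of j] top[OF M(1)] * by (cases "j = 0"; cases "j = 1") auto
        then have "M \<in> torsion_of c" unfolding torsion_of_iff by blast
        with sub M(3) * show False by auto
      qed
    qed
  qed
qed

lemma level_torsion_of_le:
  assumes "admissible c" "torsion_class K B T"
  shows "torsion_of c \<subseteq> T \<longleftrightarrow> (\<forall>i<n. c i \<le> level T i)" "T \<subseteq> torsion_of c \<longleftrightarrow> (\<forall>i<n. level T i \<le> c i)"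
  using subset_iff_level[OF torsion_class_torsion_of assms(2)] subset_iff_level[OF assms(2) torsion_class_torsion_of]
    level_torsion_of[OF assms(1)] by auto

text \<open>The element with number \<open>i\<close> of the chain has filled up the levels of the vertices before \<open>pos i\<close> and has
reached level \<open>i - start (pos i)\<close> at \<open>pos i\<close>; the next step raises this level by one. The families
\<open>lower_label i\<close> and \<open>upper_label i\<close> belong to the irreducible elements of this step. An intermediate level at \<open>pos i\<close>
is only admissible if the vertex before has its top level, whence the second case of \<open>lower_label\<close>.\<close>

definition start where "start k = (\<Sum>t<k. top_level t)"
definition len where "len = start n"
definition rung where "rung i k = min (top_level k) (i - start k)"
definition pos where "pos i = (LEAST k. i < start (Suc k))"
definition lower_label where
  "lower_label i k = (if k = pos i then Suc i - start k
     else if Suc k = pos i \<and> Suc i < start (Suc (pos i)) then top_level k else 0)"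
definition upper_label where
  "upper_label i k = (if k = pos i then i - start k else top_level k)"

lemma start_Suc: "start (Suc k) = start k + top_level k"
  by (simp add: start_def)

lemma start_mono: "k \<le> k' \<Longrightarrow> start k \<le> start k'"
  unfolding start_def by (rule sum_mono2) auto

lemma pos:
  assumes "i < len"
  shows "pos i < n" "start (pos i) \<le> i" "i < start (pos i) + top_level (pos i)"
proof -
  obtain m where m: "n = Suc m" using n_pos by (cases n) auto
  have "i < start (Suc m)" using assms[unfolded len_def, unfolded m] .
  then have P: "i < start (Suc (pos i))" and "pos i \<le> m"
    unfolding pos_def by (rule LeastI, rule Least_le)
  then show "pos i < n" "i < start (pos i) + top_level (pos i)" by (simp_all add: m start_Suc)
  show "start (pos i) \<le> i"
  proof (cases "pos i")
    case 0
    then show ?thesis by (simp add: start_def)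
  next
    case (Suc k)
    then have "\<not> i < start (Suc k)" using not_less_Least[of k "\<lambda>k. i < start (Suc k)"] by (simp add: pos_def)
    then show ?thesis using Suc by simp
  qed
qed

lemma start_before: "k < k' \<Longrightarrow> start k + top_level k \<le> start k'"
  using start_mono[of "Suc k" k'] by (simp add: start_Suc)

lemma admissible_rung: "admissible (rung i)"
  by (auto simp: admissible_def rung_def start_Suc)

lemma sum_rung: "(\<Sum>k<m. rung i k) = min i (start m)"
  by (induction m) (auto simp: rung_def start_def)

lemma rung_pos:
  assumes i: "i < len" and p: "p = pos i"
  shows "k < p \<Longrightarrow> rung i k = top_level k" "k < p \<Longrightarrow> rung (Suc i) k = top_level k"
    "rung i p = i - start p" "rung (Suc i) p = Suc i - start p"
    "p < k \<Longrightarrow> rung i k = 0" "p < k \<Longrightarrow> rung (Suc i) k = 0"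
  using pos[OF i] start_before[of k p] start_before[of p k] unfolding p[symmetric] rung_def by auto

lemma admissible_lower_label: "i < len \<Longrightarrow> admissible (lower_label i)"
  unfolding admissible_def
proof (intro conjI allI impI)
  assume i: "i < len"
  note p = pos[OF i]
  show "lower_label i k \<le> top_level k" for k using p by (auto simp: lower_label_def)
  fix k assume lt: "lower_label i k < top_level k"
  show "lower_label i (Suc k) = 0 \<or> lower_label i (Suc k) = top_level (Suc k)"
    using p lt by (auto simp: lower_label_def start_Suc split: if_splits)
qed

lemma admissible_upper_label: "i < len \<Longrightarrow> admissible (upper_label i)"
  using pos[of i] by (auto simp: admissible_def upper_label_def)

sublocale tors: complete_lattice "tors K B"
  by (rule complete_lattice_tors)

lemma carrier_tors: "T \<in> carrier (tors K B) \<longleftrightarrow> torsion_class K B T"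
  and le_tors: "T \<sqsubseteq>\<^bsub>tors K B\<^esub> T' \<longleftrightarrow> T \<subseteq> T'"
  by (simp_all add: tors_def)

lemma level_join_le:
  assumes T: "torsion_class K B T" "torsion_class K B T'" and k: "k < n"
  shows "level (T \<squnion>\<^bsub>tors K B\<^esub> T') k = max (level T k) (level T' k)"
proof (rule antisym)
  let ?c = "\<lambda>k. max (level T k) (level T' k)"
  have J: "torsion_class K B (T \<squnion>\<^bsub>tors K B\<^esub> T')"
    using tors.join_closed[of T T'] T by (simp add: carrier_tors)
  have v: "admissible ?c"
    using admissible_level[OF T(1)] admissible_level[OF T(2)] unfolding admissible_def by (auto simp: max_def)
  have "T \<squnion>\<^bsub>tors K B\<^esub> T' \<sqsubseteq>\<^bsub>tors K B\<^esub> torsion_of ?c"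
    by (rule tors.join_le)
      (use T in \<open>auto simp: carrier_tors le_tors torsion_class_torsion_of level_torsion_of_le(2)[OF v]\<close>)
  then show "level (T \<squnion>\<^bsub>tors K B\<^esub> T') k \<le> ?c k"
    using k by (simp add: le_tors level_torsion_of_le(2)[OF v J])
  have "T \<subseteq> T \<squnion>\<^bsub>tors K B\<^esub> T'" "T' \<subseteq> T \<squnion>\<^bsub>tors K B\<^esub> T'"
    using tors.join_left[of T T'] tors.join_right[of T T'] T by (auto simp: carrier_tors le_tors)
  then show "?c k \<le> level (T \<squnion>\<^bsub>tors K B\<^esub> T') k"
    using k subset_iff_level[OF T(1) J] subset_iff_level[OF T(2) J] by simp
qed

text \<open>Joins are pointwise maxima of levels. So for \<open>w \<sqsubseteq> y \<squnion> x\<close> the required \<open>v\<close> has the level of \<open>w\<close> wherever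
this is bounded by the level of \<open>x\<close>, and level \<open>0\<close> elsewhere, where the level of \<open>w\<close> is bounded by
that of \<open>y\<close>. It is admissible because the levels of a rung are \<open>0\<close> after the first one that is not the
top.\<close>

lemma rung_LM: "torsion_of (rung i) \<in> LM (tors K B)"
proof (rule tors.LM_if_small_approximation)
  show "torsion_of (rung i) \<in> carrier (tors K B)" by (simp add: carrier_tors torsion_class_torsion_of)
  fix y w assume "y \<in> carrier (tors K B)" "w \<in> carrier (tors K B)"
    and le: "w \<sqsubseteq>\<^bsub>tors K B\<^esub> y \<squnion>\<^bsub>tors K B\<^esub> torsion_of (rung i)"
  then have y: "torsion_class K B y" and w: "torsion_class K B w" by (simp_all add: carrier_tors)
  define v where "v k = (if level w k \<le> rung i k then level w k else 0)" for k
  have "admissible v"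
    unfolding admissible_def
  proof (intro conjI allI impI)
    show "v k \<le> top_level k" for k using level_le_top_level[OF w, of k] by (simp add: v_def)
    fix k assume k: "Suc k < n" and lt: "v k < top_level k"
    show "v (Suc k) = 0 \<or> v (Suc k) = top_level (Suc k)"
    proof (cases "rung i k = top_level k")
      case True
      then have "level w k < top_level k" using lt level_le_top_level[OF w, of k] by (simp add: v_def)
      then have "level w (Suc k) = 0 \<or> level w (Suc k) = top_level (Suc k)"
        using admissible_level[OF w] k by (simp add: admissible_def)
      then show ?thesis by (auto simp: v_def)
    next
      case False
      then have "rung i (Suc k) = 0" by (auto simp: rung_def start_Suc)
      then show ?thesis by (simp add: v_def)
    qed
  qed
  have J: "torsion_class K B (y \<squnion>\<^bsub>tors K B\<^esub> T)" if "torsion_class K B T" for T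
    using tors.join_closed[of y T] y that by (simp add: carrier_tors)
  have "level w k \<le> max (level y k) (rung i k)" if "k < n" for k
  proof -
    have "level w k \<le> level (y \<squnion>\<^bsub>tors K B\<^esub> torsion_of (rung i)) k"
      using le that subset_iff_level[OF w J[OF torsion_class_torsion_of]] by (simp add: le_tors)
    then show ?thesis
      by (simp only: level_join_le[OF y torsion_class_torsion_of that] level_torsion_of[OF admissible_rung that])
  qed
  then have "level w k \<le> max (level y k) (v k)" if "k < n" for k using that by (fastforce simp: v_def)
  then have "w \<subseteq> y \<squnion>\<^bsub>tors K B\<^esub> torsion_of v"
    using level_join_le[OF y torsion_class_torsion_of] level_torsion_of[OF \<open>admissible v\<close>]
      subset_iff_level[OF w J[OF torsion_class_torsion_of]] by simp
  moreover have "torsion_of v \<subseteq> torsion_of (rung i)" "torsion_of v \<subseteq> w"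
    using level_torsion_of_le(1)[OF \<open>admissible v\<close> torsion_class_torsion_of] level_torsion_of[OF admissible_rung] level_torsion_of_le(1)[OF \<open>admissible v\<close> w]
    by (auto simp: v_def)
  ultimately show "\<exists>v\<in>carrier (tors K B). v \<sqsubseteq>\<^bsub>tors K B\<^esub> torsion_of (rung i) \<and> v \<sqsubseteq>\<^bsub>tors K B\<^esub> w \<and>
      w \<sqsubseteq>\<^bsub>tors K B\<^esub> y \<squnion>\<^bsub>tors K B\<^esub> v"
    by (intro bexI[of _ "torsion_of v"]) (simp_all add: le_tors carrier_tors torsion_class_torsion_of)
qed

lemma step_iff:
  assumes i: "i < len" and T: "torsion_class K B T"
  shows "T \<subseteq> torsion_of (rung (Suc i)) \<and> \<not> T \<subseteq> torsion_of (rung i) \<longleftrightarrow>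
      level T (pos i) = Suc i - start (pos i) \<and> (\<forall>k<n. pos i < k \<longrightarrow> level T k = 0)"
    and "torsion_of (rung i) \<subseteq> T \<and> \<not> torsion_of (rung (Suc i)) \<subseteq> T \<longleftrightarrow>
      level T (pos i) = i - start (pos i) \<and> (\<forall>k<pos i. level T k = top_level k)"
proof -
  define p where "p = pos i"
  note r = rung_pos[OF i p_def]
  have p: "p < n" "start p \<le> i" "i < start p + top_level p" using pos[OF i] by (simp_all add: p_def)
  have all: "(\<forall>k<n. P k) \<longleftrightarrow> (\<forall>k<p. P k) \<and> P p \<and> (\<forall>k<n. p < k \<longrightarrow> P k)" for P
    using p(1) by (auto, metis linorder_neqE_nat)
  have le: "level T k \<le> top_level k" for k by (rule level_le_top_level[OF T])
  show "T \<subseteq> torsion_of (rung (Suc i)) \<and> \<not> T \<subseteq> torsion_of (rung i) \<longleftrightarrow>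
      level T (pos i) = Suc i - start (pos i) \<and> (\<forall>k<n. pos i < k \<longrightarrow> level T k = 0)"
    unfolding level_torsion_of_le(2)[OF admissible_rung T] p_def[symmetric] all[of "\<lambda>k. level T k \<le> rung _ k"]
    using p le by (auto simp: r)
  have eq: "top_level k \<le> level T k \<longleftrightarrow> level T k = top_level k" for k using le[of k] by auto
  show "torsion_of (rung i) \<subseteq> T \<and> \<not> torsion_of (rung (Suc i)) \<subseteq> T \<longleftrightarrow>
      level T (pos i) = i - start (pos i) \<and> (\<forall>k<pos i. level T k = top_level k)"
    unfolding level_torsion_of_le(1)[OF admissible_rung T] p_def[symmetric] all[of "\<lambda>k. rung _ k \<le> level T k"]
    using p by (auto simp: r eq)
qed

lemma ladder:
  "left_modular_ladder (tors K B) (\<lambda>T. \<Sum>k<n. level T k) len (\<lambda>i. torsion_of (rung i)) (\<lambda>i. torsion_of (lower_label i)) (\<lambda>i. torsion_of (upper_label i))"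
proof (intro left_modular_ladder.intro left_modular_ladder_axioms.intro tors.complete_lattice_axioms)
  fix T T' assume "T \<in> carrier (tors K B)" "T' \<in> carrier (tors K B)" and lt: "T \<sqsubset>\<^bsub>tors K B\<^esub> T'"
  then have T: "torsion_class K B T" "torsion_class K B T'" by (simp_all add: carrier_tors)
  have "T \<subseteq> T'" "\<not> T' \<subseteq> T" using lt by (auto simp: tors.lless_iff le_tors)
  then show "(\<Sum>k<n. level T k) < (\<Sum>k<n. level T' k)"
    unfolding subset_iff_level[OF T] subset_iff_level[OF T(2,1)]
    by (intro sum_strict_mono_ex1) (auto simp: not_le)
next
  fix T assume "T \<in> carrier (tors K B)"
  then show "(\<Sum>k<n. level T k) \<le> len"
    unfolding len_def start_def by (intro sum_mono level_le_top_level) (simp add: carrier_tors)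
next
  fix i assume "i \<le> len"
  then show "(\<Sum>k<n. level (torsion_of (rung i)) k) = i"
    using level_torsion_of[OF admissible_rung] sum_rung[of i n] by (simp add: len_def)
next
  fix i
  show "torsion_of (rung i) \<sqsubseteq>\<^bsub>tors K B\<^esub> torsion_of (rung (Suc i))"
    unfolding le_tors by (rule torsion_of_mono) (auto simp: rung_def)
next
  fix i assume i: "i < len"
  let ?S = "{z \<in> carrier (tors K B). z \<sqsubseteq>\<^bsub>tors K B\<^esub> torsion_of (rung (Suc i)) \<and> \<not> z \<sqsubseteq>\<^bsub>tors K B\<^esub> torsion_of (rung i)}"
  define p where "p = pos i"
  have p: "p < n" "start p \<le> i" "i < start p + top_level p" using pos[OF i] by (simp_all add: p_def)
  have "torsion_of (lower_label i) \<in> ?S"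
    using step_iff(1)[OF i torsion_class_torsion_of, of "lower_label i"] level_torsion_of[OF admissible_lower_label[OF i]] p(1)
    by (auto simp: carrier_tors le_tors torsion_class_torsion_of p_def[symmetric] lower_label_def)
  moreover have "torsion_of (lower_label i) \<sqsubseteq>\<^bsub>tors K B\<^esub> z" if "z \<in> ?S" for z
  proof -
    have z: "torsion_class K B z" using that by (simp add: carrier_tors)
    have lz: "level z p = Suc i - start p" using step_iff(1)[OF i z] that by (simp add: le_tors p_def)
    have "lower_label i k \<le> level z k" if k: "k < n" for k
    proof (cases "Suc k = p \<and> Suc i < start (Suc p)")
      case True
      have "level z k = top_level k"
      proof (rule ccontr)
        assume "level z k \<noteq> top_level k"
        then have "level z k < top_level k" using level_le_top_level[OF z, of k] by simp
        moreover have "Suc k < n" using True p(1) by simp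
        ultimately have "level z (Suc k) = 0 \<or> level z (Suc k) = top_level (Suc k)"
          using admissible_level[OF z] by (simp add: admissible_def)
        then have "level z p = 0 \<or> level z p = top_level p" using True by simp
        then show False using True lz p by (auto simp: start_Suc)
      qed
      then show ?thesis using True by (auto simp: lower_label_def p_def)
    qed (use lz in \<open>auto simp: lower_label_def p_def\<close>)
    then show ?thesis by (simp add: le_tors level_torsion_of_le(1)[OF admissible_lower_label[OF i] z])
  qed
  ultimately show "least (tors K B) (torsion_of (lower_label i)) ?S" by (auto simp: least_def)
next
  fix i assume i: "i < len"
  let ?S = "{z \<in> carrier (tors K B). torsion_of (rung i) \<sqsubseteq>\<^bsub>tors K B\<^esub> z \<and> \<not> torsion_of (rung (Suc i)) \<sqsubseteq>\<^bsub>tors K B\<^esub> z}"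
  define p where "p = pos i"
  have p: "p < n" using pos[OF i] by (simp add: p_def)
  have "torsion_of (upper_label i) \<in> ?S"
    using step_iff(2)[OF i torsion_class_torsion_of, of "upper_label i"] level_torsion_of[OF admissible_upper_label[OF i]] p
    by (auto simp: carrier_tors le_tors torsion_class_torsion_of p_def[symmetric] upper_label_def)
  moreover have "z \<sqsubseteq>\<^bsub>tors K B\<^esub> torsion_of (upper_label i)" if "z \<in> ?S" for z
  proof -
    have z: "torsion_class K B z" using that by (simp add: carrier_tors)
    have lz: "level z p = i - start p" using step_iff(2)[OF i z] that by (simp add: le_tors p_def)
    have "level z k \<le> upper_label i k" for k
      using lz level_le_top_level[OF z, of k] by (auto simp: upper_label_def p_def)
    then show ?thesis by (simp add: le_tors level_torsion_of_le(2)[OF admissible_upper_label[OF i] z])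
  qed
  ultimately show "greatest (tors K B) (torsion_of (upper_label i)) ?S" by (auto simp: greatest_def)
qed (rule rung_LM)

lemma len_eq: "len = 2 * n - 1 + (if 0 < d then 1 else 0)"
proof -
  have "start (Suc (Suc m)) = 2 * m + 3 + (if 0 < d then 1 else 0)" for m
    by (induction m) (auto simp: start_def top_level_def numeral_eq_Suc)
  note start = this
  obtain m where m: "n = Suc (Suc m)" using n2 by (metis add_2_eq_Suc le_Suc_ex)
  have "len = start (Suc (Suc m))" unfolding len_def unfolding m ..
  moreover have "2 * n - 1 = 2 * m + 3" using m by simp
  ultimately show ?thesis unfolding start by simp
qed

end

section \<open>Lattices of subsets\<close>

definition Pow_lattice :: "'c set \<Rightarrow> 'c set gorder" where
  "Pow_lattice F = \<lparr>carrier = Pow F, eq = (=), le = (\<subseteq>)\<rparr>"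

lemma Pow_lattice_simps [simp]:
  "x \<in> carrier (Pow_lattice F) \<longleftrightarrow> x \<subseteq> F" "x \<sqsubseteq>\<^bsub>Pow_lattice F\<^esub> y \<longleftrightarrow> x \<subseteq> y"
  "x \<sqsubset>\<^bsub>Pow_lattice F\<^esub> y \<longleftrightarrow> x \<subset> y"
  by (auto simp: Pow_lattice_def lless_def)

lemma complete_lattice_Pow_lattice: "complete_lattice (Pow_lattice F)"
  unfolding Pow_lattice_def by (rule powerset_is_complete_lattice)

lemma Sup_Pow_lattice: "S \<subseteq> Pow F \<Longrightarrow> \<Squnion>\<^bsub>Pow_lattice F\<^esub>S = \<Union>S"
proof -
  assume S: "S \<subseteq> Pow F"
  interpret L: complete_lattice "Pow_lattice F" by (rule complete_lattice_Pow_lattice)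
  have c: "S \<subseteq> carrier (Pow_lattice F)" using S by auto
  have "\<Squnion>\<^bsub>Pow_lattice F\<^esub>S \<subseteq> \<Union>S" using L.sup_least[OF c, of "\<Union>S"] S by auto
  moreover have "\<Union>S \<subseteq> \<Squnion>\<^bsub>Pow_lattice F\<^esub>S" using L.sup_upper[OF c] by auto
  ultimately show ?thesis by blast
qed

lemma Inf_Pow_lattice: "S \<subseteq> Pow F \<Longrightarrow> \<Sqinter>\<^bsub>Pow_lattice F\<^esub>S = F \<inter> \<Inter>S"
proof -
  assume S: "S \<subseteq> Pow F"
  interpret L: complete_lattice "Pow_lattice F" by (rule complete_lattice_Pow_lattice)
  have c: "S \<subseteq> carrier (Pow_lattice F)" using S by auto
  have "F \<inter> \<Inter>S \<subseteq> \<Sqinter>\<^bsub>Pow_lattice F\<^esub>S" using L.inf_greatest[OF c, of "F \<inter> \<Inter>S"] by auto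
  moreover have "\<Sqinter>\<^bsub>Pow_lattice F\<^esub>S \<subseteq> F \<inter> \<Inter>S" using L.inf_lower[OF c] L.inf_closed[OF c] by auto
  ultimately show ?thesis by blast
qed

lemma join_Pow_lattice [simp]: "x \<subseteq> F \<Longrightarrow> y \<subseteq> F \<Longrightarrow> x \<squnion>\<^bsub>Pow_lattice F\<^esub> y = x \<union> y"
  by (simp add: join_def Sup_Pow_lattice)

lemma meet_Pow_lattice [simp]: "x \<subseteq> F \<Longrightarrow> y \<subseteq> F \<Longrightarrow> x \<sqinter>\<^bsub>Pow_lattice F\<^esub> y = x \<inter> y"
  by (auto simp: meet_def Inf_Pow_lattice)

lemma LM_Pow_lattice: "LM (Pow_lattice F) = Pow F"
proof -
  have "(y \<squnion>\<^bsub>Pow_lattice F\<^esub> x) \<sqinter>\<^bsub>Pow_lattice F\<^esub> z = y \<squnion>\<^bsub>Pow_lattice F\<^esub> (x \<sqinter>\<^bsub>Pow_lattice F\<^esub> z)"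
    if "x \<subseteq> F" "y \<subseteq> F" "z \<subseteq> F" "y \<subseteq> z" for x y z
  proof -
    have "x \<inter> z \<subseteq> F" "y \<union> x \<subseteq> F" using that by auto
    with that show ?thesis by auto
  qed
  then show ?thesis by (auto simp: LM_def)
qed

lemma JIc_Pow_lattice: "JIc (Pow_lattice F) = (\<lambda>a. {a}) ` F"
proof (intro equalityI subsetI)
  fix x assume x: "x \<in> JIc (Pow_lattice F)"
  then have xF: "x \<subseteq> F" and ne: "x \<noteq> {}" by (auto simp: JIc_def Sup_Pow_lattice)
  then obtain a where a: "a \<in> x" by blast
  have "x = {a}"
  proof (rule ccontr)
    assume "x \<noteq> {a}"
    then have "(\<lambda>a. {a}) ` x \<subseteq> {y \<in> carrier (Pow_lattice F). y \<sqsubset>\<^bsub>Pow_lattice F\<^esub> x}"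
      using xF a by auto
    then have "x \<noteq> \<Squnion>\<^bsub>Pow_lattice F\<^esub>((\<lambda>a. {a}) ` x)" using x unfolding JIc_def by blast
    moreover have "\<Squnion>\<^bsub>Pow_lattice F\<^esub>((\<lambda>a. {a}) ` x) = x" using xF by (subst Sup_Pow_lattice) auto
    ultimately show False by simp
  qed
  then show "x \<in> (\<lambda>a. {a}) ` F" using a xF by auto
next
  fix x assume "x \<in> (\<lambda>a. {a}) ` F"
  then obtain a where a: "a \<in> F" "x = {a}" by blast
  have "x \<noteq> \<Squnion>\<^bsub>Pow_lattice F\<^esub>S" if "S \<subseteq> {y \<in> carrier (Pow_lattice F). y \<sqsubset>\<^bsub>Pow_lattice F\<^esub> x}" for S
  proof -
    have "\<Union>S = {}" "S \<subseteq> Pow F" using that a(2) by auto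
    then show ?thesis using a(2) by (simp only: Sup_Pow_lattice) simp
  qed
  from this this[of "{}"] a show "x \<in> JIc (Pow_lattice F)" by (simp add: JIc_def)
qed

lemma MIc_Pow_lattice: "MIc (Pow_lattice F) = (\<lambda>a. F - {a}) ` F"
proof (intro equalityI subsetI)
  fix x assume x: "x \<in> MIc (Pow_lattice F)"
  then have xF: "x \<subseteq> F" and ne: "x \<noteq> F" by (auto simp: MIc_def Inf_Pow_lattice)
  then obtain a where a: "a \<in> F - x" by blast
  have "x = F - {a}"
  proof (rule ccontr)
    assume "x \<noteq> F - {a}"
    then have "(\<lambda>a. F - {a}) ` (F - x) \<subseteq> {y \<in> carrier (Pow_lattice F). x \<sqsubset>\<^bsub>Pow_lattice F\<^esub> y}"
      using xF a by auto
    then have "x \<noteq> \<Sqinter>\<^bsub>Pow_lattice F\<^esub>((\<lambda>a. F - {a}) ` (F - x))" using x unfolding MIc_def by blast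
    moreover have "\<Sqinter>\<^bsub>Pow_lattice F\<^esub>((\<lambda>a. F - {a}) ` (F - x)) = x" using xF by (subst Inf_Pow_lattice) auto
    ultimately show False by simp
  qed
  then show "x \<in> (\<lambda>a. F - {a}) ` F" using a xF by auto
next
  fix x assume "x \<in> (\<lambda>a. F - {a}) ` F"
  then obtain a where a: "a \<in> F" "x = F - {a}" by blast
  have "x \<noteq> \<Sqinter>\<^bsub>Pow_lattice F\<^esub>S" if "S \<subseteq> {y \<in> carrier (Pow_lattice F). x \<sqsubset>\<^bsub>Pow_lattice F\<^esub> y}" for S
  proof -
    have "a \<in> F \<inter> \<Inter>S" "S \<subseteq> Pow F" using that a by auto
    then show ?thesis using a(2) by (auto simp: Inf_Pow_lattice)
  qed
  from this this[of "{}"] a show "x \<in> MIc (Pow_lattice F)" by (simp add: MIc_def)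
qed

lemma maximal_chain_of_subset: "maximal_chain_of (Pow_lattice F) C \<Longrightarrow> C \<subseteq> Pow F"
  unfolding maximal_chain_of_def pred_on.maxchain_def pred_on.chain_def
  by (elim conjE) (auto simp: Pow_lattice_def)

lemma extremal_lattice_Pow_lattice:
  assumes X: "maximal_chain_of (Pow_lattice F) X"
  shows "extremal_lattice (Pow_lattice F)"
  unfolding extremal_lattice_def
proof (intro conjI exI[of _ "\<lambda>j. F - j"] exI[of _ X] impI ballI complete_lattice_Pow_lattice X)
  show "bij_betw ((-) F) (JIc (Pow_lattice F)) (MIc (Pow_lattice F))"
    unfolding JIc_Pow_lattice MIc_Pow_lattice by (auto simp: bij_betw_def inj_on_def image_image)
next
  fix j assume "j \<in> JIc (Pow_lattice F)"
  then obtain a where a: "a \<in> F" "j = {a}" by (auto simp: JIc_Pow_lattice)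
  have "{y \<in> carrier (Pow_lattice F). y \<sqsubset>\<^bsub>Pow_lattice F\<^esub> j} = {{}}" using a by auto
  then have "lower_star (Pow_lattice F) j = {}" by (simp add: lower_star_def Sup_Pow_lattice)
  then show "is_kappa (Pow_lattice F) j (F - j)"
    using a by (auto simp: is_kappa_def greatest_def)
next
  fix x j assume x: "x \<in> X" and "j \<in> JIc (Pow_lattice F)" "\<not> j \<sqsubseteq>\<^bsub>Pow_lattice F\<^esub> x"
  moreover have "x \<subseteq> F" using maximal_chain_of_subset[OF X] x by blast
  ultimately show "x \<sqsubseteq>\<^bsub>Pow_lattice F\<^esub> F - j" by (auto simp: JIc_Pow_lattice)
next
  fix x y assume "covers (Pow_lattice F) x y"
  then have x: "x \<subseteq> F" "y \<subseteq> F" "x \<subset> y" and no: "\<And>z. z \<subseteq> F \<Longrightarrow> x \<subset> z \<Longrightarrow> \<not> z \<subset> y"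
    by (auto simp: covers_def)
  then obtain a where a: "a \<in> y" "a \<notin> x" by blast
  have "y = insert a x" using no[of "insert a x"] x a by auto
  then have "{j' \<in> JIc (Pow_lattice F). j' \<sqsubseteq>\<^bsub>Pow_lattice F\<^esub> y \<and> \<not> j' \<sqsubseteq>\<^bsub>Pow_lattice F\<^esub> x} = {{a}}"
    "{m' \<in> MIc (Pow_lattice F). x \<sqsubseteq>\<^bsub>Pow_lattice F\<^esub> m' \<and> \<not> y \<sqsubseteq>\<^bsub>Pow_lattice F\<^esub> m'} = {F - {a}}"
    using x a by (auto simp: JIc_Pow_lattice MIc_Pow_lattice)
  then show "\<exists>j m. {j' \<in> JIc (Pow_lattice F). j' \<sqsubseteq>\<^bsub>Pow_lattice F\<^esub> y \<and> \<not> j' \<sqsubseteq>\<^bsub>Pow_lattice F\<^esub> x} = {j} \<and>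
      {m' \<in> MIc (Pow_lattice F). x \<sqsubseteq>\<^bsub>Pow_lattice F\<^esub> m' \<and> \<not> y \<sqsubseteq>\<^bsub>Pow_lattice F\<^esub> m'} = {m} \<and> F - j = m"
    by blast
qed

text \<open>The initial segments of a well-order form a maximal chain of sets: a set that is comparable
  with all of them is closed downwards.\<close>

lemma maximal_chain_of_ofilters:
  assumes s: "Well_order s" "Field s = F"
  shows "maximal_chain_of (Pow_lattice F) {D. wo_rel.ofilter s D}"
proof -
  interpret L: complete_lattice "Pow_lattice F" by (rule complete_lattice_Pow_lattice)
  interpret s: wo_rel s using s by (simp add: wo_rel_def)
  have sub: "D \<subseteq> F" if "s.ofilter D" for D using that s(2) by (simp add: s.ofilter_def)
  have "D \<in> {D. s.ofilter D}" if D: "D \<subseteq> F" and cmp: "\<And>E. s.ofilter E \<Longrightarrow> E \<subseteq> D \<or> D \<subseteq> E" for D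
  proof -
    have "y \<in> D" if "x \<in> D" "(y, x) \<in> s" for x y
    proof (rule ccontr)
      assume y: "y \<notin> D"
      then have "y \<noteq> x" using that by auto
      have "y \<in> s.under y" using that(2) s.REFL by (auto simp: under_def refl_on_def Field_def)
      then have "D \<subseteq> s.under y" using cmp[OF s.under_ofilter[of y]] y by blast
      then have "(x, y) \<in> s" using that(1) by (auto simp: under_def)
      then show False using that(2) \<open>y \<noteq> x\<close> s.ANTISYM by (auto simp: antisym_def)
    qed
    then show ?thesis using D s(2) by (auto simp: s.ofilter_def under_def)
  qed
  then show ?thesis
    unfolding L.maximal_chain_of_iff L.chain_of_iff using sub s.ofilter_linord by auto
qed

lemma card_of_finite_ordLeq: "finite A \<Longrightarrow> infinite B \<Longrightarrow> |A| \<le>o |B|"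
  by (rule ordLess_imp_ordLeq, rule finite_ordLess_infinite)
    (simp_all add: card_of_well_order_on Field_card_of)

lemma card_ofilters:
  assumes s: "Well_order s" "Field s = F" and inf: "infinite F"
  shows "|{D. wo_rel.ofilter s D}| =o |F|"
proof -
  interpret s: wo_rel s using s by (simp add: wo_rel_def)
  have eq: "{D. s.ofilter D} = s.underS ` F \<union> {F}"
    using s.ofilter_underS_Field s(2) by auto
  have inj: "inj_on s.underS F"
  proof (rule inj_onI, rule ccontr)
    fix a c assume ac: "a \<in> F" "c \<in> F" "s.underS a = s.underS c" "a \<noteq> c"
    then have "(a, c) \<in> s \<or> (c, a) \<in> s" using s.TOTAL s(2) by (auto simp: total_on_def)
    then have "a \<in> s.underS c \<or> c \<in> s.underS a" using ac(4) by (auto simp: underS_def)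
    then show False using ac(3) by (auto simp: underS_def)
  qed
  have "|s.underS ` F \<union> {F}| \<le>o |F|"
    by (rule card_of_Un_ordLeq_infinite_Field)
      (use inf in \<open>simp_all add: Field_card_of card_of_card_order_on card_of_image card_of_finite_ordLeq\<close>)
  moreover have "|F| \<le>o |s.underS ` F \<union> {F}|"
    by (rule card_of_ordLeqI[OF inj]) auto
  ultimately show ?thesis unfolding eq by (simp add: ordIso_iff_ordLeq)
qed

lemma card_Pow: "Card_order r \<Longrightarrow> |Pow (Field r)| =o ctwo ^c r"
  using card_of_Pow_Func[of "Field r"] by (simp add: cexp_def ctwo_def Field_card_of)

text \<open>The lower bound: on pairs of points that fill \<open>F\<close>, the order within each pair can be chosen
  freely, and the chain of initial segments remembers the choice.\<close>

lemma many_ofilter_chains: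
  assumes r: "Well_order r" and inf: "infinite (Field r)"
  shows "|Pow (Field r)| \<le>o |(\<lambda>s. {D. wo_rel.ofilter s D}) ` {s. Well_order s \<and> Field s = Field r}|"
proof -
  let ?F = "Field r"
  interpret r: wo_rel r using r by (simp add: wo_rel_def)
  have "|?F \<times> (UNIV :: bool set)| =o |?F|"
    by (rule card_of_Times_infinite[THEN conjunct1])
      (use inf in \<open>simp_all add: card_of_finite_ordLeq\<close>)
  then obtain h :: "'a \<times> bool \<Rightarrow> 'a" where h: "bij_betw h (?F \<times> UNIV) ?F"
    unfolding card_of_ordIso[symmetric] by blast
  have hF: "h (a, t) \<in> ?F" if "a \<in> ?F" for a t using h that by (auto simp: bij_betw_def)
  have hinj: "h (a, t) = h (c, u) \<longleftrightarrow> a = c \<and> t = u" if "a \<in> ?F" "c \<in> ?F" for a c t u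
    using h that by (auto simp: bij_betw_def inj_on_def)
  have hsurj: "\<exists>a\<in>?F. \<exists>t. z = h (a, t)" if "z \<in> ?F" for z
  proof -
    have "z \<in> h ` (?F \<times> UNIV)" using h that by (simp add: bij_betw_def)
    then show ?thesis by auto
  qed
  define dec where "dec C = {a \<in> ?F. \<exists>D\<in>C. h (a, False) \<in> D \<and> h (a, True) \<notin> D}" for C
  have "Pow ?F \<subseteq> dec ` (\<lambda>s. {D. wo_rel.ofilter s D}) ` {s. Well_order s \<and> Field s = ?F}"
  proof
    fix A assume "A \<in> Pow ?F"
    define Sw where "Sw = {a \<in> ?F. (a \<in> A) \<noteq> ((h (a, False), h (a, True)) \<in> r)}"
    define \<pi> where "\<pi> z = (case inv_into (?F \<times> UNIV) h z of (a, t) \<Rightarrow> h (a, t \<noteq> (a \<in> Sw)))" for z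
    have \<pi>h: "\<pi> (h (a, t)) = h (a, t \<noteq> (a \<in> Sw))" if "a \<in> ?F" for a t
      using h that by (simp add: \<pi>_def bij_betw_def inv_into_f_f)
    have \<pi>F: "\<pi> z \<in> ?F" "\<pi> (\<pi> z) = z" if z: "z \<in> ?F" for z
    proof -
      obtain a t where "a \<in> ?F" "z = h (a, t)" using hsurj[OF z] by blast
      moreover have "((t \<noteq> (a \<in> Sw)) \<noteq> (a \<in> Sw)) = t" by blast
      ultimately show "\<pi> z \<in> ?F" "\<pi> (\<pi> z) = z" by (simp_all only: \<pi>h hF)
    qed
    have inj: "inj_on \<pi> ?F" by (rule inj_on_inverseI[of _ \<pi>]) (rule \<pi>F)
    have im: "\<pi> ` ?F = ?F"
    proof
      show "?F \<subseteq> \<pi> ` ?F"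
      proof
        fix x assume "x \<in> ?F"
        then show "x \<in> \<pi> ` ?F" using image_eqI[of x \<pi> "\<pi> x" ?F] \<pi>F by simp
      qed
    qed (use \<pi>F(1) in blast)
    define s where "s = dir_image r \<pi>"
    have s: "Well_order s" "Field s = ?F"
      using Well_order_dir_image[OF r inj] by (simp_all add: s_def dir_image_Field im)
    interpret s: wo_rel s using s by (simp add: wo_rel_def)
    have in_s: "(z, w) \<in> s \<longleftrightarrow> (\<pi> z, \<pi> w) \<in> r" if "z \<in> ?F" "w \<in> ?F" for z w
    proof
      assume "(z, w) \<in> s"
      then obtain x y where xy: "(x, y) \<in> r" "z = \<pi> x" "w = \<pi> y" by (auto simp: s_def dir_image_def)
      then have "x \<in> ?F" "y \<in> ?F" by (auto simp: Field_def)
      with xy show "(\<pi> z, \<pi> w) \<in> r" by (simp add: \<pi>F)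
    next
      assume "(\<pi> z, \<pi> w) \<in> r"
      then have "(\<pi> (\<pi> z), \<pi> (\<pi> w)) \<in> s" by (auto simp: s_def dir_image_def)
      with that show "(z, w) \<in> s" by (simp add: \<pi>F)
    qed
    have "a \<in> dec {D. s.ofilter D} \<longleftrightarrow> a \<in> A" if a: "a \<in> ?F" for a
    proof -
      let ?p = "h (a, False)" and ?q = "h (a, True)"
      have pq: "?p \<in> ?F" "?q \<in> ?F" "?p \<noteq> ?q" using hF[OF a] hinj[OF a a] by auto
      have "a \<in> dec {D. s.ofilter D} \<longleftrightarrow> (?p, ?q) \<in> s"
      proof
        assume "a \<in> dec {D. s.ofilter D}"
        then obtain D where D: "s.ofilter D" "?p \<in> D" "?q \<notin> D" by (auto simp: dec_def)
        then have "(?q, ?p) \<notin> s" by (auto simp: s.ofilter_def under_def)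
        then show "(?p, ?q) \<in> s" using s.TOTAL pq s(2) by (auto simp: total_on_def)
      next
        assume "(?p, ?q) \<in> s"
        then have "?p \<in> s.underS ?q" "?q \<notin> s.underS ?q" using pq by (auto simp: underS_def)
        then show "a \<in> dec {D. s.ofilter D}" using a s.underS_ofilter[of ?q] by (auto simp: dec_def)
      qed
      also have "\<dots> \<longleftrightarrow> (if a \<in> Sw then (?q, ?p) \<in> r else (?p, ?q) \<in> r)"
        using in_s[OF pq(1,2)] by (simp add: \<pi>h a)
      also have "\<dots> \<longleftrightarrow> a \<in> A"
      proof (cases "a \<in> Sw")
        case True
        have "(?q, ?p) \<in> r \<longleftrightarrow> (?p, ?q) \<notin> r"
          using r.TOTAL r.ANTISYM pq by (auto simp: total_on_def antisym_def)
        then show ?thesis using True by (auto simp: Sw_def)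
      next
        case False
        then show ?thesis using a by (auto simp: Sw_def)
      qed
      finally show ?thesis .
    qed
    then have "dec {D. s.ofilter D} = A" using \<open>A \<in> Pow ?F\<close> by (auto simp: dec_def)
    then show "A \<in> dec ` (\<lambda>s. {D. wo_rel.ofilter s D}) ` {s. Well_order s \<and> Field s = ?F}"
      using s by blast
  qed
  then have "|Pow ?F| \<le>o |dec ` (\<lambda>s. {D. wo_rel.ofilter s D}) ` {s. Well_order s \<and> Field s = ?F}|"
    by (rule card_of_mono1)
  then show ?thesis by (rule ordLeq_transitive[OF _ card_of_image])
qed

text \<open>Each such family is the image of a map from \<open>Field r\<close> to its power set, and
\<open>(2\<^sup>r)\<^sup>r = 2\<^sup>r\<close>.\<close>

lemma card_families_le:
  assumes r: "Cinfinite r"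
  shows "|{C. C \<subseteq> Pow (Field r) \<and> |C| =o r}| \<le>o ctwo ^c r"
proof -
  let ?F = "Field r"
  have rF: "|?F| =o r" using r by (simp add: card_of_Field_ordIso)
  have "{C. C \<subseteq> Pow ?F \<and> |C| =o r} \<subseteq> (\<lambda>f. f ` ?F) ` Func ?F (Pow ?F)"
  proof
    fix C assume "C \<in> {C. C \<subseteq> Pow ?F \<and> |C| =o r}"
    then have C: "C \<subseteq> Pow ?F" "|C| =o r" by auto
    have "|?F| =o |C|" using rF C(2) ordIso_symmetric ordIso_transitive by blast
    then obtain f where f: "bij_betw f ?F C" unfolding card_of_ordIso[symmetric] by blast
    define g where "g x = (if x \<in> ?F then f x else undefined)" for x
    have "g \<in> Func ?F (Pow ?F)" "g ` ?F = C"
      using f C(1) by (auto simp: Func_def g_def bij_betw_def)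
    then show "C \<in> (\<lambda>f. f ` ?F) ` Func ?F (Pow ?F)" by blast
  qed
  then have "|{C. C \<subseteq> Pow ?F \<and> |C| =o r}| \<le>o |Func ?F (Pow ?F)|"
    by (rule ordLeq_transitive[OF card_of_mono1 card_of_image])
  moreover have "|Func ?F (Pow ?F)| =o (ctwo ^c r) ^c r"
  proof -
    have "|Func ?F (Pow ?F)| = |Pow ?F| ^c r" by (simp add: cexp_def Field_card_of)
    moreover have "|Pow ?F| ^c r =o (ctwo ^c r) ^c r"
      using r by (intro cexp_cong1 card_Pow) auto
    ultimately show ?thesis by simp
  qed
  moreover have "(ctwo ^c r) ^c r =o ctwo ^c r"
    by (rule cexp_cprod_ordLeq) (use r in \<open>auto simp: Card_order_ctwo Cinfinite_Cnotzero ordLeq_refl\<close>)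
  ultimately show ?thesis using ordLeq_ordIso_trans ordIso_transitive by blast
qed

theorem Pow_lattice_maximal_chains:
  assumes r: "Cinfinite r"
  shows "left_modular_lattice (Pow_lattice (Field r))" "extremal_lattice (Pow_lattice (Field r))"
    and "|{C. maximal_chain_of (Pow_lattice (Field r)) C \<and> C \<subseteq> LM (Pow_lattice (Field r)) \<and> |C| =o r}| =o ctwo ^c r"
    and "|LM (Pow_lattice (Field r))| =o ctwo ^c r"
proof -
  let ?F = "Field r" and ?L = "Pow_lattice (Field r)"
  have wo: "Well_order r" using r by (simp add: card_order_on_well_order_on)
  have inf: "infinite ?F" using r by (simp add: cinfinite_def)
  have rF: "|?F| =o r" using r by (simp add: card_of_Field_ordIso)
  note sub = maximal_chain_of_subset[of "Field r"]
  have mx: "maximal_chain_of ?L {D. wo_rel.ofilter r D}" by (rule maximal_chain_of_ofilters[OF wo refl])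
  show "left_modular_lattice ?L"
    unfolding left_modular_lattice_def LM_Pow_lattice
    using complete_lattice_Pow_lattice mx sub by blast
  show "extremal_lattice ?L" by (rule extremal_lattice_Pow_lattice[OF mx])
  show "|LM ?L| =o ctwo ^c r" unfolding LM_Pow_lattice using r by (simp add: card_Pow)
  let ?M = "{C. maximal_chain_of ?L C \<and> C \<subseteq> LM ?L \<and> |C| =o r}"
  have "(\<lambda>s. {D. wo_rel.ofilter s D}) ` {s. Well_order s \<and> Field s = ?F} \<subseteq> ?M"
  proof (rule image_subsetI)
    fix s assume "s \<in> {s. Well_order s \<and> Field s = ?F}"
    then have s: "Well_order s" "Field s = ?F" by auto
    have m: "maximal_chain_of ?L {D. wo_rel.ofilter s D}" by (rule maximal_chain_of_ofilters[OF s])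
    moreover have "{D. wo_rel.ofilter s D} \<subseteq> LM ?L" unfolding LM_Pow_lattice by (rule sub[OF m])
    moreover have "|{D. wo_rel.ofilter s D}| =o r"
      by (rule ordIso_transitive[OF card_ofilters[OF s inf] rF])
    ultimately show "{D. wo_rel.ofilter s D} \<in> ?M" by simp
  qed
  then have "|Pow ?F| \<le>o |?M|"
    by (intro ordLeq_transitive[OF many_ofilter_chains[OF wo inf]] card_of_mono1)
  moreover have "ctwo ^c r =o |Pow ?F|" using card_Pow r ordIso_symmetric by blast
  ultimately have "ctwo ^c r \<le>o |?M|" using ordIso_ordLeq_trans by blast
  moreover have "|?M| \<le>o |{C. C \<subseteq> Pow ?F \<and> |C| =o r}|"
    by (rule card_of_mono1) (use sub in blast)
  then have "|?M| \<le>o ctwo ^c r" by (rule ordLeq_transitive[OF _ card_families_le[OF r]])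
  ultimately show "|?M| =o ctwo ^c r" by (simp add: ordIso_iff_ordLeq)
qed

section \<open>Conclusion\<close>

text \<open>With \<open>n = (m + 1) div 2\<close> vertices, and \<open>Comp\<close> present for even \<open>m\<close>, the length is \<open>m\<close>; the number of the
loops \<open>Null j\<close> varies.\<close>

lemma many_left_modular_torsion_lattices:
  fixes K :: "('k, 'x) ring_scheme"
  assumes K: "field K" and m: "2 < m"
  shows "\<exists>\<A> :: ('k, 'k list) module set. infinite \<A> \<and>
     (\<forall>A\<in>\<A>. \<forall>B\<in>\<A>. A \<noteq> B \<longrightarrow> \<not> algebra_isomorphic K A B) \<and>
     (\<forall>A\<in>\<A>. fd_algebra K A \<and> connected_algebra A \<and>
        left_modular_lattice (tors K A) \<and> extremal_lattice (tors K A) \<and> has_length (tors K A) m)"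
proof -
  define n where "n = Suc m div 2"
  define d :: nat where "d = (if even m then 1 else 0)"
  have n: "2 \<le> n" using m by (simp add: n_def)
  have loc: "path_algebra_locale K n" by (intro path_algebra_locale.intro K path_algebra_locale_axioms.intro n)
  let ?P = "path_algebra K n d"
  have neq: "min_generators K (?P N) \<noteq> min_generators K (?P N')" if "N \<noteq> N'" for N N'
    using that min_generators_path_algebra_less[OF K n, of N N' d]
      min_generators_path_algebra_less[OF K n, of N' N d] by (cases N N' rule: linorder_cases) auto
  have inj: "inj ?P" by (rule injI) (metis neq)
  have fd: "fd_algebra K (?P N)" for N by (rule path_algebra_locale.fd_algebra_B[OF loc])
  have noniso: "\<not> algebra_isomorphic K (?P N) (?P N')" if "?P N \<noteq> ?P N'" for N N'
    using neq min_generators_if_algebra_isomorphic[OF fd fd] that by metis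
  have props: "connected_algebra (?P N) \<and> left_modular_lattice (tors K (?P N)) \<and>
      extremal_lattice (tors K (?P N)) \<and> has_length (tors K (?P N)) m" for N
  proof -
    interpret P: path_algebra_locale K n d N by (rule loc)
    interpret L: left_modular_ladder "tors K (?P N)" "\<lambda>T. \<Sum>k<n. P.level T k" P.len
        "\<lambda>i. P.torsion_of (P.rung i)" "\<lambda>i. P.torsion_of (P.lower_label i)" "\<lambda>i. P.torsion_of (P.upper_label i)"
      by (rule P.ladder)
    have "P.len = m" unfolding P.len_eq using m by (auto simp: n_def d_def elim!: evenE oddE)
    then show ?thesis
      using P.connected_algebra_B L.left_modular_lattice L.extremal_lattice L.has_length by simp
  qed
  have "infinite (range ?P)" using inj finite_imageD infinite_UNIV_nat by blast
  then show ?thesis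
    by (intro exI[of _ "range ?P"] conjI ballI impI)
      (use noniso fd props in auto)
qed

theorem corollary1p8:
  shows
    "(\<forall>K :: ('k, 'x) ring_scheme. field K \<longrightarrow>
       (\<forall>m :: nat. m > 4 \<longrightarrow>
         (\<exists>\<A> :: ('k, 'k list) module set.
            infinite \<A> \<and>
            (\<forall>A\<in>\<A>. \<forall>B\<in>\<A>. A \<noteq> B \<longrightarrow> \<not> algebra_isomorphic K A B) \<and>
            (\<forall>A\<in>\<A>. fd_algebra K A \<and> connected_algebra A \<and>
               left_modular_lattice (tors K A) \<and> extremal_lattice (tors K A) \<and>
               has_length (tors K A) m)))) \<and>
     (\<forall>r :: 'c rel. Cinfinite r \<longrightarrow>
       (\<exists>L :: 'c set gorder.
          left_modular_lattice L \<and> extremal_lattice L \<and>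
          |{C. maximal_chain_of L C \<and> C \<subseteq> LM L \<and> |C| =o r}| =o ctwo ^c r)) \<and>
     (\<forall>r :: 'c rel. Cinfinite r \<longrightarrow>
       (\<exists>L :: 'c set gorder. extremal_lattice L \<and> |LM L| =o ctwo ^c r))"
proof (intro conjI allI impI)
  fix K :: "('k, 'x) ring_scheme" and m :: nat
  assume "field K" and "4 < m"
  then show "\<exists>\<A> :: ('k, 'k list) module set. infinite \<A> \<and>
     (\<forall>A\<in>\<A>. \<forall>B\<in>\<A>. A \<noteq> B \<longrightarrow> \<not> algebra_isomorphic K A B) \<and>
     (\<forall>A\<in>\<A>. fd_algebra K A \<and> connected_algebra A \<and>
        left_modular_lattice (tors K A) \<and> extremal_lattice (tors K A) \<and> has_length (tors K A) m)"
    by (intro many_left_modular_torsion_lattices) auto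
next
  fix r :: "'c rel" assume r: "Cinfinite r"
  show "\<exists>L :: 'c set gorder. left_modular_lattice L \<and> extremal_lattice L \<and>
      |{C. maximal_chain_of L C \<and> C \<subseteq> LM L \<and> |C| =o r}| =o ctwo ^c r"
    by (intro exI[of _ "Pow_lattice (Field r)"] conjI Pow_lattice_maximal_chains[OF r])
next
  fix r :: "'c rel" assume r: "Cinfinite r"
  show "\<exists>L :: 'c set gorder. extremal_lattice L \<and> |LM L| =o ctwo ^c r"
    by (intro exI[of _ "Pow_lattice (Field r)"] conjI Pow_lattice_maximal_chains[OF r])
qed

end
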